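(* Let $(M,\mathcal{F},g)$ be a compact connected foliated Riemannian manifold of dimension $n+1$ with a codimension one foliation which is leafwise and transversely orientable. Let $\gamma:[0,1]\to M$ be a closed transversal curve, $N(\gamma)$ a fixed foliated tubular neighbourhood of $\gamma$, and let $\mathcal{F}_\gamma$ be the foliation of $M$ obtained from $\mathcal{F}$ by turbulization along $\gamma$ in $N(\gamma)$. Let $\pi:M\to\mathrm{HLS}(\mathcal{F})$ be the natural projection and let $(X,d_X)$ be the metric space obtained from $\mathrm{HLS}(\mathcal{F})$ by identifying $\pi(\gamma([0,1]))$ to a point, with the quotient metric. Then $\mathrm{HLS}(\mathcal{F}_\gamma)$ is isometric to $(X,d_X)$.
   Context: Hausdorff leaf space: for a compact connected foliated Riemannian manifold $(M,\mathcal{F},g)$ with Riemannian distance $d$ and set of leaves $\mathcal{L}$, put $\mathrm{dist}(L,L')=\inf\{d(x,y):x\in L,\,y\in L'\}$ and $$\rho(L,L')=\inf\Big\{\sum_{i=1}^{n-1}\mathrm{dist}(L_i,L_{i+1})\Big\},$$ the infimum being over all finite sequences of leaves $L_1,\dots,L_n$ with $L_1=L$, $L_n=L'$. Put $L\sim L'$ iff $\rho(L,L')=0$, $\tilde{\mathcal{L}}=\mathcal{L}/_\sim$ and $\tilde\rho([L],[L'])=\rho(L,L')$. The metric space $(\tilde{\mathcal{L}},\tilde\rho)$ is the Hausdorff leaf space $\mathrm{HLS}(\mathcal{F})$; the natural projection $M\to\mathrm{HLS}(\mathcal{F})$ sends $x$ to the class of the leaf through $x$. Both $\mathrm{HLS}(\mathcal{F})$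 and $\mathrm{HLS}(\mathcal{F}_\gamma)$ are taken with respect to the same metric $g$. Turbulization: $\gamma$ is a (simple) closed curve transverse to $\mathcal{F}$ and $N(\gamma)=D^n\times S^1$ carries cylindrical coordinates $(r,z,t)$, $t$ modulo $1$, $r\in[0,1]$ the radius and $z\in S^{n-1}$ the angular coordinate in $D^n$, such that the leaves of $\mathcal{F}|_{N(\gamma)}$ are the sets $D^n\times\{t\}$ and $\gamma$ is the core $r=0$. Let $\omega=\cos\lambda(r)\,dr+\sin\lambda(r)\,dt$, where $\lambda:[0,1]\to[-\pi/2,\pi/2]$ is smooth, strictly increasing on $[0,3/4]$, with $\lambda(0)=-\pi/2$, $\lambda(2/3)=0$, $\lambda(r)=\pi/2$ for all $r\ge 3/4$, and with derivatives of all orders at $0$ vanishing. The form $\omega$ is integrable and defines a foliation of $N(\gamma)$ that agrees with $\mathcal{F}$ near $\partial N(\gamma)$ and has a Reeb component inside $N(\gamma)$; $\mathcal{F}_\gamma$ is this foliation inside $N(\gamma)$ and $\mathcal{F}$ outside. Quotient metric: for a metric space $(Y,d)$ with an equivalence relation $R$, put $d_R(x,y)=\inf\sum_{i=1}^k d(p_i,q_i)$ over all $k$ and all $p_1,q_1,\dots,p_k,q_k\in Y$ with $p_1=x$, $q_k=y$ and $(p_{i+1},q_i)\in R$ for $1\le i<k$; points at $d_R$-distance $0$ are identified. *)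

theory Defs
  imports "HOL-Analysis.Analysis"
begin

section \<open>Smooth maps\<close>

text \<open>\<open>S\<close> is meant to be open. In finite dimension, continuity of all iterated directional
  derivatives is the usual notion of a \<open>C\<^sup>k\<close> map.\<close>

primrec Ck_on ::
  "nat \<Rightarrow> 'a::real_normed_vector set \<Rightarrow> ('a \<Rightarrow> 'b::real_normed_vector) \<Rightarrow> bool" where
  "Ck_on 0 S f \<longleftrightarrow> continuous_on S f"
| "Ck_on (Suc k) S f \<longleftrightarrow>
     (\<forall>x\<in>S. f differentiable (at x)) \<and>
     (\<forall>v. Ck_on k S (\<lambda>x. frechet_derivative f (at x) v))"

definition smooth_on ::
  "'a::real_normed_vector set \<Rightarrow> ('a \<Rightarrow> 'b::real_normed_vector) \<Rightarrow> bool" where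
  "smooth_on S f \<longleftrightarrow> (\<forall>k. Ck_on k S f)"

text \<open>\<open>D k\<close> is the \<open>k\<close>-th derivative of \<open>f\<close> on the interval \<open>I\<close>, one-sided at end points
  that belong to \<open>I\<close>.\<close>

definition iterated_derivs ::
  "real set \<Rightarrow> (real \<Rightarrow> 'b::real_normed_vector) \<Rightarrow> (nat \<Rightarrow> real \<Rightarrow> 'b) \<Rightarrow> bool" where
  "iterated_derivs I f D \<longleftrightarrow>
     (\<forall>t\<in>I. D 0 t = f t) \<and>
     (\<forall>k. \<forall>t\<in>I. (D k has_vector_derivative D (Suc k) t) (at t within I))"


section \<open>Smooth manifolds\<close>

text \<open>A chart is a domain together with a coordinate map; the map is irrelevant outside the
  domain. The manifold is the whole type \<open>'m\<close>.\<close>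

type_synonym ('m, 'e) chart = "'m set \<times> ('m \<Rightarrow> 'e)"

definition chart_inv :: "('m, 'e) chart \<Rightarrow> 'e \<Rightarrow> 'm" where
  "chart_inv c = inv_into (fst c) (snd c)"

definition transition :: "('m, 'e) chart \<Rightarrow> ('m, 'e) chart \<Rightarrow> 'e \<Rightarrow> 'e" where
  "transition c c' = snd c' \<circ> chart_inv c"

definition is_chart ::
  "('m::topological_space, 'e::euclidean_space) chart \<Rightarrow> bool" where
  "is_chart c \<longleftrightarrow>
     open (fst c) \<and> open (snd c ` fst c) \<and>
     homeomorphism (fst c) (snd c ` fst c) (snd c) (chart_inv c)"

definition smooth_atlas ::
  "('m::topological_space, 'e::euclidean_space) chart set \<Rightarrow> bool" where
  "smooth_atlas A \<longleftrightarrow>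
     (\<forall>c\<in>A. is_chart c) \<and> (\<Union>c\<in>A. fst c) = UNIV \<and>
     (\<forall>c\<in>A. \<forall>c'\<in>A. smooth_on (snd c ` (fst c \<inter> fst c')) (transition c c'))"


section \<open>Riemannian metrics and distance\<close>

text \<open>A Riemannian metric is given by its coordinate expressions: \<open>g c p\<close> is the inner product
  at \<open>p\<close> in the coordinates of \<open>c\<close>, and the expressions in two charts are related by the
  transformation law of covariant 2-tensors.\<close>

definition riemannian_metric ::
  "('m::topological_space, 'e::euclidean_space) chart set \<Rightarrow>
     (('m, 'e) chart \<Rightarrow> 'm \<Rightarrow> 'e \<Rightarrow> 'e \<Rightarrow> real) \<Rightarrow> bool" where
  "riemannian_metric A g \<longleftrightarrow>
     (\<forall>c\<in>A. \<forall>p\<in>fst c.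
        bilinear (g c p) \<and> (\<forall>v w. g c p v w = g c p w v) \<and> (\<forall>v. v \<noteq> 0 \<longrightarrow> 0 < g c p v v)) \<and>
     (\<forall>c\<in>A. \<forall>v w. smooth_on (snd c ` fst c) (\<lambda>q. g c (chart_inv c q) v w)) \<and>
     (\<forall>c\<in>A. \<forall>c'\<in>A. \<forall>p\<in>fst c \<inter> fst c'. \<forall>v w.
        g c p v w =
          g c' p (frechet_derivative (transition c c') (at (snd c p)) v)
                 (frechet_derivative (transition c c') (at (snd c p)) w))"

text \<open>The curve is smooth, up to and including the end points, on every closed parameter interval
  whose interior avoids the finite set of break points.\<close>

definition smooth_curve_off ::
  "('m::topological_space, 'e::euclidean_space) chart set \<Rightarrow> real set \<Rightarrow> (real \<Rightarrow> 'm) \<Rightarrow> bool" where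
  "smooth_curve_off A S c \<longleftrightarrow>
     continuous_on {0..1} c \<and>
     (\<forall>\<phi>\<in>A. \<forall>a b. 0 \<le> a \<and> a < b \<and> b \<le> 1 \<and> {a<..<b} \<inter> S = {} \<and> c ` {a..b} \<subseteq> fst \<phi> \<longrightarrow>
        (\<exists>D. iterated_derivs {a..b} (snd \<phi> \<circ> c) D))"

definition piecewise_smooth_curve ::
  "('m::topological_space, 'e::euclidean_space) chart set \<Rightarrow> (real \<Rightarrow> 'm) \<Rightarrow> bool" where
  "piecewise_smooth_curve A c \<longleftrightarrow> (\<exists>S. finite S \<and> smooth_curve_off A S c)"

text \<open>The value does not depend on the chart chosen around \<open>c t\<close>; it is arbitrary at break
  points, of which there are finitely many.\<close>

definition speed ::
  "('m::topological_space, 'e::euclidean_space) chart set \<Rightarrow>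
     (('m, 'e) chart \<Rightarrow> 'm \<Rightarrow> 'e \<Rightarrow> 'e \<Rightarrow> real) \<Rightarrow> (real \<Rightarrow> 'm) \<Rightarrow> real \<Rightarrow> real" where
  "speed A g c t =
     (let \<phi> = (SOME \<phi>. \<phi> \<in> A \<and> c t \<in> fst \<phi>);
          v = vector_derivative (snd \<phi> \<circ> c) (at t)
      in sqrt (g \<phi> (c t) v v))"

definition curve_length ::
  "('m::topological_space, 'e::euclidean_space) chart set \<Rightarrow>
     (('m, 'e) chart \<Rightarrow> 'm \<Rightarrow> 'e \<Rightarrow> 'e \<Rightarrow> real) \<Rightarrow> (real \<Rightarrow> 'm) \<Rightarrow> real" where
  "curve_length A g c = integral {0..1} (speed A g c)"

definition riemannian_dist ::
  "('m::topological_space, 'e::euclidean_space) chart set \<Rightarrow>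
     (('m, 'e) chart \<Rightarrow> 'm \<Rightarrow> 'e \<Rightarrow> 'e \<Rightarrow> real) \<Rightarrow> 'm \<Rightarrow> 'm \<Rightarrow> real" where
  "riemannian_dist A g x y =
     Inf {curve_length A g c | c. piecewise_smooth_curve A c \<and> c 0 = x \<and> c 1 = y}"


section \<open>Codimension one foliations\<close>

text \<open>Foliated charts take values in \<open>\<real>\<^sup>n \<times> \<real>\<close>, the second component being the transverse
  coordinate. Coherence says that coordinate changes are locally of the form
  \<open>(x, y) \<mapsto> (f (x, y), h y)\<close>. Being an atlas jointly with \<open>A\<close> makes the foliated charts charts of
  the smooth structure defined by \<open>A\<close>.\<close>

definition foliated_atlas ::
  "('m::topological_space, (real^'n) \<times> real) chart set \<Rightarrow>
     ('m, (real^'n) \<times> real) chart set \<Rightarrow> bool" where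
  "foliated_atlas A F \<longleftrightarrow>
     smooth_atlas (A \<union> F) \<and> (\<Union>c\<in>F. fst c) = UNIV \<and>
     (\<forall>c\<in>F. \<exists>a b. snd c ` fst c = box a b) \<and>
     (\<forall>c\<in>F. \<forall>c'\<in>F. \<forall>p\<in>fst c \<inter> fst c'.
        \<exists>W h. open W \<and> p \<in> W \<and>
          (\<forall>q\<in>W \<inter> fst c \<inter> fst c'. snd (snd c' q) = h (snd (snd c q))))"

definition plaque :: "('m, (real^'n) \<times> real) chart \<Rightarrow> real \<Rightarrow> 'm set" where
  "plaque c y = {p \<in> fst c. snd (snd c p) = y}"

text \<open>The topology in which the plaques, with their usual topology, are open.\<close>

definition leaf_topology ::
  "('m::topological_space, (real^'n) \<times> real) chart set \<Rightarrow> 'm topology" where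
  "leaf_topology F = topology_generated_by {W \<inter> plaque c y | W c y. open W \<and> c \<in> F}"

definition leaves ::
  "('m::topological_space, (real^'n) \<times> real) chart set \<Rightarrow> 'm set set" where
  "leaves F = connected_components_of (leaf_topology F)"

definition leaf_through ::
  "('m::topological_space, (real^'n) \<times> real) chart set \<Rightarrow> 'm \<Rightarrow> 'm set" where
  "leaf_through F x = connected_component_of_set (leaf_topology F) x"

definition leaves_of_restriction ::
  "('m::topological_space, (real^'n) \<times> real) chart set \<Rightarrow> 'm set \<Rightarrow> 'm set set" where
  "leaves_of_restriction F N = connected_components_of (subtopology (leaf_topology F) N)"

text \<open>\<open>F\<close> and \<open>F'\<close> define the same foliation iff their union is again a foliated atlas.\<close>

definition transversely_orientable ::
  "('m::topological_space, (real^'n) \<times> real) chart set \<Rightarrow>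
     ('m, (real^'n) \<times> real) chart set \<Rightarrow> bool" where
  "transversely_orientable A F \<longleftrightarrow>
     (\<exists>F'. foliated_atlas A F' \<and> foliated_atlas A (F \<union> F') \<and>
        (\<forall>c\<in>F'. \<forall>c'\<in>F'. \<forall>p\<in>fst c \<inter> fst c'.
           0 < snd (frechet_derivative (transition c c') (at (snd c p)) (0, 1))))"

definition leafwise_orientable ::
  "('m::topological_space, (real^'n) \<times> real) chart set \<Rightarrow>
     ('m, (real^'n) \<times> real) chart set \<Rightarrow> bool" where
  "leafwise_orientable A F \<longleftrightarrow>
     (\<exists>F'. foliated_atlas A F' \<and> foliated_atlas A (F \<union> F') \<and>
        (\<forall>c\<in>F'. \<forall>c'\<in>F'. \<forall>p\<in>fst c \<inter> fst c'.
           0 < det (matrix (\<lambda>v. fst (frechet_derivative (transition c c') (at (snd c p)) (v, 0))))))"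

text \<open>The tangent space of the leaf through \<open>\<Phi> q\<close>, pulled back to \<open>\<real>\<^sup>n \<times> \<real>\<close> along a local
  parametrization \<open>\<Phi>\<close> of the manifold. By coherence it does not depend on the foliated chart.\<close>

definition leaf_tangent ::
  "('m::topological_space, (real^'n) \<times> real) chart set \<Rightarrow>
     ((real^'n) \<times> real \<Rightarrow> 'm) \<Rightarrow> (real^'n) \<times> real \<Rightarrow> ((real^'n) \<times> real) set" where
  "leaf_tangent F \<Phi> q =
     {v. \<exists>c\<in>F. \<Phi> q \<in> fst c \<and> snd (frechet_derivative (snd c \<circ> \<Phi>) (at q) v) = 0}"


section \<open>Turbulization\<close>

definition simple_closed_transversal ::
  "('m::topological_space, (real^'n) \<times> real) chart set \<Rightarrow>
     ('m, (real^'n) \<times> real) chart set \<Rightarrow> (real \<Rightarrow> 'm) \<Rightarrow> bool" where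
  "simple_closed_transversal A F \<gamma> \<longleftrightarrow>
     simple_path \<gamma> \<and> pathfinish \<gamma> = pathstart \<gamma> \<and> smooth_curve_off A {} \<gamma> \<and>
     (\<forall>c\<in>F. \<forall>t\<in>{0..1}. \<gamma> t \<in> fst c \<longrightarrow>
        snd (vector_derivative (snd c \<circ> \<gamma>) (at t within {0..1})) \<noteq> 0)"

text \<open>The parameter of \<open>\<Theta>\<close> is \<open>(x, t)\<close> with \<open>x = r z\<close> in the closed unit disc and \<open>t\<close> taken modulo
  1. Smoothness of the embedding of the closed solid torus is expressed through an extension to a
  slightly larger open one; nothing is required of \<open>F\<close> in the added collar.\<close>

definition tube :: "((real^'n) \<times> real \<Rightarrow> 'm) \<Rightarrow> 'm set" where
  "tube \<Theta> = \<Theta> ` (cball 0 1 \<times> UNIV)"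

definition foliated_tubular_nbhd ::
  "('m::topological_space, (real^'n) \<times> real) chart set \<Rightarrow>
     ('m, (real^'n) \<times> real) chart set \<Rightarrow> (real \<Rightarrow> 'm) \<Rightarrow>
     ((real^'n) \<times> real \<Rightarrow> 'm) \<Rightarrow> bool" where
  "foliated_tubular_nbhd A F \<gamma> \<Theta> \<longleftrightarrow>
     (\<exists>R>1.
        continuous_on (ball 0 R \<times> UNIV) \<Theta> \<and>
        (\<forall>c\<in>A. smooth_on {q \<in> ball 0 R \<times> UNIV. \<Theta> q \<in> fst c} (snd c \<circ> \<Theta>) \<and>
           (\<forall>q\<in>ball 0 R \<times> UNIV. \<Theta> q \<in> fst c \<longrightarrow>
              bij (frechet_derivative (snd c \<circ> \<Theta>) (at q)))) \<and>
        (\<forall>x\<in>ball 0 R. \<forall>x'\<in>ball 0 R. \<forall>t t'.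
           \<Theta> (x, t) = \<Theta> (x', t') \<longleftrightarrow> x = x' \<and> t - t' \<in> \<int>)) \<and>
     leaves_of_restriction F (tube \<Theta>) = {\<Theta> ` (cball 0 1 \<times> {t}) | t. True} \<and>
     \<gamma> ` {0..1} = \<Theta> ` ({0} \<times> UNIV)"

definition turbulization_profile :: "(real \<Rightarrow> real) \<Rightarrow> bool" where
  "turbulization_profile lam \<longleftrightarrow>
     lam ` {0..1} \<subseteq> {- pi / 2..pi / 2} \<and> strict_mono_on {0..3/4} lam \<and>
     lam 0 = - pi / 2 \<and> lam (2/3) = 0 \<and> (\<forall>r\<in>{3/4..1}. lam r = pi / 2) \<and>
     (\<exists>D. iterated_derivs {0..1} lam D \<and> (\<forall>k\<ge>1. D k 0 = 0))"

text \<open>The kernel of \<open>\<omega> = cos lam(r) dr + sin lam(r) dt\<close> at \<open>(x, t)\<close>, where \<open>r = norm x\<close> and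
  \<open>dr v = (x \<bullet> v) / r\<close>. At \<open>r = 0\<close> the \<open>dr\<close> term is absent, as it should be since
  \<open>cos (lam 0) = 0\<close>.\<close>

definition turbulization_kernel ::
  "(real \<Rightarrow> real) \<Rightarrow> (real^'n) \<times> real \<Rightarrow> ((real^'n) \<times> real) set" where
  "turbulization_kernel lam q =
     {(v, \<tau>). cos (lam (norm (fst q))) * ((fst q \<bullet> v) / norm (fst q))
               + sin (lam (norm (fst q))) * \<tau> = 0}"

text \<open>The foliation \<open>F\<^sub>\<gamma>\<close>, determined by its tangent planes: those of \<open>F\<close> outside the tube and the
  kernel of \<open>\<omega>\<close> inside.\<close>

definition turbulization ::
  "('m::topological_space, (real^'n) \<times> real) chart set \<Rightarrow>
     ('m, (real^'n) \<times> real) chart set \<Rightarrow> ((real^'n) \<times> real \<Rightarrow> 'm) \<Rightarrow> (real \<Rightarrow> real) \<Rightarrow>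
     ('m, (real^'n) \<times> real) chart set \<Rightarrow> bool" where
  "turbulization A F \<Theta> lam F\<^sub>\<gamma> \<longleftrightarrow>
     foliated_atlas A F\<^sub>\<gamma> \<and>
     (\<forall>c\<in>A. \<forall>p\<in>fst c - tube \<Theta>.
        leaf_tangent F\<^sub>\<gamma> (chart_inv c) (snd c p) = leaf_tangent F (chart_inv c) (snd c p)) \<and>
     (\<forall>q\<in>cball 0 1 \<times> UNIV. leaf_tangent F\<^sub>\<gamma> \<Theta> q = turbulization_kernel lam q)"


section \<open>Quotients of pseudometric spaces and the Hausdorff leaf space\<close>

definition zero_dist_rel :: "'a set \<Rightarrow> ('a \<Rightarrow> 'a \<Rightarrow> real) \<Rightarrow> ('a \<times> 'a) set" where
  "zero_dist_rel S r = {(x, y) \<in> S \<times> S. r x y = 0}"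

definition zero_dist_classes :: "'a set \<Rightarrow> ('a \<Rightarrow> 'a \<Rightarrow> real) \<Rightarrow> 'a set set" where
  "zero_dist_classes S r = S // zero_dist_rel S r"

definition class_dist :: "('a \<Rightarrow> 'a \<Rightarrow> real) \<Rightarrow> 'a set \<Rightarrow> 'a set \<Rightarrow> real" where
  "class_dist r C C' = r (SOME x. x \<in> C) (SOME y. y \<in> C')"

definition set_dist :: "('m \<Rightarrow> 'm \<Rightarrow> real) \<Rightarrow> 'm set \<Rightarrow> 'm set \<Rightarrow> real" where
  "set_dist d L L' = Inf {d x y | x y. x \<in> L \<and> y \<in> L'}"

definition leaf_chain_dist ::
  "('m \<Rightarrow> 'm \<Rightarrow> real) \<Rightarrow> 'm set set \<Rightarrow> 'm set \<Rightarrow> 'm set \<Rightarrow> real" where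
  "leaf_chain_dist d \<L> L L' =
     Inf {\<Sum>i<length Ls - 1. set_dist d (Ls ! i) (Ls ! Suc i) | Ls.
            Ls \<noteq> [] \<and> set Ls \<subseteq> \<L> \<and> hd Ls = L \<and> last Ls = L'}"

definition hls_points ::
  "('m::topological_space \<Rightarrow> 'm \<Rightarrow> real) \<Rightarrow> ('m, (real^'n) \<times> real) chart set \<Rightarrow>
     'm set set set" where
  "hls_points d F = zero_dist_classes (leaves F) (leaf_chain_dist d (leaves F))"

definition hls_dist ::
  "('m::topological_space \<Rightarrow> 'm \<Rightarrow> real) \<Rightarrow> ('m, (real^'n) \<times> real) chart set \<Rightarrow>
     'm set set \<Rightarrow> 'm set set \<Rightarrow> real" where
  "hls_dist d F = class_dist (leaf_chain_dist d (leaves F))"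

definition hls_proj ::
  "('m::topological_space \<Rightarrow> 'm \<Rightarrow> real) \<Rightarrow> ('m, (real^'n) \<times> real) chart set \<Rightarrow>
     'm \<Rightarrow> 'm set set" where
  "hls_proj d F x =
     zero_dist_rel (leaves F) (leaf_chain_dist d (leaves F)) `` {leaf_through F x}"

text \<open>The pseudometric \<open>d\<^sub>R\<close>; the list holds the pairs \<open>(p\<^sub>i, q\<^sub>i)\<close>.\<close>

definition glued_dist ::
  "'a set \<Rightarrow> ('a \<Rightarrow> 'a \<Rightarrow> real) \<Rightarrow> ('a \<times> 'a) set \<Rightarrow> 'a \<Rightarrow> 'a \<Rightarrow> real" where
  "glued_dist Y d R x y =
     Inf {\<Sum>i<length ps. d (fst (ps ! i)) (snd (ps ! i)) | ps.
            ps \<noteq> [] \<and> set ps \<subseteq> Y \<times> Y \<and> fst (hd ps) = x \<and> snd (last ps) = y \<and>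
            (\<forall>i. Suc i < length ps \<longrightarrow> (fst (ps ! Suc i), snd (ps ! i)) \<in> R)}"

definition quotient_points ::
  "'a set \<Rightarrow> ('a \<Rightarrow> 'a \<Rightarrow> real) \<Rightarrow> ('a \<times> 'a) set \<Rightarrow> 'a set set" where
  "quotient_points Y d R = zero_dist_classes Y (glued_dist Y d R)"

definition quotient_dist ::
  "'a set \<Rightarrow> ('a \<Rightarrow> 'a \<Rightarrow> real) \<Rightarrow> ('a \<times> 'a) set \<Rightarrow> 'a set \<Rightarrow> 'a set \<Rightarrow> real" where
  "quotient_dist Y d R = class_dist (glued_dist Y d R)"

definition collapse_rel :: "'a set \<Rightarrow> 'a set \<Rightarrow> ('a \<times> 'a) set" where
  "collapse_rel Y P = {(x, y) \<in> Y \<times> Y. x = y \<or> x \<in> P \<and> y \<in> P}"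

definition isometric ::
  "'a set \<Rightarrow> ('a \<Rightarrow> 'a \<Rightarrow> real) \<Rightarrow> 'b set \<Rightarrow> ('b \<Rightarrow> 'b \<Rightarrow> real) \<Rightarrow> bool" where
  "isometric X d Y d' \<longleftrightarrow>
     (\<exists>f. bij_betw f X Y \<and> (\<forall>x\<in>X. \<forall>y\<in>X. d' (f x) (f y) = d x y))"

end

theory Submission
  imports Defs
begin

text \<open>Both leaf spaces are quotients of pseudometrics on \<open>M\<close>: \<open>\<rho>\<close> is the largest pseudometric below the
  Riemannian distance that vanishes on pairs of points of a common leaf, and the glued distance is
  the largest one below it that also vanishes on \<open>\<gamma>\<close>. So it suffices that the pseudometric \<open>\<tau>\<close> of \<open>X\<close> vanishes
  on the leaves of \<open>F\<^sub>\<gamma>\<close> and that the pseudometric \<open>\<sigma>\<close> of \<open>F\<^sub>\<gamma>\<close> vanishes on the leaves of \<open>F\<close> and on \<open>\<gamma>\<close>.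
  Both vanish on the tube: \<open>\<tau>\<close> because every plaque of \<open>F\<close> in the tube meets \<open>\<gamma>\<close>, and \<open>\<sigma>\<close> because inside
  the tube the leaves of \<open>F\<^sub>\<gamma>\<close> on either side of \<open>r = 2/3\<close> spiral towards all points of
  \<open>r = 2/3\<close> with the same angle, and those on the inner side contain all angles because they cross
  the core. Outside the tube the foliations have the same plaques, so a pseudometric that
  vanishes on the tube and on the leaves of one foliation vanishes on the leaves of the other.\<close>

section \<open>Pseudometrics and glued distances\<close>

text \<open>Leaves enter only through tangent curves: a pseudometric that vanishes on plaques
  vanishes on leaves, and a curve whose transverse coordinate has derivative zero stays in one leaf.
  This suits \<open>turbulization\<close>, which prescribes \<open>F\<^sub>\<gamma>\<close> by its
  tangent planes and gives no foliated charts. The spiralling comes from the zero of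
  \<open>lam\<close> at \<open>r = 2/3\<close>. There \<open>sin (lam r)\<close> is at most a
  multiple of the distance to \<open>2/3\<close> while \<open>cos (lam r)\<close> is close to 1, so
  \<open>dt/dr\<close> along a leaf has absolute value at least \<open>C / |r - 2/3|\<close> and
  \<open>t\<close> diverges logarithmically. Since \<open>t\<close> counts modulo 1, the leaf passes
  every height arbitrarily close to \<open>r = 2/3\<close>. As \<sigma> is bounded by the Riemannian
  distance, it is continuous, so it vanishes between the leaf and each such limit point. Triangle
  inequalities come from concatenating chains. Of the Riemannian distance itself the comparison uses
  that it is nonnegative, symmetric, zero on the diagonal and small near each point.\<close>

definition pseudometric_on :: "'a set \<Rightarrow> ('a \<Rightarrow> 'a \<Rightarrow> real) \<Rightarrow> bool" where
  "pseudometric_on S r \<longleftrightarrow>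
     (\<forall>x\<in>S. r x x = 0) \<and> (\<forall>x\<in>S. \<forall>y\<in>S. 0 \<le> r x y \<and> r x y = r y x) \<and>
     (\<forall>x\<in>S. \<forall>y\<in>S. \<forall>z\<in>S. r x z \<le> r x y + r y z)"

lemma pseudometric_onD:
  assumes "pseudometric_on S r" "x \<in> S" "y \<in> S"
  shows "r x x = 0" "0 \<le> r x y" "r x y = r y x" "z \<in> S \<Longrightarrow> r x z \<le> r x y + r y z"
  using assms unfolding pseudometric_on_def by blast+

lemma pseudometric_on_cong_left:
  assumes "pseudometric_on S r" "x \<in> S" "x' \<in> S" "y \<in> S" "r x x' = 0"
  shows "r x' y = r x y"
  using pseudometric_onD(4)[OF assms(1,2,3,4)] pseudometric_onD(4)[OF assms(1,3,2,4)]
    pseudometric_onD(3)[OF assms(1,2,3)] assms(5) by linarith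

lemma pseudometric_on_zero_trans:
  assumes "pseudometric_on S r" "x \<in> S" "y \<in> S" "z \<in> S" "r x y = 0" "r y z = 0"
  shows "r x z = 0"
  using pseudometric_on_cong_left[OF assms(1-5)] assms(6) by simp

lemma pseudometric_on_pullback:
  assumes "pseudometric_on S r" "e ` M \<subseteq> S"
  shows "pseudometric_on M (\<lambda>x y. r (e x) (e y))"
  using assms unfolding pseudometric_on_def by blast

abbreviation zero_dist_class :: "'a set \<Rightarrow> ('a \<Rightarrow> 'a \<Rightarrow> real) \<Rightarrow> 'a \<Rightarrow> 'a set" where
  "zero_dist_class S r x \<equiv> zero_dist_rel S r `` {x}"

lemma mem_zero_dist_class_iff:
  "y \<in> zero_dist_class S r x \<longleftrightarrow> x \<in> S \<and> y \<in> S \<and> r x y = 0"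
  by (auto simp: zero_dist_rel_def)

lemma zero_dist_class_self:
  assumes "pseudometric_on S r" "x \<in> S"
  shows "x \<in> zero_dist_class S r x"
  unfolding mem_zero_dist_class_iff using pseudometric_onD(1)[OF assms assms(2)] assms(2) by simp

text \<open>\<open>class_dist\<close> evaluates \<open>r\<close> at representatives picked by
  \<open>SOME\<close>. They lie at distance zero from \<open>x\<close> and \<open>y\<close>, and
  moving an argument by distance zero leaves \<open>r\<close> unchanged.\<close>

lemma class_dist_zero_dist_class:
  assumes r: "pseudometric_on S r" and "x \<in> S" "y \<in> S"
  shows "class_dist r (zero_dist_class S r x) (zero_dist_class S r y) = r x y"
proof -
  define x' where "x' = (SOME u. u \<in> zero_dist_class S r x)"
  define y' where "y' = (SOME u. u \<in> zero_dist_class S r y)"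
  have "x \<in> zero_dist_class S r x" "y \<in> zero_dist_class S r y"
    by (rule zero_dist_class_self[OF r assms(2)] zero_dist_class_self[OF r assms(3)])+
  then have "x' \<in> zero_dist_class S r x" "y' \<in> zero_dist_class S r y"
    unfolding x'_def y'_def by (metis someI)+
  then have x': "x' \<in> S" "r x x' = 0" and y': "y' \<in> S" "r y y' = 0"
    unfolding mem_zero_dist_class_iff by blast+
  have "r x' y' = r x y'"
    using pseudometric_on_cong_left[OF r assms(2) x'(1) y'(1) x'(2)] .
  also have "\<dots> = r y' x" by (rule pseudometric_onD(3)[OF r assms(2) y'(1)])
  also have "\<dots> = r y x"
    using pseudometric_on_cong_left[OF r assms(3) y'(1) assms(2) y'(2)] .
  also have "\<dots> = r x y" by (rule pseudometric_onD(3)[OF r assms(3,2)])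
  finally show ?thesis by (simp add: class_dist_def x'_def y'_def)
qed

lemma zero_dist_class_eq_iff:
  assumes r: "pseudometric_on S r" and "x \<in> S" "y \<in> S"
  shows "zero_dist_class S r x = zero_dist_class S r y \<longleftrightarrow> r x y = 0"
proof
  assume "zero_dist_class S r x = zero_dist_class S r y"
  moreover have "y \<in> zero_dist_class S r y"
    by (rule zero_dist_class_self[OF r assms(3)])
  ultimately show "r x y = 0" by (metis mem_zero_dist_class_iff)
next
  assume *: "r x y = 0"
  have "r x u = 0 \<longleftrightarrow> r y u = 0" if "u \<in> S" for u
    using pseudometric_on_cong_left[OF r assms(2,3) that *] by simp
  then show "zero_dist_class S r x = zero_dist_class S r y"
    unfolding set_eq_iff mem_zero_dist_class_iff using assms(2,3) by blast
qed

lemma zero_dist_classes_eq: "zero_dist_classes S r = zero_dist_class S r ` S"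
  by (auto simp: zero_dist_classes_def quotient_def)

lemma pseudometric_on_class_dist:
  assumes r: "pseudometric_on S r"
  shows "pseudometric_on (zero_dist_classes S r) (class_dist r)"
proof -
  note c = class_dist_zero_dist_class[OF r]
  show ?thesis
    unfolding zero_dist_classes_eq pseudometric_on_def ball_simps
  proof (intro conjI ballI)
    fix x y z assume "x \<in> S" "y \<in> S" "z \<in> S"
    then show "class_dist r (zero_dist_class S r x) (zero_dist_class S r z) \<le>
        class_dist r (zero_dist_class S r x) (zero_dist_class S r y) +
        class_dist r (zero_dist_class S r y) (zero_dist_class S r z)"
      using pseudometric_onD(4)[OF r] by (simp only: c)
  next
    fix x y assume xy: "x \<in> S" "y \<in> S"
    show "0 \<le> class_dist r (zero_dist_class S r x) (zero_dist_class S r y)"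
      using pseudometric_onD(2)[OF r xy] by (simp only: c[OF xy])
    show "class_dist r (zero_dist_class S r x) (zero_dist_class S r y) =
        class_dist r (zero_dist_class S r y) (zero_dist_class S r x)"
      using pseudometric_onD(3)[OF r xy] by (simp only: c[OF xy] c[OF xy(2,1)])
    show "class_dist r (zero_dist_class S r x) (zero_dist_class S r x) = 0"
      using pseudometric_onD(1)[OF r xy] by (simp only: c[OF xy(1) xy(1)])
  qed
qed

text \<open>Both quotients are parametrized by the same set \<open>M\<close>. Equal pullbacks to
  \<open>M\<close> identify the same pairs of parameters, so matching the class of
  \<open>e x\<close> with the class of \<open>e' x\<close> is well defined and injective.\<close>

lemma isometric_zero_dist_classes:
  assumes r: "pseudometric_on S r" and r': "pseudometric_on S' r'"
    and e: "e ` M = S" and e': "e' ` M = S'"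
    and eq: "\<And>x y. x \<in> M \<Longrightarrow> y \<in> M \<Longrightarrow> r (e x) (e y) = r' (e' x) (e' y)"
  shows "isometric (zero_dist_classes S r) (class_dist r) (zero_dist_classes S' r') (class_dist r')"
proof -
  define k where "k = (\<lambda>x. zero_dist_class S r (e x))"
  define k' where "k' = (\<lambda>x. zero_dist_class S' r' (e' x))"
  define f where "f C = k' (SOME x. x \<in> M \<and> C = k x)" for C
  have kk: "k x = k y \<longleftrightarrow> k' x = k' y" if "x \<in> M" "y \<in> M" for x y
  proof -
    have "e x \<in> S" "e y \<in> S" "e' x \<in> S'" "e' y \<in> S'" using that e e' by auto
    then show ?thesis
      unfolding k_def k'_def using zero_dist_class_eq_iff[OF r] zero_dist_class_eq_iff[OF r'] eq that
      by simp
  qed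
  have f: "f (k x) = k' x" if "x \<in> M" for x
  proof -
    have "\<exists>u. u \<in> M \<and> k x = k u" using that by blast
    then have "(SOME u. u \<in> M \<and> k x = k u) \<in> M \<and> k x = k (SOME u. u \<in> M \<and> k x = k u)"
      by (rule someI_ex)
    then show ?thesis using kk that by (metis f_def)
  qed
  have Z: "zero_dist_classes S r = k ` M" and Z': "zero_dist_classes S' r' = k' ` M"
    using e e' by (auto simp: zero_dist_classes_eq k_def k'_def)
  have "inj_on f (k ` M)" unfolding inj_on_def using kk by (auto simp: f)
  moreover have "f ` k ` M = k' ` M" by (force simp: f image_iff)
  ultimately have "bij_betw f (k ` M) (k' ` M)" by (simp add: bij_betw_def)
  moreover have "class_dist r' (f (k x)) (f (k y)) = class_dist r (k x) (k y)"
    if "x \<in> M" "y \<in> M" for x y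
  proof -
    have "e x \<in> S" "e y \<in> S" "e' x \<in> S'" "e' y \<in> S'" using that e e' by auto
    then show ?thesis
      using that by (simp add: f eq) (simp add: k_def k'_def class_dist_zero_dist_class[OF r]
          class_dist_zero_dist_class[OF r'] eq)
  qed
  ultimately show ?thesis unfolding isometric_def Z Z' by blast
qed

text \<open>The lists of pairs under \<open>glued_dist\<close> in inductive form, with the total
  length as last argument, so that chains can be concatenated, reversed and estimated by induction
  instead of by index arithmetic. The base case is one pair because the lists are nonempty.\<close>

inductive glue_chain ::
  "'a set \<Rightarrow> ('a \<Rightarrow> 'a \<Rightarrow> real) \<Rightarrow> ('a \<times> 'a) set \<Rightarrow> 'a \<Rightarrow> 'a \<Rightarrow> real \<Rightarrow> bool" for Y d R where
  single: "p \<in> Y \<Longrightarrow> q \<in> Y \<Longrightarrow> glue_chain Y d R p q (d p q)"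
| step: "p \<in> Y \<Longrightarrow> q \<in> Y \<Longrightarrow> (p', q) \<in> R \<Longrightarrow> glue_chain Y d R p' y s \<Longrightarrow>
    glue_chain Y d R p y (d p q + s)"

lemma glue_chain_mem: "glue_chain Y d R x y s \<Longrightarrow> x \<in> Y \<and> y \<in> Y"
  by (induction rule: glue_chain.induct) auto

text \<open>Reflexivity of \<open>R\<close> glues the end of the first chain to itself, which is the
  junction that \<open>step\<close> asks for.\<close>

lemma glue_chain_append:
  assumes "glue_chain Y d R x y s" "glue_chain Y d R y z s'" "refl_on Y R"
  shows "glue_chain Y d R x z (s + s')"
  using assms
proof (induction rule: glue_chain.induct)
  case (single p q)
  then have "(q, q) \<in> R" by (meson refl_onD)
  then show ?case using single by (blast intro: glue_chain.step)
next
  case (step p q p' y s)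
  then show ?case by (metis glue_chain.step add.assoc)
qed

lemma glue_chain_sym:
  assumes "glue_chain Y d R x y s" "refl_on Y R" "sym R"
    and "\<And>x y. x \<in> Y \<Longrightarrow> y \<in> Y \<Longrightarrow> d x y = d y x"
    and "\<And>x. x \<in> Y \<Longrightarrow> d x x = 0"
  shows "glue_chain Y d R y x s"
  using assms(1)
proof (induction rule: glue_chain.induct)
  case (single p q)
  then show ?case using assms(4) by (metis glue_chain.single)
next
  case (step p q p' y s)
  have "p' \<in> Y" using step glue_chain_mem by fast
  have "(q, p') \<in> R" using step(3) assms(3) by (meson symD)
  \<comment> \<open>Reversed, the pair \<open>(p, q)\<close> becomes \<open>(q, p)\<close> and has
    to follow a chain that ends at \<open>p'\<close>. The degenerate pair \<open>(p', p')\<close>,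
    of cost zero, makes a chain that starts there.\<close>
  then have "glue_chain Y d R p' p (d p' p' + d q p)"
    using step(1,2) \<open>p' \<in> Y\<close> by (blast intro: glue_chain.intros)
  then have "glue_chain Y d R p' p (d p q)" using assms(4,5) step(1,2) \<open>p' \<in> Y\<close> by simp
  from glue_chain_append[OF step(5) this assms(2)] show ?case by (simp add: add.commute)
qed

text \<open>The triangle inequality for \<open>f\<close>: every pair costs at least the
  \<open>f\<close>-distance of its lifts, and a jump along \<open>R\<close> costs \<open>f\<close>
  nothing. The chain runs in \<open>Y\<close> while \<open>f\<close> lives on \<open>M\<close>, so
  chain points are lifted through \<open>e\<close>, and \<open>zero\<close> is stated for all
  lifts.\<close>

lemma le_glue_chain:
  assumes f: "pseudometric_on M f" and e: "Y \<subseteq> e ` M"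
    and le: "\<And>x y. x \<in> M \<Longrightarrow> y \<in> M \<Longrightarrow> f x y \<le> d (e x) (e y)"
    and zero: "\<And>x y. x \<in> M \<Longrightarrow> y \<in> M \<Longrightarrow> (e x, e y) \<in> R \<Longrightarrow> f x y = 0"
    and "glue_chain Y d R p q s" "x \<in> M" "y \<in> M" "e x = p" "e y = q"
  shows "f x y \<le> s"
  using assms(5-)
proof (induction arbitrary: x rule: glue_chain.induct)
  case (single p q)
  then show ?case using le by blast
next
  case (step p q p' y' s)
  obtain a b where ab: "a \<in> M" "q = e a" "b \<in> M" "p' = e b"
    using e step(2) glue_chain_mem[OF step(4)] by blast
  have "f a b = 0" using zero[of b a] pseudometric_onD(3)[OF f] ab step by metis
  moreover have "f x y \<le> f x a + f a y" "f a y \<le> f a b + f b y"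
    using pseudometric_onD(4)[OF f] ab step by metis+
  moreover have "f b y \<le> s" using step ab by blast
  moreover have "f x a \<le> d p q" using le step ab by metis
  ultimately show ?case by linarith
qed

lemma glue_chain_iff_list:
  "glue_chain Y d R x y s \<longleftrightarrow>
     (\<exists>ps. s = (\<Sum>i<length ps. d (fst (ps ! i)) (snd (ps ! i))) \<and>
       ps \<noteq> [] \<and> set ps \<subseteq> Y \<times> Y \<and> fst (hd ps) = x \<and> snd (last ps) = y \<and>
       (\<forall>i. Suc i < length ps \<longrightarrow> (fst (ps ! Suc i), snd (ps ! i)) \<in> R))"
  (is "_ \<longleftrightarrow> (\<exists>ps. ?P ps s x y)")
proof
  assume "glue_chain Y d R x y s"
  then show "\<exists>ps. ?P ps s x y"
  proof (induction rule: glue_chain.induct)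
    case (single p q)
    then have "?P [(p, q)] (d p q) p q" by simp
    then show ?case by blast
  next
    case (step p q p' y s)
    then obtain ps where ps: "?P ps s p' y" by blast
    have "d p q + s = (\<Sum>i<length ((p, q) # ps). d (fst (((p, q) # ps) ! i)) (snd (((p, q) # ps) ! i)))"
      using ps by (simp add: sum.lessThan_Suc_shift del: sum.lessThan_Suc)
    moreover have "(fst (((p, q) # ps) ! Suc i), snd (((p, q) # ps) ! i)) \<in> R"
      if "Suc i < length ((p, q) # ps)" for i
      using ps step(3) that by (cases i) (auto simp: hd_conv_nth)
    moreover have "(p, q) # ps \<noteq> []" "set ((p, q) # ps) \<subseteq> Y \<times> Y"
      "fst (hd ((p, q) # ps)) = p" "snd (last ((p, q) # ps)) = y"
      using ps step(1,2) by auto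
    ultimately show ?case by blast
  qed
next
  assume "\<exists>ps. ?P ps s x y"
  then obtain ps where "?P ps s x y" by blast
  then show "glue_chain Y d R x y s"
  proof (induction ps arbitrary: s x)
    case Nil
    then show ?case by simp
  next
    case (Cons a ps)
    obtain p q where a: "a = (p, q)" by (cases a)
    show ?case
    proof (cases ps)
      case Nil
      then show ?thesis using Cons(2) a by (auto intro: glue_chain.single)
    next
      case (Cons b bs)
      let ?s = "\<Sum>i<length ps. d (fst (ps ! i)) (snd (ps ! i))"
      have P: "?P (a # ps) s x y" by fact
      have R: "(fst (ps ! Suc i), snd (ps ! i)) \<in> R" if "Suc i < length ps" for i
        using P that by auto
      have s: "s = d p q + ?s" using P a by (simp add: sum.lessThan_Suc_shift del: sum.lessThan_Suc)
      have "?P ps ?s (fst b) y" using P Cons R by auto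
      then have "glue_chain Y d R (fst b) y ?s" by (rule Cons.IH)
      moreover have "(fst b, q) \<in> R" using P Cons a by force
      moreover have "p \<in> Y" "q \<in> Y" "x = p" using P a by auto
      ultimately show ?thesis using s by (blast intro: glue_chain.step)
    qed
  qed
qed

lemma glued_dist_eq_Inf: "glued_dist Y d R x y = Inf {s. glue_chain Y d R x y s}"
proof -
  have "{s. glue_chain Y d R x y s} =
    {\<Sum>i<length ps. d (fst (ps ! i)) (snd (ps ! i)) | ps.
            ps \<noteq> [] \<and> set ps \<subseteq> Y \<times> Y \<and> fst (hd ps) = x \<and> snd (last ps) = y \<and>
            (\<forall>i. Suc i < length ps \<longrightarrow> (fst (ps ! Suc i), snd (ps ! i)) \<in> R)}"
    unfolding glue_chain_iff_list by blast
  then show ?thesis unfolding glued_dist_def by simp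
qed

lemma glue_chain_nonneg:
  assumes "\<And>x y. x \<in> Y \<Longrightarrow> y \<in> Y \<Longrightarrow> 0 \<le> d x y" and "glue_chain Y d R x y s"
  shows "0 \<le> s"
  using assms(2) by (induction rule: glue_chain.induct) (auto simp: assms(1))

lemma glued_dist_le:
  assumes "\<And>x y. x \<in> Y \<Longrightarrow> y \<in> Y \<Longrightarrow> 0 \<le> d x y" and "glue_chain Y d R x y s"
  shows "glued_dist Y d R x y \<le> s"
proof -
  have "bdd_below {s. glue_chain Y d R x y s}"
    using glue_chain_nonneg[OF assms(1)] by (intro bdd_belowI[of _ 0]) auto
  then show ?thesis unfolding glued_dist_eq_Inf using assms(2) by (intro cInf_lower) auto
qed

text \<open>Maximality of the glued distance, with the competitor \<open>f\<close> living on
  parameters. Both inequalities between \<sigma> and \<tau> rest on it.\<close>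

lemma le_glued_dist:
  assumes f: "pseudometric_on M f" and e: "Y = e ` M"
    and le: "\<And>x y. x \<in> M \<Longrightarrow> y \<in> M \<Longrightarrow> f x y \<le> d (e x) (e y)"
    and zero: "\<And>x y. x \<in> M \<Longrightarrow> y \<in> M \<Longrightarrow> (e x, e y) \<in> R \<Longrightarrow> f x y = 0"
    and "x \<in> M" "y \<in> M"
  shows "f x y \<le> glued_dist Y d R (e x) (e y)"
  unfolding glued_dist_eq_Inf
proof (rule cInf_greatest)
  show "{s. glue_chain Y d R (e x) (e y) s} \<noteq> {}"
    using assms(5,6) e by (auto intro: glue_chain.single)
next
  fix s assume "s \<in> {s. glue_chain Y d R (e x) (e y) s}"
  then show "f x y \<le> s" using e le zero assms(5,6)
    by (intro le_glue_chain[OF f, of Y e d R "e x" "e y" s x y]) simp_all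
qed

text \<open>The triangle inequality comes from concatenating chains rather than from
  \<open>d\<close>. This matters for \<open>set_dist\<close>, which in general violates it.\<close>

lemma pseudometric_on_glued_dist:
  assumes R: "refl_on Y R" "sym R"
    and nonneg: "\<And>x y. x \<in> Y \<Longrightarrow> y \<in> Y \<Longrightarrow> 0 \<le> d x y"
    and sym: "\<And>x y. x \<in> Y \<Longrightarrow> y \<in> Y \<Longrightarrow> d x y = d y x"
    and refl: "\<And>x. x \<in> Y \<Longrightarrow> d x x = 0"
  shows "pseudometric_on Y (glued_dist Y d R)"
  unfolding pseudometric_on_def
proof (intro conjI ballI)
  fix x y assume xy: "x \<in> Y" "y \<in> Y"
  then have ne: "{s. glue_chain Y d R x y s} \<noteq> {}" by (auto intro: glue_chain.single)
  show ge: "0 \<le> glued_dist Y d R x y"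
    unfolding glued_dist_eq_Inf using glue_chain_nonneg[OF nonneg] by (intro cInf_greatest ne) auto
  have "glue_chain Y d R x y s \<longleftrightarrow> glue_chain Y d R y x s" for s
    using glue_chain_sym[of Y d R, OF _ R sym refl] by blast
  then have "{s. glue_chain Y d R x y s} = {s. glue_chain Y d R y x s}" by blast
  then show "glued_dist Y d R x y = glued_dist Y d R y x" by (simp only: glued_dist_eq_Inf)
next
  fix x assume x: "x \<in> Y"
  have "glue_chain Y d R x x 0" using glue_chain.single[OF x x, of d R] refl[OF x] by simp
  then have "glued_dist Y d R x x \<le> 0" using nonneg by (intro glued_dist_le[where d = d])
  moreover have "0 \<le> glued_dist Y d R x x"
    unfolding glued_dist_eq_Inf using glue_chain_nonneg[OF nonneg] \<open>glue_chain Y d R x x 0\<close>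
    by (intro cInf_greatest) auto
  ultimately show "glued_dist Y d R x x = 0" by simp
next
  fix x y z assume xyz: "x \<in> Y" "y \<in> Y" "z \<in> Y"
  have ne: "{s. glue_chain Y d R p q s} \<noteq> {}" if "p \<in> Y" "q \<in> Y" for p q
    using that by (auto intro: glue_chain.single)
  have "glued_dist Y d R x z \<le> s + s'" if "glue_chain Y d R x y s" "glue_chain Y d R y z s'" for s s'
    by (rule glued_dist_le[where d = d]) (simp_all add: nonneg glue_chain_append[OF that R(1)])
  \<comment> \<open>The two infima are taken one at a time: with \<open>s\<close> moved to the left,
    first over all \<open>s'\<close>, then over all \<open>s\<close>.\<close>
  then have "glued_dist Y d R x z - s \<le> s'"
    if "glue_chain Y d R x y s" "glue_chain Y d R y z s'" for s s' using that by fastforce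
  then have "glued_dist Y d R x z - s \<le> glued_dist Y d R y z" if "glue_chain Y d R x y s" for s
    unfolding glued_dist_eq_Inf[of Y d R y z] using ne[OF xyz(2,3)] that
    by (intro cInf_greatest) auto
  then have "glued_dist Y d R x z - glued_dist Y d R y z \<le> s" if "glue_chain Y d R x y s" for s
    using that by fastforce
  then have "glued_dist Y d R x z - glued_dist Y d R y z \<le> glued_dist Y d R x y"
    unfolding glued_dist_eq_Inf[of Y d R x y] using ne[OF xyz(1,2)]
    by (intro cInf_greatest) auto
  then show "glued_dist Y d R x z \<le> glued_dist Y d R x y + glued_dist Y d R y z" by simp
qed

text \<open>A sequence of leaves is a chain of consecutive pairs glued by equality. The sequence
  with a single leaf has no such pair; it corresponds to the chain \<open>(L, L)\<close>, whose cost
  must then be zero.\<close>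

lemma leaf_chain_dist_eq_glued_dist:
  assumes "\<And>L. L \<in> \<L> \<Longrightarrow> set_dist d L L = 0"
  shows "leaf_chain_dist d \<L> = glued_dist \<L> (set_dist d) Id"
proof (intro ext)
  fix L L'
  let ?P = "\<lambda>Ls L s. s = (\<Sum>i<length Ls - 1. set_dist d (Ls ! i) (Ls ! Suc i)) \<and>
            Ls \<noteq> [] \<and> set Ls \<subseteq> \<L> \<and> hd Ls = L \<and> last Ls = L'"
  have "glue_chain \<L> (set_dist d) Id L L' s" if "?P Ls L s" for Ls L s
    using that
  proof (induction Ls arbitrary: L s)
    case Nil
    then show ?case by simp
  next
    case (Cons K Ls)
    show ?case
    proof (cases Ls)
      case Nil
      then show ?thesis using Cons(2) glue_chain.single[of L \<L> L "set_dist d"] assms by auto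
    next
      case (Cons K' Ks)
      let ?s = "\<Sum>i<length Ls - 1. set_dist d (Ls ! i) (Ls ! Suc i)"
      have P: "?P (K # Ls) L s" by fact
      have s: "s = set_dist d K K' + ?s"
        using P Cons by (simp add: sum.lessThan_Suc_shift del: sum.lessThan_Suc)
      have "?P Ls K' ?s" using P Cons by auto
      then have "glue_chain \<L> (set_dist d) Id K' L' ?s" by (rule Cons.IH)
      moreover have "K \<in> \<L>" "K' \<in> \<L>" "L = K" using P Cons by auto
      ultimately show ?thesis using s by (auto intro: glue_chain.step)
    qed
  qed
  moreover have "\<exists>Ls. ?P Ls L s" if "glue_chain \<L> (set_dist d) Id L L' s" for s
    using that
  proof (induction rule: glue_chain.induct)
    case (single p q)
    then have "(set_dist d p q = (\<Sum>i<length [p, q] - 1. set_dist d ([p, q] ! i) ([p, q] ! Suc i))) \<and>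
            [p, q] \<noteq> [] \<and> set [p, q] \<subseteq> \<L> \<and> hd [p, q] = p \<and> last [p, q] = q" by simp
    then show ?case by blast
  next
    case (step p q p' y s)
    then obtain Ls where Ls: "s = (\<Sum>i<length Ls - 1. set_dist d (Ls ! i) (Ls ! Suc i))"
       "Ls \<noteq> []" "set Ls \<subseteq> \<L>" "hd Ls = p'" "last Ls = y" by blast
    obtain m where m: "length Ls = Suc m" using Ls(2) by (cases Ls) auto
    have "p' = q" using step by simp
    have "set_dist d p q + s =
      (\<Sum>i<length (p # Ls) - 1. set_dist d ((p # Ls) ! i) ((p # Ls) ! Suc i))"
      using Ls \<open>p' = q\<close> m by (simp add: hd_conv_nth sum.lessThan_Suc_shift del: sum.lessThan_Suc)
    moreover have "p # Ls \<noteq> []" "set (p # Ls) \<subseteq> \<L>" "hd (p # Ls) = p" "last (p # Ls) = y"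
      using Ls step(1) by auto
    ultimately show ?case by blast
  qed
  ultimately have "{s. glue_chain \<L> (set_dist d) Id L L' s} =
     {\<Sum>i<length Ls - 1. set_dist d (Ls ! i) (Ls ! Suc i) | Ls.
            Ls \<noteq> [] \<and> set Ls \<subseteq> \<L> \<and> hd Ls = L \<and> last Ls = L'}" by blast
  then show "leaf_chain_dist d \<L> L L' = glued_dist \<L> (set_dist d) Id L L'"
    unfolding glued_dist_eq_Inf leaf_chain_dist_def by simp
qed

section \<open>Charts, plaques and leaves\<close>

lemma chart_invD:
  assumes "is_chart c"
  shows "p \<in> fst c \<Longrightarrow> chart_inv c (snd c p) = p"
    and "q \<in> snd c ` fst c \<Longrightarrow> snd c (chart_inv c q) = q"
    and "q \<in> snd c ` fst c \<Longrightarrow> chart_inv c q \<in> fst c"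
    and "continuous_on (fst c) (snd c)" and "continuous_on (snd c ` fst c) (chart_inv c)"
    and "open (fst c)" and "open (snd c ` fst c)"
  using assms unfolding is_chart_def homeomorphism_def by auto

lemma open_chart_image:
  assumes "is_chart c" "open W"
  shows "open (snd c ` (fst c \<inter> W))"
proof -
  have "openin (top_of_set (snd c ` fst c)) (snd c ` (fst c \<inter> W))"
    using assms unfolding is_chart_def
    by (intro homeomorphism_imp_open_map[where S = "fst c" and g = "chart_inv c"]) (auto simp: openin_open)
  then show ?thesis using assms openin_open_eq is_chart_def by blast
qed

lemma smooth_atlasD:
  assumes "smooth_atlas A"
  shows "c \<in> A \<Longrightarrow> is_chart c" and "\<exists>c\<in>A. p \<in> fst c"
    and "c \<in> A \<Longrightarrow> c' \<in> A \<Longrightarrow> smooth_on (snd c ` (fst c \<inter> fst c')) (transition c c')"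
  using assms unfolding smooth_atlas_def by (blast, blast, blast)

lemma transition_has_derivative:
  assumes "smooth_atlas A" "c \<in> A" "c' \<in> A" "p \<in> fst c" "p \<in> fst c'"
  shows "(transition c c' has_derivative frechet_derivative (transition c c') (at (snd c p)))
    (at (snd c p))"
proof -
  have "Ck_on (Suc 0) (snd c ` (fst c \<inter> fst c')) (transition c c')"
    using smooth_atlasD(3)[OF assms(1-3)] smooth_on_def by blast
  then show ?thesis using assms(4,5) frechet_derivative_works by force
qed

lemma transition_chart:
  assumes "is_chart c" "p \<in> fst c"
  shows "transition c c' (snd c p) = snd c' p"
  using chart_invD(1)[OF assms] by (simp add: transition_def)

text \<open>The chain rule for the transition map. The composite agrees with the map in the new
  chart only where \<open>\<Phi>\<close> stays in the domain of \<open>c\<close>; continuity makes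
  this true near \<open>q\<close>.\<close>

lemma has_derivative_change_chart:
  assumes A: "smooth_atlas A" "c \<in> A" "c' \<in> A"
    and \<Phi>: "\<Phi> q \<in> fst c" "\<Phi> q \<in> fst c'" "continuous (at q within S) \<Phi>" "q \<in> S"
    and D: "(snd c \<circ> \<Phi> has_derivative D) (at q within S)"
  shows "(snd c' \<circ> \<Phi> has_derivative
      frechet_derivative (transition c c') (at (snd c (\<Phi> q))) \<circ> D) (at q within S)"
proof -
  have c: "is_chart c" using A smooth_atlasD by blast
  have T: "(transition c c' \<circ> (snd c \<circ> \<Phi>) has_derivative
      frechet_derivative (transition c c') (at (snd c (\<Phi> q))) \<circ> D) (at q within S)"
    using transition_has_derivative[OF A \<Phi>(1,2)]
    by (intro diff_chain_within[OF D]) (simp add: has_derivative_at_withinI)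
  have "(\<Phi> \<longlongrightarrow> \<Phi> q) (at q within S)" using \<Phi>(3) by (simp add: continuous_within)
  then have "\<forall>\<^sub>F x in at q within S. \<Phi> x \<in> fst c"
    using chart_invD(6)[OF c] \<Phi>(1) by (rule topological_tendstoD)
  then have "\<forall>\<^sub>F x in at q within S. (transition c c' \<circ> (snd c \<circ> \<Phi>)) x = (snd c' \<circ> \<Phi>) x"
    by eventually_elim (simp add: transition_chart[OF c])
  then show ?thesis
    using has_derivative_transform_eventually[OF T] \<Phi> by (simp add: transition_chart[OF c])
qed

lemma foliated_atlasD:
  assumes "foliated_atlas A F"
  shows "smooth_atlas (A \<union> F)" "\<exists>c\<in>F. p \<in> fst c" "c \<in> F \<Longrightarrow> is_chart c"
    and "c \<in> F \<Longrightarrow> \<exists>a b. snd c ` fst c = box a b"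
    and "c \<in> F \<Longrightarrow> c' \<in> F \<Longrightarrow> p \<in> fst c \<Longrightarrow> p \<in> fst c' \<Longrightarrow>
        \<exists>W h. open W \<and> p \<in> W \<and>
          (\<forall>q\<in>W \<inter> fst c \<inter> fst c'. snd (snd c' q) = h (snd (snd c q)))"
proof -
  show "smooth_atlas (A \<union> F)" using assms unfolding foliated_atlas_def by blast
  then show "c \<in> F \<Longrightarrow> is_chart c" using smooth_atlasD by blast
  show "\<exists>c\<in>F. p \<in> fst c" using assms unfolding foliated_atlas_def by blast
  show "c \<in> F \<Longrightarrow> \<exists>a b. snd c ` fst c = box a b" using assms unfolding foliated_atlas_def by blast
  show "c \<in> F \<Longrightarrow> c' \<in> F \<Longrightarrow> p \<in> fst c \<Longrightarrow> p \<in> fst c' \<Longrightarrow>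
        \<exists>W h. open W \<and> p \<in> W \<and>
          (\<forall>q\<in>W \<inter> fst c \<inter> fst c'. snd (snd c' q) = h (snd (snd c q)))"
    using assms unfolding foliated_atlas_def by blast
qed

text \<open>Along a horizontal line the old transverse coordinate is constant, so by coherence the
  new one is \<open>h\<close> of a constant. Restricting to such a line avoids differentiating
  \<open>h\<close>, of which no regularity is given.\<close>

lemma transition_horizontal:
  assumes F: "foliated_atlas A F" "c \<in> F" "c' \<in> F" and p: "p \<in> fst c" "p \<in> fst c'"
  shows "snd (frechet_derivative (transition c c') (at (snd c p)) (w, 0)) = 0"
proof -
  let ?D = "frechet_derivative (transition c c') (at (snd c p))"
  have c: "is_chart c" "is_chart c'" using F foliated_atlasD(3) by blast+
  obtain W h where W: "open W" "p \<in> W"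
    "\<And>q. q \<in> W \<inter> fst c \<inter> fst c' \<Longrightarrow> snd (snd c' q) = h (snd (snd c q))"
    using foliated_atlasD(5)[OF F p] by blast
  define U where "U = snd c ` (fst c \<inter> (W \<inter> fst c'))"
  have U: "open U" unfolding U_def using chart_invD(6)[OF c(2)] W(1) by (intro open_chart_image c) auto
  have hU: "snd (transition c c' q) = h (snd q)" if "q \<in> U" for q
    using that W(3) unfolding U_def by (auto simp: transition_chart[OF c(1)])
  have T: "(transition c c' has_derivative ?D) (at (snd c p))"
    using foliated_atlasD(1)[OF F(1)] F p by (intro transition_has_derivative[of "A \<union> F"]) auto
  define l where "l s = snd c p + s *\<^sub>R (w, 0)" for s :: real
  have l: "(l has_derivative (\<lambda>s. s *\<^sub>R (w, 0))) (at 0)"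
    unfolding l_def by (auto intro!: derivative_eq_intros simp: zero_prod_def)
  have l0: "l 0 = snd c p" by (simp add: l_def zero_prod_def)
  have 1: "((\<lambda>s. snd (transition c c' (l s))) has_derivative (\<lambda>s. snd (?D (s *\<^sub>R (w, 0))))) (at 0)"
    by (intro has_derivative_snd has_derivative_compose[OF l]) (simp add: l0 T)
  have "(l \<longlongrightarrow> l 0) (at 0)" using l has_derivative_continuous by (metis continuous_at)
  moreover have "l 0 \<in> U" using W p unfolding l0 U_def by blast
  ultimately have "\<forall>\<^sub>F s in at 0. l s \<in> U" using U topological_tendstoD by blast
  then have ev: "\<forall>\<^sub>F s in at 0. snd (transition c c' (l s)) = h (snd (snd c p))"
    by eventually_elim (simp add: hU, simp add: l_def)
  have "((\<lambda>s. h (snd (snd c p))) has_derivative (\<lambda>s. snd (?D (s *\<^sub>R (w, 0))))) (at 0)"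
    by (rule has_derivative_transform_eventually[OF 1 ev])
      (use hU[OF \<open>l 0 \<in> U\<close>] in \<open>simp_all add: l0 zero_prod_def\<close>)
  then have "(\<lambda>s. snd (?D (s *\<^sub>R (w, 0)))) = (\<lambda>s. 0)"
    by (rule has_derivative_unique) simp
  then show ?thesis by (metis scaleR_one)
qed

text \<open>A vector that is horizontal in one foliated chart is horizontal in every other by
  \<open>transition_horizontal\<close>, so the existential in \<open>leaf_tangent\<close> may be
  tested in any chart \<open>c\<close>. The chart \<open>a\<close> carries the differentiability of
  \<open>\<Phi>\<close>, which then passes to the foliated charts.\<close>

lemma leaf_tangent_iff:
  assumes F: "foliated_atlas A F" and a: "a \<in> A \<union> F" "\<Phi> q \<in> fst a"
    and cont: "isCont \<Phi> q" and diff: "(snd a \<circ> \<Phi>) differentiable (at q)"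
    and c: "c \<in> F" "\<Phi> q \<in> fst c"
  shows "v \<in> leaf_tangent F \<Phi> q \<longleftrightarrow> snd (frechet_derivative (snd c \<circ> \<Phi>) (at q) v) = 0"
proof
  assume "v \<in> leaf_tangent F \<Phi> q"
  then obtain c' where c': "c' \<in> F" "\<Phi> q \<in> fst c'"
    and v: "snd (frechet_derivative (snd c' \<circ> \<Phi>) (at q) v) = 0"
    unfolding leaf_tangent_def by blast
  note sm = foliated_atlasD(1)[OF F]
  let ?D' = "frechet_derivative (snd c' \<circ> \<Phi>) (at q)"
  have Da: "(snd a \<circ> \<Phi> has_derivative frechet_derivative (snd a \<circ> \<Phi>) (at q)) (at q)"
    using diff frechet_derivative_works by blast
  have "(snd c' \<circ> \<Phi>) differentiable (at q)"
    using has_derivative_change_chart[OF sm a(1) _ a(2) c'(2) cont _ Da] c' unfolding differentiable_def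
    by auto
  then have "(snd c' \<circ> \<Phi> has_derivative ?D') (at q)"
    using frechet_derivative_works by blast
  then have "(snd c \<circ> \<Phi> has_derivative
       frechet_derivative (transition c' c) (at (snd c' (\<Phi> q))) \<circ> ?D') (at q)"
    using has_derivative_change_chart[OF sm _ _ c'(2) c(2) cont] c c' by auto
  then have "frechet_derivative (snd c \<circ> \<Phi>) (at q) =
       frechet_derivative (transition c' c) (at (snd c' (\<Phi> q))) \<circ> ?D'"
    by (rule frechet_derivative_at[symmetric]) 
  moreover have "?D' v = (fst (?D' v), 0)" using v by (simp add: prod_eq_iff)
  ultimately show "snd (frechet_derivative (snd c \<circ> \<Phi>) (at q) v) = 0"
    using transition_horizontal[OF F c'(1) c(1) c'(2) c(2)] by (metis comp_apply)
next
  assume "snd (frechet_derivative (snd c \<circ> \<Phi>) (at q) v) = 0"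
  then show "v \<in> leaf_tangent F \<Phi> q" unfolding leaf_tangent_def using c by blast
qed

section \<open>The leaf topology and its connected sets\<close>

lemma topspace_leaf_topology:
  assumes "foliated_atlas A F" shows "topspace (leaf_topology F) = UNIV"
proof -
  have "p \<in> \<Union> {W \<inter> plaque c y | W c y. open W \<and> c \<in> F}" for p
  proof -
    obtain c where "c \<in> F" "p \<in> fst c" using foliated_atlasD(2)[OF assms] by blast
    then have "p \<in> UNIV \<inter> plaque c (snd (snd c p))" by (simp add: plaque_def)
    then show ?thesis using \<open>c \<in> F\<close> open_UNIV by blast
  qed
  then show ?thesis unfolding leaf_topology_def topology_generated_by_topspace by blast
qed

lemma openin_plaque:
  assumes "c \<in> F" shows "openin (leaf_topology F) (plaque c y)"
  unfolding leaf_topology_def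
  by (rule topology_generated_by_Basis) (use assms open_UNIV in blast)

text \<open>A plaque is the image of a convex slice of the coordinate box under
  \<open>chart_inv c\<close>. The point is continuity into the finer leaf topology: by coherence the
  slice stays locally inside one plaque of any other foliated chart, so generating open sets have
  open preimages in the slice.\<close>

lemma connectedin_plaque:
  fixes F :: "('m::topological_space, (real^'n::finite) \<times> real) chart set"
  assumes F: "foliated_atlas A F" and c: "c \<in> F"
  shows "connectedin (leaf_topology F) (plaque c y)"
proof -
  obtain a b where ab: "snd c ` fst c = box a b" using foliated_atlasD(4)[OF F c] by blast
  have ch: "is_chart c" using F c foliated_atlasD(3) by blast
  define V where "V = {q \<in> box a b. snd q = y}"
  have V: "V \<subseteq> snd c ` fst c" using ab V_def by blast
  have "convex V"
  proof -
    have "V = box a b \<inter> snd -` {y}" unfolding V_def by blast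
    moreover have "convex (snd -` {y} :: ((real^'n) \<times> real) set)"
      by (rule convex_linear_vimage) (auto intro: linear_snd)
    ultimately show ?thesis by (simp add: convex_Int)
  qed
  have "continuous_map (top_of_set V) (leaf_topology F) (chart_inv c)"
    unfolding leaf_topology_def
  proof (rule continuous_on_generated_topo)
    show "chart_inv c ` topspace (top_of_set V) \<subseteq> \<Union> {W \<inter> plaque c y | W c y. open W \<and> c \<in> F}"
      using topspace_leaf_topology[OF F] unfolding leaf_topology_def topology_generated_by_topspace by simp
  next
    fix U assume "U \<in> {W \<inter> plaque c y | W c y. open W \<and> c \<in> F}"
    then obtain W c' y' where U: "U = W \<inter> plaque c' y'" "open W" "c' \<in> F" by blast
    have ch': "is_chart c'" using F U foliated_atlasD(3) by blast
    show "openin (top_of_set V) (chart_inv c -` U \<inter> topspace (top_of_set V))"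
    proof (subst openin_subopen, intro ballI)
      fix q assume "q \<in> chart_inv c -` U \<inter> topspace (top_of_set V)"
      then have q: "q \<in> V" "chart_inv c q \<in> W" "chart_inv c q \<in> fst c'"
        "snd (snd c' (chart_inv c q)) = y'" using U by (auto simp: plaque_def)
      have qc: "chart_inv c q \<in> fst c" "snd c (chart_inv c q) = q"
        using q(1) V chart_invD(2,3)[OF ch] by blast+
      obtain W' h where W': "open W'" "chart_inv c q \<in> W'"
        "\<And>r. r \<in> W' \<inter> fst c \<inter> fst c' \<Longrightarrow> snd (snd c' r) = h (snd (snd c r))"
        using foliated_atlasD(5)[OF F c U(3) qc(1) q(3)] by blast
      \<comment> \<open>The whole slice has transverse coordinate \<open>y\<close>, so near
        \<open>q\<close> it lies in the level \<open>y'\<close> of \<open>c'\<close>.\<close>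
      have hy: "h y = y'"
        using W'(3)[of "chart_inv c q"] W' q qc V_def by auto
      define T where "T = snd c ` (fst c \<inter> (W \<inter> W' \<inter> fst c'))"
      have "open T" unfolding T_def
        using U W' chart_invD(6)[OF ch'] by (intro open_chart_image ch) auto
      have "openin (top_of_set V) (V \<inter> T)" using \<open>open T\<close> by (rule openin_open_Int)
      moreover have "q \<in> V \<inter> T" unfolding T_def using q qc W' by (auto intro!: image_eqI[of q])
      moreover have "V \<inter> T \<subseteq> chart_inv c -` U \<inter> topspace (top_of_set V)"
      proof
        fix r assume r: "r \<in> V \<inter> T"
        then obtain p where p: "p \<in> fst c" "p \<in> W" "p \<in> W'" "p \<in> fst c'" "r = snd c p"
          unfolding T_def by blast
        have "chart_inv c r = p" using chart_invD(1)[OF ch p(1)] p by simp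
        moreover have "snd (snd c' p) = y'" using W'(3)[of p] p hy r V_def by auto
        ultimately show "r \<in> chart_inv c -` U \<inter> topspace (top_of_set V)"
          using U p r by (auto simp: plaque_def)
      qed
      ultimately show "\<exists>T. openin (top_of_set V) T \<and> q \<in> T \<and>
          T \<subseteq> chart_inv c -` U \<inter> topspace (top_of_set V)" by blast
    qed
  qed
  moreover have "connectedin (top_of_set V) V"
    using \<open>convex V\<close> by (simp add: connectedin_subtopology convex_connected)
  ultimately have "connectedin (leaf_topology F) (chart_inv c ` V)"
    by (rule connectedin_continuous_map_image)
  moreover have "chart_inv c ` V = plaque c y"
  proof
    show "chart_inv c ` V \<subseteq> plaque c y"
      using V chart_invD(2,3)[OF ch] unfolding plaque_def V_def by fastforce
    show "plaque c y \<subseteq> chart_inv c ` V"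
    proof
      fix p assume "p \<in> plaque c y"
      then have "snd c p \<in> V" "p = chart_inv c (snd c p)"
        using ab chart_invD(1)[OF ch] unfolding plaque_def V_def by auto
      then show "p \<in> chart_inv c ` V" by blast
    qed
  qed
  ultimately show ?thesis by simp
qed

lemma leaf_through_eqI:
  assumes "connectedin (leaf_topology F) S" "p \<in> S" "q \<in> S"
  shows "leaf_through F p = leaf_through F q"
proof -
  have "connected_component_of (leaf_topology F) p q"
    using assms unfolding connected_component_of_def by blast
  then show ?thesis unfolding leaf_through_def
    by (metis connected_component_of_equiv)
qed

lemma leaf_through_self:
  assumes "foliated_atlas A F" shows "p \<in> leaf_through F p"
  using topspace_leaf_topology[OF assms] unfolding leaf_through_def
  by (simp add: connected_component_of_refl)

lemma leaf_through_eq_iff: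
  assumes "foliated_atlas A F"
  shows "leaf_through F p = leaf_through F q \<longleftrightarrow> q \<in> leaf_through F p"
proof -
  have "connectedin (leaf_topology F) (leaf_through F p)"
    unfolding leaf_through_def by (rule connectedin_connected_component_of)
  then show ?thesis using leaf_through_eqI leaf_through_self[OF assms] by metis
qed

lemma leaves_eq:
  assumes "foliated_atlas A F" shows "leaves F = range (leaf_through F)"
  unfolding leaves_def leaf_through_def connected_components_of_def
  by (simp add: topspace_leaf_topology[OF assms])

text \<open>The points at \<open>f\<close>-distance zero from \<open>p\<close> form a union of
  plaques, and so does their complement. Both are open in the leaf topology, so a connected leaf
  cannot be split between them.\<close>

lemma zero_on_leaves_if_zero_on_plaques:
  assumes F: "foliated_atlas A F" and f: "pseudometric_on UNIV f"
    and zero: "\<And>c y p q. c \<in> F \<Longrightarrow> p \<in> plaque c y \<Longrightarrow> q \<in> plaque c y \<Longrightarrow> f p q = 0"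
    and eq: "leaf_through F p = leaf_through F q"
  shows "f p q = 0"
proof -
  let ?X = "leaf_topology F"
  define U where "U = {x. f p x = 0}"
  have *: "openin ?X V" if V: "\<And>x y. x \<in> V \<Longrightarrow> f x y = 0 \<Longrightarrow> y \<in> V" for V
  proof (subst openin_subopen, intro ballI)
    fix x assume x: "x \<in> V"
    obtain c where c: "c \<in> F" "x \<in> fst c" using foliated_atlasD(2)[OF F] by blast
    then have "x \<in> plaque c (snd (snd c x))" by (simp add: plaque_def)
    moreover from this have "plaque c (snd (snd c x)) \<subseteq> V" using zero[OF c(1)] V[OF x] by blast
    ultimately show "\<exists>T. openin ?X T \<and> x \<in> T \<and> T \<subseteq> V" using openin_plaque[OF c(1)] by blast
  qed
  have tr: "f x y = 0" if "f x z = 0" "f z y = 0" for x y z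
    using pseudometric_on_zero_trans[OF f] that by blast
  have sy: "f x y = f y x" for x y using pseudometric_onD(3)[OF f] by blast
  have "openin ?X U" unfolding U_def by (rule *) (use tr in blast)
  moreover have "openin ?X (- U)" 
  proof (rule *)
    fix x y assume "x \<in> - U" "f x y = 0"
    then show "y \<in> - U" using tr[of p y x] sy[of x y] unfolding U_def by auto
  qed
  ultimately have "closedin ?X U" "openin ?X U"
    using topspace_leaf_topology[OF F] by (auto simp: closedin_def Compl_eq_Diff_UNIV)
  moreover have "connectedin ?X (leaf_through F p)"
    unfolding leaf_through_def by (rule connectedin_connected_component_of)
  ultimately have "leaf_through F p \<subseteq> U \<or> disjnt (leaf_through F p) U"
    using connectedin_clopen_cases by metis
  moreover have "p \<in> U" using pseudometric_onD(1)[OF f] U_def by auto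
  ultimately have "leaf_through F p \<subseteq> U" using leaf_through_self[OF F] by (meson disjnt_iff)
  then show ?thesis using leaf_through_eq_iff[OF F, of p q] eq U_def by auto
qed

section \<open>Comparing two foliations\<close>

text \<open>In a foliated chart the curve keeps its transverse coordinate, hence stays in one plaque
  for a short time, and its leaf is a locally constant function of the parameter. Derivatives are
  asked for in the open interval only, which permits end points where tangency is unknown.\<close>

lemma leaf_through_tangent_curve:
  fixes c :: "real \<Rightarrow> 'm::topological_space"
  assumes F: "foliated_atlas A F" and "a \<le> b" and cont: "continuous_on {a..b} c"
    and der: "\<And>t \<psi>. a < t \<Longrightarrow> t < b \<Longrightarrow> \<psi> \<in> F \<Longrightarrow> c t \<in> fst \<psi> \<Longrightarrow>
       ((\<lambda>s. snd (snd \<psi> (c s))) has_real_derivative 0) (at t)"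
  shows "leaf_through F (c a) = leaf_through F (c b)"
proof (rule connected_local_const[where A = "{a..b}" and f = "\<lambda>t. leaf_through F (c t)"])
  show "\<forall>t\<in>{a..b}. \<forall>\<^sub>F s in at t within {a..b}. leaf_through F (c t) = leaf_through F (c s)"
  proof
    fix t assume t: "t \<in> {a..b}"
    obtain \<psi> where \<psi>: "\<psi> \<in> F" "c t \<in> fst \<psi>" using foliated_atlasD(2)[OF F] by blast
    have ch: "is_chart \<psi>" using F \<psi> foliated_atlasD(3) by blast
    have "(c \<longlongrightarrow> c t) (at t within {a..b})" using cont t by (simp add: continuous_on)
    then have "\<forall>\<^sub>F s in at t within {a..b}. c s \<in> fst \<psi>"
      using chart_invD(6)[OF ch] \<psi>(2) by (rule topological_tendstoD)
    then obtain e where e: "e > 0" "\<And>s. s \<in> {a..b} \<Longrightarrow> s \<noteq> t \<Longrightarrow> dist s t < e \<Longrightarrow> c s \<in> fst \<psi>"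
      unfolding eventually_at by blast
    have "leaf_through F (c t) = leaf_through F (c s)"
      if s: "s \<in> {a..b}" "s \<noteq> t" "dist s t < e" for s
    proof -
      define lo hi where "lo = min s t" and "hi = max s t"
      have lohi: "lo < hi" "a \<le> lo" "hi \<le> b" "{lo..hi} \<subseteq> {a..b}" using s t by (auto simp: lo_def hi_def)
      have dom: "c r \<in> fst \<psi>" if "r \<in> {lo..hi}" for r
      proof (cases "r = t")
        case False
        have "dist r t < e" using s that by (auto simp: lo_def hi_def dist_real_def split: if_splits)
        then show ?thesis using e(2) False that lohi(4) by blast
      qed (use \<psi> in simp)
      have "continuous_on {lo..hi} (\<lambda>r. snd (snd \<psi> (c r)))"
        by (intro continuous_on_snd continuous_on_compose2[OF chart_invD(4)[OF ch]]
            continuous_on_subset[OF cont lohi(4)]) (use dom in blast)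
      then have "snd (snd \<psi> (c hi)) = snd (snd \<psi> (c lo))"
      proof (rule DERIV_isconst_end[OF lohi(1)])
        fix r assume "lo < r" "r < hi"
        then show "((\<lambda>r. snd (snd \<psi> (c r))) has_real_derivative 0) (at r)"
          using dom lohi \<psi> by (intro der) auto
      qed
      then have "snd (snd \<psi> (c s)) = snd (snd \<psi> (c t))"
        by (auto simp: lo_def hi_def min_def max_def split: if_splits)
      moreover have "c s \<in> fst \<psi>" by (rule dom) (auto simp: lo_def hi_def)
      ultimately have "c s \<in> plaque \<psi> (snd (snd \<psi> (c t)))" "c t \<in> plaque \<psi> (snd (snd \<psi> (c t)))"
        using \<psi> by (auto simp: plaque_def)
      then show ?thesis using leaf_through_eqI connectedin_plaque[OF F \<psi>(1)] by metis
    qed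
    then show "\<forall>\<^sub>F s in at t within {a..b}. leaf_through F (c t) = leaf_through F (c s)"
      unfolding eventually_at using e(1) by blast
  qed
qed (use assms(2) in auto)

lemma has_derivative_chart_inv:
  assumes "is_chart c" "q \<in> snd c ` fst c"
  shows "isCont (chart_inv c) q" "(snd c \<circ> chart_inv c has_derivative (\<lambda>v. v)) (at q)"
proof -
  note o = chart_invD(7)[OF assms(1)]
  show "isCont (chart_inv c) q"
    using chart_invD(5)[OF assms(1)] o assms(2) continuous_on_eq_continuous_at by blast
  have "\<forall>\<^sub>F x in at q. x \<in> snd c ` fst c"
    using o assms(2) eventually_at_topological by blast
  then have "\<forall>\<^sub>F x in at q. x = (snd c \<circ> chart_inv c) x"
    by eventually_elim (simp add: chart_invD(2)[OF assms(1)])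
  then show "(snd c \<circ> chart_inv c has_derivative (\<lambda>v. v)) (at q)"
    using has_derivative_transform_eventually[OF has_derivative_ident, of "snd c \<circ> chart_inv c" q UNIV]
      chart_invD(2)[OF assms] by simp
qed

text \<open>Tangent planes of the two foliations are compared in a chart \<open>a\<close> of
  \<open>A\<close>, so the velocity is carried from \<open>\<psi>\<close> to \<open>a\<close> and
  from there to \<open>\<psi>'\<close>.\<close>

lemma tangent_curve_change_foliation:
  fixes c :: "real \<Rightarrow> 'm::topological_space"
  assumes F: "foliated_atlas A F" and F': "foliated_atlas A F'"
    and a: "a \<in> A" "c t \<in> fst a"
    and tangent: "leaf_tangent F (chart_inv a) (snd a (c t)) \<subseteq> leaf_tangent F' (chart_inv a) (snd a (c t))"
    and \<psi>: "\<psi> \<in> F" "c t \<in> fst \<psi>" and \<psi>': "\<psi>' \<in> F'" "c t \<in> fst \<psi>'"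
    and c: "isCont c t" "(snd \<psi> \<circ> c has_derivative D) (at t)" "snd (D 1) = 0"
  shows "((\<lambda>s. snd (snd \<psi>' (c s))) has_real_derivative 0) (at t)"
proof -
  note sm = foliated_atlasD(1)[OF F] foliated_atlasD(1)[OF F']
  have ch: "is_chart a" using sm(1) a smooth_atlasD by blast
  let ?q = "snd a (c t)"
  have q: "?q \<in> snd a ` fst a" "chart_inv a ?q = c t"
    using a chart_invD(1)[OF ch] by auto
  note inv = has_derivative_chart_inv[OF ch q(1)]
  have lt: "v \<in> leaf_tangent G (chart_inv a) ?q \<longleftrightarrow>
      snd (frechet_derivative (transition a \<eta>) (at ?q) v) = 0"
    if "foliated_atlas A G" "\<eta> \<in> G" "c t \<in> fst \<eta>" for G \<eta> v
    unfolding transition_def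
  proof (rule leaf_tangent_iff[OF that(1), of a])
    show "snd a \<circ> chart_inv a differentiable at ?q" using inv(2) differentiable_def by blast
  qed (use a that inv q in auto)
  define Da where "Da = frechet_derivative (transition \<psi> a) (at (snd \<psi> (c t))) \<circ> D"
  have Da: "(snd a \<circ> c has_derivative Da) (at t)"
    unfolding Da_def
    by (rule has_derivative_change_chart[OF sm(1) _ _ \<psi>(2) a(2) _ _ c(2)]) (use c \<psi> a in auto)
  have "(snd \<psi> \<circ> c has_derivative frechet_derivative (transition a \<psi>) (at ?q) \<circ> Da) (at t)"
    by (rule has_derivative_change_chart[OF sm(1) _ _ a(2) \<psi>(2) _ _ Da]) (use c \<psi> a in auto)
  \<comment> \<open>Going to \<open>a\<close> and back to \<open>\<psi>\<close> returns the
    velocity, so its expression \<open>Da 1\<close> in \<open>a\<close> is tangent to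
    \<open>F\<close>.\<close>
  then have "D = frechet_derivative (transition a \<psi>) (at ?q) \<circ> Da"
    by (rule has_derivative_unique[OF c(2)])
  then have "Da 1 \<in> leaf_tangent F (chart_inv a) ?q" using lt[OF F \<psi>] c(3) by simp
  then have 0: "snd (frechet_derivative (transition a \<psi>') (at ?q) (Da 1)) = 0"
    using tangent lt[OF F' \<psi>'] by blast
  have 1: "(snd \<psi>' \<circ> c has_derivative frechet_derivative (transition a \<psi>') (at ?q) \<circ> Da) (at t)"
    by (rule has_derivative_change_chart[OF sm(2) _ _ a(2) \<psi>'(2) _ _ Da]) (use c \<psi>' a in auto)
  then have lin: "linear (frechet_derivative (transition a \<psi>') (at ?q) \<circ> Da)"
    by (rule has_derivative_linear)
  have "snd ((frechet_derivative (transition a \<psi>') (at ?q) \<circ> Da) s) = 0" for s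
    using linear_scale[OF lin, of s 1] 0 by simp
  then show ?thesis
    using has_derivative_snd[OF 1] unfolding has_field_derivative_def
    by (auto simp: comp_def lambda_zero)
qed

text \<open>Off \<open>K\<close> the plaques of the two foliations agree locally. A segment in a plaque of \<open>F\<close> that meets
  \<open>K\<close> is cut at its first and its last point in \<open>K\<close>, so tangency is never needed on \<open>K\<close> itself.\<close>

lemma zero_on_leaves_change_foliation:
  fixes F F' :: "('m::topological_space, (real^'n::finite) \<times> real) chart set"
  assumes A: "smooth_atlas A" and F: "foliated_atlas A F" and F': "foliated_atlas A F'"
    and f: "pseudometric_on UNIV f" and K: "closed K"
    and zero': "\<And>p q. leaf_through F' p = leaf_through F' q \<Longrightarrow> f p q = 0"
    and zeroK: "\<And>p q. p \<in> K \<Longrightarrow> q \<in> K \<Longrightarrow> f p q = 0"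
    and tangent: "\<And>a p. a \<in> A \<Longrightarrow> p \<in> fst a - K \<Longrightarrow>
       leaf_tangent F (chart_inv a) (snd a p) \<subseteq> leaf_tangent F' (chart_inv a) (snd a p)"
    and eq: "leaf_through F p = leaf_through F q"
  shows "f p q = 0"
  using eq
proof (rule zero_on_leaves_if_zero_on_plaques[OF F f, rotated])
  fix \<psi> y p q assume \<psi>: "\<psi> \<in> F" and pq: "p \<in> plaque \<psi> y" "q \<in> plaque \<psi> y"
  have tr: "f x y = 0" if "f x z = 0" "f z y = 0" for x y z
    using pseudometric_on_zero_trans[OF f] that by blast
  have ch: "is_chart \<psi>" using F \<psi> foliated_atlasD(3) by blast
  obtain l u where lu: "snd \<psi> ` fst \<psi> = box l u" using foliated_atlasD(4)[OF F \<psi>] by blast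
  \<comment> \<open>The straight segment stays in the box by convexity and is horizontal because
    both ends have transverse coordinate \<open>y\<close>.\<close>
  define g where "g s = snd \<psi> p + s *\<^sub>R (snd \<psi> q - snd \<psi> p)" for s :: real
  define c where "c s = chart_inv \<psi> (g s)" for s
  have "snd \<psi> p \<in> box l u" "snd \<psi> q \<in> box l u" using pq lu by (auto simp: plaque_def)
  then have gb: "g s \<in> box l u" if "s \<in> {0..1}" for s
    using convexD_alt[OF convex_box(2), of "snd \<psi> p" l u "snd \<psi> q" s] that
    unfolding g_def by (simp add: algebra_simps)
  have gd: "(g has_derivative (\<lambda>s. s *\<^sub>R (snd \<psi> q - snd \<psi> p))) (at s)" for s
    unfolding g_def by (auto intro!: derivative_eq_intros)
  have gc: "isCont g s" for s using gd has_derivative_continuous by blast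
  have cc: "isCont c s" if "s \<in> {0..1}" for s
    unfolding c_def
    by (rule isCont_o2[OF gc]) (use has_derivative_chart_inv(1)[OF ch] gb[OF that] lu in blast)
  have cd: "(snd \<psi> \<circ> c has_derivative (\<lambda>s. s *\<^sub>R (snd \<psi> q - snd \<psi> p))) (at s)" if "s \<in> {0..1}" for s
  proof -
    have "g s \<in> snd \<psi> ` fst \<psi>" using gb[OF that] lu by blast
    from diff_chain_at[OF gd has_derivative_chart_inv(2)[OF ch this]]
    show ?thesis by (simp add: c_def comp_def)
  qed
  have snd0: "snd (snd \<psi> q - snd \<psi> p) = 0" using pq by (simp add: plaque_def)
  have cont: "continuous_on {0..1} c" using cc continuous_at_imp_continuous_on by blast
  have c01: "c 0 = p" "c 1 = q"
    using pq chart_invD(1)[OF ch] by (auto simp: c_def g_def plaque_def)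
  have cdom: "c s \<in> fst \<psi>" if "s \<in> {0..1}" for s
    using gb[OF that] lu chart_invD(3)[OF ch] by (simp add: c_def)
  \<comment> \<open>Only the open interval has to miss \<open>K\<close>, so an end point may be a
    cutting point on \<open>K\<close>.\<close>
  have off: "f (c s) (c s') = 0"
    if ss: "0 \<le> s" "s \<le> s'" "s' \<le> 1" and nK: "\<And>r. s < r \<Longrightarrow> r < s' \<Longrightarrow> c r \<notin> K" for s s'
  proof (rule zero', rule leaf_through_tangent_curve[OF F' ss(2)])
    show "continuous_on {s..s'} c" by (rule continuous_on_subset[OF cont]) (use ss in auto)
    fix t \<psi>' assume t: "s < t" "t < s'" and \<psi>': "\<psi>' \<in> F'" "c t \<in> fst \<psi>'"
    have t01: "t \<in> {0..1}" using t ss by auto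
    obtain a where a: "a \<in> A" "c t \<in> fst a" using smooth_atlasD(2)[OF A] by blast
    show "((\<lambda>s. snd (snd \<psi>' (c s))) has_real_derivative 0) (at t)"
    proof (rule tangent_curve_change_foliation[where a = a and \<psi> = \<psi> and c = c,
          OF F F' a _ \<psi> _ \<psi>' cc[OF t01] cd[OF t01]])
      show "leaf_tangent F (chart_inv a) (snd a (c t)) \<subseteq> leaf_tangent F' (chart_inv a) (snd a (c t))"
        by (rule tangent) (use a nK[OF t] in auto)
    qed (use cdom[OF t01] snd0 in auto)
  qed
  define Z where "Z = {0..1} \<inter> c -` K"
  have "closed Z" unfolding Z_def using continuous_closed_preimage[OF cont _ K] by simp
  moreover have "bounded Z" by (rule bounded_subset[of "{0..1}"]) (auto simp: Z_def)
  ultimately have Z: "compact Z" by (simp add: compact_eq_bounded_closed)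
  show "f p q = 0"
  proof (cases "Z = {}")
    case True
    have "c r \<notin> K" if "0 < r" "r < 1" for r
      using True that unfolding Z_def by (metis IntI atLeastAtMost_iff empty_iff less_imp_le vimageI)
    then have "f (c 0) (c 1) = 0" by (intro off) auto
    then show ?thesis by (simp add: c01)
  next
    case False
    obtain s1 where s1: "s1 \<in> Z" "\<And>s. s \<in> Z \<Longrightarrow> s1 \<le> s" using compact_attains_inf[OF Z False] by blast
    obtain s2 where s2: "s2 \<in> Z" "\<And>s. s \<in> Z \<Longrightarrow> s \<le> s2" using compact_attains_sup[OF Z False] by blast
    have s12: "0 \<le> s1" "s1 \<le> 1" "0 \<le> s2" "s2 \<le> 1" using s1 s2 by (auto simp: Z_def)
    have nK: "c r \<notin> K" if "0 \<le> r" "r \<le> 1" "r < s1 \<or> s2 < r" for r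
      using s1(2)[of r] s2(2)[of r] that by (auto simp: Z_def)
    have "f (c 0) (c s1) = 0" by (rule off) (use s12 nK in auto)
    \<comment> \<open>In between, the curve may leave \<open>K\<close> and return arbitrarily often;
      only its two end points count.\<close>
    moreover have "f (c s1) (c s2) = 0" by (rule zeroK) (use s1 s2 in \<open>auto simp: Z_def\<close>)
    moreover have "f (c s2) (c 1) = 0" by (rule off) (use s12 nK in auto)
    ultimately show ?thesis using tr c01 by metis
  qed
qed

section \<open>The Riemannian distance\<close>

lemma riemannian_metricD:
  assumes "riemannian_metric A g" "c \<in> A"
  shows "p \<in> fst c \<Longrightarrow> bilinear (g c p)"
    and "p \<in> fst c \<Longrightarrow> v \<noteq> 0 \<Longrightarrow> 0 < g c p v v"
    and "smooth_on (snd c ` fst c) (\<lambda>q. g c (chart_inv c q) v w)"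
    and "c' \<in> A \<Longrightarrow> p \<in> fst c \<Longrightarrow> p \<in> fst c' \<Longrightarrow>
        g c p v w =
          g c' p (frechet_derivative (transition c c') (at (snd c p)) v)
                 (frechet_derivative (transition c c') (at (snd c p)) w)"
proof -
  note * = assms(1)[unfolded riemannian_metric_def] assms(2)
  show "p \<in> fst c \<Longrightarrow> bilinear (g c p)" "p \<in> fst c \<Longrightarrow> v \<noteq> 0 \<Longrightarrow> 0 < g c p v v"
    "smooth_on (snd c ` fst c) (\<lambda>q. g c (chart_inv c q) v w)"
    using * by blast+
  assume "c' \<in> A" "p \<in> fst c" "p \<in> fst c'"
  then show "g c p v w =
          g c' p (frechet_derivative (transition c c') (at (snd c p)) v)
                 (frechet_derivative (transition c c') (at (snd c p)) w)"
    using *(1)[THEN conjunct2, THEN conjunct2] assms(2) by blast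
qed

lemma riemannian_metric_nonneg:
  assumes "riemannian_metric A g" "c \<in> A" "p \<in> fst c"
  shows "0 \<le> g c p v v"
  using riemannian_metricD(2)[OF assms, of v] bilinear_lzero[OF riemannian_metricD(1)[OF assms], of v]
  by (cases "v = 0") auto

lemma speed_chart:
  assumes A: "smooth_atlas A"
  obtains \<phi> where "\<phi> \<in> A" "c t \<in> fst \<phi>"
    "speed A g c t = sqrt (g \<phi> (c t) (vector_derivative (snd \<phi> \<circ> c) (at t))
                                        (vector_derivative (snd \<phi> \<circ> c) (at t)))"
proof -
  have "\<exists>\<phi>. \<phi> \<in> A \<and> c t \<in> fst \<phi>" using smooth_atlasD(2)[OF A] by blast
  from someI_ex[OF this] that[of "SOME \<phi>. \<phi> \<in> A \<and> c t \<in> fst \<phi>"] show ?thesis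
    by (simp add: speed_def Let_def)
qed

lemma speed_nonneg:
  assumes "smooth_atlas A" "riemannian_metric A g"
  shows "0 \<le> speed A g c t"
  by (metis speed_chart[OF assms(1), of c t g] riemannian_metric_nonneg[OF assms(2)] real_sqrt_ge_zero)

text \<open>\<open>speed\<close> works in a chart picked by \<open>SOME\<close>. The chain rule and
  the transformation law of the metric bring its value into the given chart.\<close>

lemma speed_eq:
  assumes A: "smooth_atlas A" and g: "riemannian_metric A g"
    and \<psi>: "\<psi> \<in> A" "c t \<in> fst \<psi>" and c: "isCont c t"
    and v: "(snd \<psi> \<circ> c has_vector_derivative v) (at t)"
  shows "speed A g c t = sqrt (g \<psi> (c t) v v)"
proof -
  obtain \<phi> where \<phi>: "\<phi> \<in> A" "c t \<in> fst \<phi>"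
    and sp: "speed A g c t = sqrt (g \<phi> (c t) (vector_derivative (snd \<phi> \<circ> c) (at t))
                                        (vector_derivative (snd \<phi> \<circ> c) (at t)))"
    using speed_chart[OF A] by metis
  let ?D = "frechet_derivative (transition \<psi> \<phi>) (at (snd \<psi> (c t)))"
  have "linear ?D"
    using transition_has_derivative[OF A \<psi>(1) \<phi>(1) \<psi>(2) \<phi>(2)] by (rule has_derivative_linear)
  have "(snd \<phi> \<circ> c has_derivative ?D \<circ> (\<lambda>s. s *\<^sub>R v)) (at t)"
    by (rule has_derivative_change_chart[OF A \<psi>(1) \<phi>(1) \<psi>(2) \<phi>(2) c])
      (use v in \<open>simp_all add: has_vector_derivative_def\<close>)
  then have "(snd \<phi> \<circ> c has_vector_derivative ?D v) (at t)"
    using linear_scale[OF \<open>linear ?D\<close>] by (simp add: has_vector_derivative_def comp_def)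
  then have "vector_derivative (snd \<phi> \<circ> c) (at t) = ?D v" by (rule vector_derivative_at)
  then show ?thesis
    using sp riemannian_metricD(4)[OF g \<psi>(1) \<phi>(1) \<psi>(2) \<phi>(2)] by simp
qed

lemma curve_length_nonneg:
  assumes "smooth_atlas A" "riemannian_metric A g"
  shows "0 \<le> curve_length A g c"
proof (cases "speed A g c integrable_on {0..1}")
  case True
  then show ?thesis unfolding curve_length_def
    by (rule integral_nonneg) (simp add: speed_nonneg[OF assms])
\<comment> \<open>A speed that is not integrable gives the default length 0.\<close>
qed (simp add: curve_length_def not_integrable_integral)

text \<open>An equivalence, because \<open>speed_reverse\<close> also has to transfer the absence of
  a derivative.\<close>

lemma has_vector_derivative_reverse_iff:
  "((\<lambda>s. f (1 - s)) has_vector_derivative v) (at t) \<longleftrightarrow> (f has_vector_derivative - v) (at (1 - t))"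
  (is "?L v f t = _")
proof -
  have *: "((\<lambda>s. f (1 - s)) has_vector_derivative - v) (at t)"
    if "(f has_vector_derivative v) (at (1 - t))" for f :: "real \<Rightarrow> 'a" and v t
  proof -
    have r: "((\<lambda>s. 1 - s) has_derivative (\<lambda>s. - s)) (at t)"
      by (auto intro!: derivative_eq_intros)
    have "((\<lambda>s. f (1 - s)) has_derivative (\<lambda>s. (- s) *\<^sub>R v)) (at t)"
      using has_derivative_compose[OF r that[unfolded has_vector_derivative_def]] .
    then show ?thesis by (simp add: has_vector_derivative_def)
  qed
  from *[of f "- v" t] *[of "\<lambda>s. f (1 - s)" v "1 - t"] show ?thesis by auto
qed

text \<open>This holds at every \<open>t\<close>, break points included. Both curves pass the same
  point, so \<open>SOME\<close> picks the same chart; where no derivative exists, both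
  \<open>vector_derivative\<close> terms choose from the same empty predicate and coincide.\<close>

lemma speed_reverse:
  assumes A: "smooth_atlas A" and g: "riemannian_metric A g"
  shows "speed A g (\<lambda>s. c (1 - s)) t = speed A g c (1 - t)"
proof -
  define \<phi> where "\<phi> = (SOME \<phi>. \<phi> \<in> A \<and> c (1 - t) \<in> fst \<phi>)"
  have "\<exists>\<phi>. \<phi> \<in> A \<and> c (1 - t) \<in> fst \<phi>" using smooth_atlasD(2)[OF A] by blast
  then have \<phi>: "\<phi> \<in> A" "c (1 - t) \<in> fst \<phi>" unfolding \<phi>_def by (metis (mono_tags, lifting) someI_ex)+
  define v where "v = vector_derivative (snd \<phi> \<circ> c) (at (1 - t))"
  define v' where "v' = vector_derivative (snd \<phi> \<circ> (\<lambda>s. c (1 - s))) (at t)"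
  note rev = has_vector_derivative_reverse_iff[of "snd \<phi> \<circ> c", unfolded comp_def]
  have "v' = - v \<or> v' = v"
  proof (cases "\<exists>w. (snd \<phi> \<circ> c has_vector_derivative w) (at (1 - t))")
    case True
    then have "(snd \<phi> \<circ> c has_vector_derivative v) (at (1 - t))"
      unfolding v_def using vector_derivative_at by blast
    then have "(snd \<phi> \<circ> (\<lambda>s. c (1 - s)) has_vector_derivative - v) (at t)"
      using rev[of "- v" t] by (simp add: comp_def)
    then show ?thesis unfolding v'_def using vector_derivative_at by blast
  next
    case False
    then have "\<not> (snd \<phi> \<circ> (\<lambda>s. c (1 - s)) has_vector_derivative w) (at t)" for w
      using rev[of w t] by (simp add: comp_def)
    then show ?thesis using False unfolding v_def v'_def vector_derivative_def by simp
  qed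
  moreover have "g \<phi> (c (1 - t)) (- v) (- v) = g \<phi> (c (1 - t)) v v"
    using bilinear_lneg bilinear_rneg riemannian_metricD(1)[OF g \<phi>]
    by (metis minus_minus)
  ultimately have "g \<phi> (c (1 - t)) v' v' = g \<phi> (c (1 - t)) v v" by auto
  then show ?thesis by (simp add: speed_def Let_def \<phi>_def[symmetric] v_def v'_def)
qed

lemma curve_length_reverse:
  assumes "smooth_atlas A" "riemannian_metric A g"
  shows "curve_length A g (\<lambda>s. c (1 - s)) = curve_length A g c"
proof -
  let ?f = "speed A g c"
  have "integral {0..1} (\<lambda>t. ?f (1 - t)) = integral {-1..0} (?f \<circ> (+) 1)"
  proof -
    have "integral {- 0..- (- 1)} (\<lambda>t. (?f \<circ> (+) 1) (- t)) = integral {-1..0} (?f \<circ> (+) 1)"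
      by (rule Henstock_Kurzweil_Integration.integral_reflect_real)
    then show ?thesis by (simp add: comp_def del: integral_reflect_real)
  qed
  also have "\<dots> = integral {0..1} ?f"
    using integral_shift_Icc_real[of "-1" 0 ?f 1] by simp
  also have "(\<lambda>t. ?f (1 - t)) = speed A g (\<lambda>s. c (1 - s))"
    by (rule ext) (rule speed_reverse[OF assms, symmetric])
  finally show ?thesis by (simp add: curve_length_def)
qed

section \<open>Piecewise smooth curves under reparametrization and joining\<close>

lemma iterated_derivs_affine:
  assumes "iterated_derivs I f D" and I: "\<And>t. t \<in> J \<Longrightarrow> m * t + k \<in> I"
  shows "iterated_derivs J (\<lambda>t. f (m * t + k)) (\<lambda>n t. m ^ n *\<^sub>R D n (m * t + k))"
  unfolding iterated_derivs_def
proof (intro conjI ballI allI)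
  fix t assume t: "t \<in> J"
  show "m ^ 0 *\<^sub>R D 0 (m * t + k) = f (m * t + k)"
    using assms(1) I[OF t] by (simp add: iterated_derivs_def)
  fix n
  have r: "((\<lambda>t. m * t + k) has_derivative (\<lambda>s. m * s)) (at t within J)"
    by (auto intro!: derivative_eq_intros)
  have "(D n has_vector_derivative D (Suc n) (m * t + k)) (at (m * t + k) within I)"
    using assms(1) I[OF t] by (simp add: iterated_derivs_def)
  then have "(D n has_vector_derivative D (Suc n) (m * t + k))
      (at (m * t + k) within (\<lambda>t. m * t + k) ` J)"
    by (rule has_vector_derivative_within_subset) (use I in auto)
  from has_derivative_in_compose[OF r this[unfolded has_vector_derivative_def]]
  have "((\<lambda>t. D n (m * t + k)) has_vector_derivative m *\<^sub>R D (Suc n) (m * t + k)) (at t within J)"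
    by (simp add: has_vector_derivative_def mult.commute)
  from has_derivative_scaleR_right[OF this[unfolded has_vector_derivative_def], of "m ^ n"]
  show "((\<lambda>t. m ^ n *\<^sub>R D n (m * t + k)) has_vector_derivative m ^ Suc n *\<^sub>R D (Suc n) (m * t + k))
       (at t within J)"
    by (simp add: has_vector_derivative_def ac_simps)
qed

lemma iterated_derivs_cong:
  assumes "iterated_derivs I f D" "\<And>t. t \<in> I \<Longrightarrow> f t = h t"
  shows "iterated_derivs I h D"
  using assms by (simp add: iterated_derivs_def)

text \<open>Made for the two halves of a joined path, where \<open>m = 2\<close> and
  \<open>k\<close> is 0 or -1.\<close>

lemma smooth_curve_off_affine:
  assumes c: "smooth_curve_off A S c" and \<psi>: "\<psi> \<in> A" and m: "m > 0"
    and ab: "a < b" "0 \<le> m * a + k" "m * b + k \<le> 1"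
    and S: "\<And>t. a < t \<Longrightarrow> t < b \<Longrightarrow> m * t + k \<notin> S"
    and dom: "\<And>t. a \<le> t \<Longrightarrow> t \<le> b \<Longrightarrow> c (m * t + k) \<in> fst \<psi>"
  shows "\<exists>D. iterated_derivs {a..b} (\<lambda>t. snd \<psi> (c (m * t + k))) D"
proof -
  have inv: "\<exists>t. s = m * t + k" for s using m by (intro exI[of _ "(s - k) / m"]) simp
  have "{m * a + k<..<m * b + k} \<inter> S = {}"
  proof -
    have False if "m * a + k < s" "s < m * b + k" "s \<in> S" for s
      using inv[of s] that S m by (metis add_less_cancel_right mult_less_cancel_left_pos)
    then show ?thesis by auto
  qed
  moreover have "c ` {m * a + k..m * b + k} \<subseteq> fst \<psi>"
  proof -
    have "c s \<in> fst \<psi>" if "m * a + k \<le> s" "s \<le> m * b + k" for s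
      using inv[of s] that dom m by (metis add_le_cancel_right mult_le_cancel_left_pos)
    then show ?thesis by auto
  qed
  moreover have "m * a + k < m * b + k" using ab m by simp
  ultimately obtain D where "iterated_derivs {m * a + k..m * b + k} (snd \<psi> \<circ> c) D"
    using c \<psi> ab(2,3) unfolding smooth_curve_off_def by blast
  from iterated_derivs_affine[OF this, of "{a..b}" m k] m
  show ?thesis by (auto simp: comp_def)
qed

lemma piecewise_smooth_curve_reverse:
  assumes "piecewise_smooth_curve A c"
  shows "piecewise_smooth_curve A (\<lambda>t. c (1 - t))"
proof -
  obtain S where S: "finite S" "smooth_curve_off A S c"
    using assms unfolding piecewise_smooth_curve_def by blast
  have "smooth_curve_off A ((\<lambda>t. 1 - t) ` S) (\<lambda>t. c (1 - t))"
    unfolding smooth_curve_off_def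
  proof (intro conjI ballI allI impI)
    have c: "continuous_on {0..1} c" using S unfolding smooth_curve_off_def by blast
    show "continuous_on {0..1} (\<lambda>t. c (1 - t))"
      by (intro continuous_on_compose2[OF c] continuous_intros) auto
    fix \<psi> a b
    assume \<psi>: "\<psi> \<in> A" and ab: "0 \<le> a \<and> a < b \<and> b \<le> 1 \<and> {a<..<b} \<inter> (\<lambda>t. 1 - t) ` S = {} \<and>
         (\<lambda>t. c (1 - t)) ` {a..b} \<subseteq> fst \<psi>"
    have "{1 - b<..<1 - a} \<inter> S = {}"
    proof -
      have False if "1 - b < s" "s < 1 - a" "s \<in> S" for s
      proof -
        have "1 - s \<in> {a<..<b} \<inter> (\<lambda>t. 1 - t) ` S" using that by auto
        then show False using ab by blast
      qed
      then show ?thesis by auto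
    qed
    moreover have "c ` {1 - b..1 - a} \<subseteq> fst \<psi>"
    proof -
      have "c s \<in> fst \<psi>" if "1 - b \<le> s" "s \<le> 1 - a" for s
      proof -
        have "c (1 - (1 - s)) \<in> (\<lambda>t. c (1 - t)) ` {a..b}"
          by (rule imageI) (use that in auto)
        then show ?thesis using ab by auto
      qed
      then show ?thesis by auto
    qed
    ultimately obtain D where "iterated_derivs {1 - b..1 - a} (snd \<psi> \<circ> c) D"
      using S(2) \<psi> ab unfolding smooth_curve_off_def
      by (metis diff_ge_0_iff_ge diff_le_eq diff_strict_left_mono le_add_same_cancel1)
    from iterated_derivs_affine[OF this, of "{a..b}" "-1" 1]
    show "\<exists>D. iterated_derivs {a..b} (snd \<psi> \<circ> (\<lambda>t. c (1 - t))) D"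
      by (auto simp: comp_def)
  qed
  then show ?thesis using S(1) unfolding piecewise_smooth_curve_def by blast
qed

lemma piecewise_smooth_curve_join:
  assumes "piecewise_smooth_curve A c" "piecewise_smooth_curve A c'" "c 1 = c' 0"
  shows "piecewise_smooth_curve A (c +++ c')"
proof -
  obtain S where S: "finite S" "smooth_curve_off A S c"
    using assms unfolding piecewise_smooth_curve_def by blast
  obtain S' where S': "finite S'" "smooth_curve_off A S' c'"
    using assms unfolding piecewise_smooth_curve_def by blast
  \<comment> \<open>The junction together with the break points of both halves, rescaled to the
    joined parameter.\<close>
  define T where "T = {1/2} \<union> (\<lambda>s. s / 2) ` S \<union> (\<lambda>s. (s + 1) / 2) ` S'"
  have "smooth_curve_off A T (c +++ c')"
    unfolding smooth_curve_off_def
  proof (intro conjI ballI allI impI)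
    show "continuous_on {0..1} (c +++ c')"
      using S S' assms(3) unfolding smooth_curve_off_def
      by (intro continuous_on_joinpaths) (auto simp: pathfinish_def pathstart_def)
    fix \<psi> a b
    assume \<psi>: "\<psi> \<in> A" and ab: "0 \<le> a \<and> a < b \<and> b \<le> 1 \<and> {a<..<b} \<inter> T = {} \<and>
         (c +++ c') ` {a..b} \<subseteq> fst \<psi>"
    have nT: "t \<notin> T" if "a < t" "t < b" for t using ab that by auto
    have dom: "(c +++ c') t \<in> fst \<psi>" if "a \<le> t" "t \<le> b" for t using ab that by auto
    \<comment> \<open>As the junction is a break point, an admissible interval lies within one
      half.\<close>
    have "b \<le> 1/2 \<or> 1/2 \<le> a" using nT[of "1/2"] by (force simp: T_def)
    then show "\<exists>D. iterated_derivs {a..b} (snd \<psi> \<circ> (c +++ c')) D"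
    proof
      assume b: "b \<le> 1/2"
      have eq: "(c +++ c') t = c (2 * t + 0)" if "t \<le> b" for t
        using that b by (simp add: joinpaths_def)
      have "\<exists>D. iterated_derivs {a..b} (\<lambda>t. snd \<psi> (c (2 * t + 0))) D"
      proof (rule smooth_curve_off_affine[OF S(2) \<psi>])
        show "2 * t + 0 \<notin> S" if "a < t" "t < b" for t
        proof
          assume "2 * t + 0 \<in> S"
          then have "(2 * t + 0) / 2 \<in> T" unfolding T_def by blast
          then show False using nT[OF that] by simp
        qed
        show "c (2 * t + 0) \<in> fst \<psi>" if "a \<le> t" "t \<le> b" for t
          using dom[OF that] eq[OF that(2)] by metis
      qed (use ab b in auto)
      then obtain D where D: "iterated_derivs {a..b} (\<lambda>t. snd \<psi> (c (2 * t + 0))) D" ..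
      have "iterated_derivs {a..b} (snd \<psi> \<circ> (c +++ c')) D"
        by (rule iterated_derivs_cong[OF D]) (simp add: eq[simplified])
      then show ?thesis by blast
    next
      assume a: "1/2 \<le> a"
      \<comment> \<open>At the junction itself \<open>joinpaths\<close> takes the first path, so
        there the equation is \<open>c 1 = c' 0\<close>.\<close>
      have eq: "(c +++ c') t = c' (2 * t + (-1))" if "a \<le> t" for t
      proof (cases "t = 1/2")
        case True
        show ?thesis unfolding True using assms(3) by (simp add: joinpaths_def)
      next
        case False
        then show ?thesis using that a by (simp add: joinpaths_def)
      qed
      have "\<exists>D. iterated_derivs {a..b} (\<lambda>t. snd \<psi> (c' (2 * t + (-1)))) D"
      proof (rule smooth_curve_off_affine[OF S'(2) \<psi>])
        show "2 * t + (-1) \<notin> S'" if "a < t" "t < b" for t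
        proof
          assume "2 * t + (-1) \<in> S'"
          then have "((2 * t + (-1)) + 1) / 2 \<in> T" unfolding T_def by blast
          then show False using nT[OF that] by simp
        qed
        show "c' (2 * t + (-1)) \<in> fst \<psi>" if "a \<le> t" "t \<le> b" for t
          using dom[OF that] eq[OF that(1)] by metis
      qed (use ab a in auto)
      then obtain D where D: "iterated_derivs {a..b} (\<lambda>t. snd \<psi> (c' (2 * t + (-1)))) D" ..
      have "iterated_derivs {a..b} (snd \<psi> \<circ> (c +++ c')) D"
        by (rule iterated_derivs_cong[OF D]) (simp add: eq[simplified])
      then show ?thesis by blast
    qed
  qed
  moreover have "finite T" using S S' by (simp add: T_def)
  ultimately show ?thesis unfolding piecewise_smooth_curve_def by blast
qed

text \<open>Along a line with direction \<open>v\<close> these are the successive derivatives of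
  \<open>f\<close> with respect to the parameter. They provide the witness that
  \<open>iterated_derivs\<close> demands.\<close>

primrec iterated_directional_derivative ::
  "'a::real_normed_vector \<Rightarrow> ('a \<Rightarrow> 'b::real_normed_vector) \<Rightarrow> nat \<Rightarrow> 'a \<Rightarrow> 'b" where
  "iterated_directional_derivative v f 0 = f"
| "iterated_directional_derivative v f (Suc k) =
     (\<lambda>x. frechet_derivative (iterated_directional_derivative v f k) (at x) v)"

lemma smooth_on_iterated_directional_derivative:
  assumes "smooth_on S f"
  shows "smooth_on S (iterated_directional_derivative v f k)"
proof (induction k)
  case (Suc k)
  have "Ck_on (Suc j) S (iterated_directional_derivative v f k)" for j
    using Suc unfolding smooth_on_def by blast
  then show ?case unfolding smooth_on_def by simp
qed (use assms in simp)

lemma smooth_on_iterated_derivs_line: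
  assumes f: "smooth_on S f" and S: "\<And>t. t \<in> I \<Longrightarrow> u + t *\<^sub>R v \<in> S"
  shows "iterated_derivs I (\<lambda>t. f (u + t *\<^sub>R v)) (\<lambda>k t. iterated_directional_derivative v f k (u + t *\<^sub>R v))"
  unfolding iterated_derivs_def
proof (intro conjI ballI allI)
  fix k t assume t: "t \<in> I"
  let ?G = "iterated_directional_derivative v f k"
  have "Ck_on (Suc 0) S ?G"
    using smooth_on_iterated_directional_derivative[OF f] unfolding smooth_on_def by blast
  then have "?G differentiable (at (u + t *\<^sub>R v))" using S[OF t] by simp
  then have G: "(?G has_derivative frechet_derivative ?G (at (u + t *\<^sub>R v))) (at (u + t *\<^sub>R v))"
    using frechet_derivative_works by blast
  have l: "((\<lambda>t. u + t *\<^sub>R v) has_derivative (\<lambda>s. s *\<^sub>R v)) (at t within I)"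
    by (auto intro!: derivative_eq_intros)
  have "((\<lambda>t. ?G (u + t *\<^sub>R v)) has_derivative
      (\<lambda>s. frechet_derivative ?G (at (u + t *\<^sub>R v)) (s *\<^sub>R v))) (at t within I)"
    by (rule has_derivative_compose[OF l G])
  then show "((\<lambda>t. ?G (u + t *\<^sub>R v)) has_vector_derivative
      iterated_directional_derivative v f (Suc k) (u + t *\<^sub>R v)) (at t within I)"
    using linear_scale[OF has_derivative_linear[OF G]] by (simp add: has_vector_derivative_def)
qed simp

section \<open>Straight segments in charts as short curves\<close>

definition chart_segment :: "('m, 'e::real_vector) chart \<Rightarrow> 'e \<Rightarrow> 'e \<Rightarrow> real \<Rightarrow> 'm" where
  "chart_segment c u v t = chart_inv c (u + t *\<^sub>R v)"

lemma chart_segment_properties: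
  assumes c: "is_chart c" "u + t *\<^sub>R v \<in> snd c ` fst c"
  shows "isCont (chart_segment c u v) t"
    and "(snd c \<circ> chart_segment c u v has_vector_derivative v) (at t)"
    and "chart_segment c u v t \<in> fst c"
proof -
  note inv = has_derivative_chart_inv[OF c]
  have "((\<lambda>t. u + t *\<^sub>R v) has_derivative (\<lambda>s. s *\<^sub>R v)) (at t)"
    by (auto intro!: derivative_eq_intros)
  from diff_chain_at[OF this inv(2)]
  show "(snd c \<circ> chart_segment c u v has_vector_derivative v) (at t)"
    by (simp add: has_vector_derivative_def comp_def chart_segment_def)
  show "isCont (chart_segment c u v) t"
    unfolding chart_segment_def 
    by (rule isCont_o2[where f = "\<lambda>t. u + t *\<^sub>R v", OF _ inv(1)]) (intro continuous_intros)
  show "chart_segment c u v t \<in> fst c"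
    unfolding chart_segment_def by (rule chart_invD(3)[OF c])
qed

text \<open>Seen from another chart, the segment is a smooth transition map restricted to a line, so
  no break points arise.\<close>

lemma piecewise_smooth_chart_segment:
  assumes A: "smooth_atlas A" "c \<in> A"
    and uv: "\<And>t. t \<in> {0..1} \<Longrightarrow> u + t *\<^sub>R v \<in> snd c ` fst c"
  shows "piecewise_smooth_curve A (chart_segment c u v)"
proof -
  have ch: "is_chart c" using A smooth_atlasD by blast
  have "smooth_curve_off A {} (chart_segment c u v)"
    unfolding smooth_curve_off_def
  proof (intro conjI ballI allI impI)
    show "continuous_on {0..1} (chart_segment c u v)"
      using chart_segment_properties(1)[OF ch uv] continuous_at_imp_continuous_on by blast
    fix \<psi> a b assume \<psi>: "\<psi> \<in> A"
      and ab: "0 \<le> a \<and> a < b \<and> b \<le> 1 \<and> {a<..<b} \<inter> {} = {} \<and> chart_segment c u v ` {a..b} \<subseteq> fst \<psi>"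
    have "u + t *\<^sub>R v \<in> snd c ` (fst c \<inter> fst \<psi>)" if t: "t \<in> {a..b}" for t
    proof -
      have t01: "t \<in> {0..1}" using t ab by auto
      have "chart_segment c u v t \<in> fst c \<inter> fst \<psi>"
        using chart_segment_properties(3)[OF ch uv[OF t01]] ab t by auto
      moreover have "snd c (chart_segment c u v t) = u + t *\<^sub>R v"
        unfolding chart_segment_def by (rule chart_invD(2)[OF ch uv[OF t01]])
      ultimately show ?thesis by (metis imageI)
    qed
    from smooth_on_iterated_derivs_line[where I = "{a..b}", OF smooth_atlasD(3)[OF A \<psi>] this]
    show "\<exists>D. iterated_derivs {a..b} (snd \<psi> \<circ> chart_segment c u v) D"
      by (auto simp: transition_def chart_segment_def comp_def)
  qed
  then show ?thesis unfolding piecewise_smooth_curve_def by blast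
qed

lemma curve_length_chart_segment_le:
  assumes A: "smooth_atlas A" and g: "riemannian_metric A g" and c: "c \<in> A"
    and uv: "\<And>t. t \<in> {0..1} \<Longrightarrow> u + t *\<^sub>R v \<in> snd c ` fst c"
    and B: "\<And>t. t \<in> {0..1} \<Longrightarrow> sqrt (g c (chart_segment c u v t) v v) \<le> B"
  shows "curve_length A g (chart_segment c u v) \<le> B"
proof -
  have ch: "is_chart c" using A c smooth_atlasD by blast
  have sp: "speed A g (chart_segment c u v) t \<le> B" if "t \<in> {0..1}" for t
    using speed_eq[OF A g c] chart_segment_properties[OF ch uv[OF that]] B[OF that] by simp
  show ?thesis
  proof (cases "speed A g (chart_segment c u v) integrable_on {0..1}")
    case True
    then have "curve_length A g (chart_segment c u v) \<le> integral {0..1} (\<lambda>t::real. B)"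
      unfolding curve_length_def by (rule integral_le) (use sp in auto)
    then show ?thesis by simp
  next
    \<comment> \<open>The length is then the default value 0, and \<open>B\<close> is at least a
      nonnegative speed.\<close>
    case False
    have "0 \<le> speed A g (chart_segment c u v) 0" by (rule speed_nonneg[OF A g])
    then show ?thesis using False sp[of 0] by (simp add: curve_length_def not_integrable_integral)
  qed
qed

text \<open>A crude bound, chosen because its coefficient is a finite sum of metric coefficients: it
  depends continuously on the base point and is therefore bounded on a compact ball.\<close>

lemma bilinear_le_sum_Basis:
  fixes h :: "'e::euclidean_space \<Rightarrow> 'e \<Rightarrow> real"
  assumes "bilinear h"
  shows "h v v \<le> (\<Sum>i\<in>Basis. \<Sum>j\<in>Basis. \<bar>h i j\<bar>) * (norm v)\<^sup>2"
proof -
  have "h v v = h (\<Sum>i\<in>Basis. (v \<bullet> i) *\<^sub>R i) (\<Sum>j\<in>Basis. (v \<bullet> j) *\<^sub>R j)"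
    by (simp add: euclidean_representation)
  also have "\<dots> = (\<Sum>i\<in>Basis. \<Sum>j\<in>Basis. (v \<bullet> i) * (v \<bullet> j) * h i j)"
    using bilinear_sum[OF assms, of "\<lambda>i. (v \<bullet> i) *\<^sub>R i" Basis "\<lambda>j. (v \<bullet> j) *\<^sub>R j" Basis]
    by (simp add: sum.cartesian_product bilinear_lmul[OF assms] bilinear_rmul[OF assms] ac_simps)
  also have "\<dots> \<le> (\<Sum>i\<in>Basis. \<Sum>j\<in>Basis. (norm v)\<^sup>2 * \<bar>h i j\<bar>)"
  proof (intro sum_mono)
    fix i j :: 'e assume ij: "i \<in> Basis" "j \<in> Basis"
    have "(v \<bullet> i) * (v \<bullet> j) * h i j \<le> \<bar>v \<bullet> i\<bar> * \<bar>v \<bullet> j\<bar> * \<bar>h i j\<bar>"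
      by (metis abs_ge_self abs_mult)
    also have "\<dots> \<le> (norm v * norm v) * \<bar>h i j\<bar>"
      using Basis_le_norm[OF ij(1), of v] Basis_le_norm[OF ij(2), of v]
      by (intro mult_right_mono mult_mono) auto
    finally show "(v \<bullet> i) * (v \<bullet> j) * h i j \<le> (norm v)\<^sup>2 * \<bar>h i j\<bar>" by (simp add: power2_eq_square)
  qed
  also have "\<dots> = (\<Sum>i\<in>Basis. \<Sum>j\<in>Basis. \<bar>h i j\<bar>) * (norm v)\<^sup>2"
    by (simp add: sum_distrib_left sum_distrib_right mult.commute)
  finally show ?thesis .
qed

text \<open>In a compact coordinate ball the metric is bounded by a multiple \<open>B\<close> of the
  Euclidean one, so a segment of coordinate length \<open>l\<close> has length at most
  \<open>sqrt B * l\<close>. The last clause records the constant curve, needed for distance zero on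
  the diagonal.\<close>

lemma short_curves_nearby:
  fixes A :: "('m::topological_space, 'e::euclidean_space) chart set"
  assumes A: "smooth_atlas A" and g: "riemannian_metric A g" and e: "e > 0"
  shows "\<exists>U. open U \<and> p \<in> U \<and> (\<forall>q\<in>U. \<exists>c. piecewise_smooth_curve A c \<and> c 0 = p \<and> c 1 = q \<and>
     curve_length A g c < e \<and> (q = p \<longrightarrow> curve_length A g c = 0))"
proof -
  obtain c where c: "c \<in> A" "p \<in> fst c" using smooth_atlasD(2)[OF A] by blast
  have ch: "is_chart c" using A c smooth_atlasD by blast
  define u where "u = snd c p"
  have "u \<in> snd c ` fst c" using c u_def by blast
  then obtain r where r: "r > 0" "cball u r \<subseteq> snd c ` fst c"
    using chart_invD(7)[OF ch] open_contains_cball by blast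
  let ?s = "\<lambda>q. \<Sum>i\<in>Basis. \<Sum>j\<in>Basis. \<bar>g c (chart_inv c q) i j\<bar>"
  have "continuous_on (cball u r) (\<lambda>q. g c (chart_inv c q) i j)" for i j
  proof (rule continuous_on_subset[OF _ r(2)])
    have "Ck_on 0 (snd c ` fst c) (\<lambda>q. g c (chart_inv c q) i j)"
      using riemannian_metricD(3)[OF g c(1)] unfolding smooth_on_def by blast
    then show "continuous_on (snd c ` fst c) (\<lambda>q. g c (chart_inv c q) i j)" by simp
  qed
  then have "continuous_on (cball u r) ?s" by (intro continuous_intros)
  then have "bounded (?s ` cball u r)" by (intro compact_imp_bounded compact_continuous_image compact_cball)
  then obtain B0 where B0: "\<And>q. q \<in> cball u r \<Longrightarrow> ?s q \<le> B0"
    unfolding bounded_iff by (metis abs_le_D1 imageI real_norm_def)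
  define B where "B = max 0 B0"
  have B: "B \<ge> 0" "\<And>q. q \<in> cball u r \<Longrightarrow> ?s q \<le> B" using B0 by (auto simp: B_def intro: le_max_iff_disj[THEN iffD2])
  \<comment> \<open>Small enough that \<open>sqrt B * \<delta> < e\<close>; the summand 1 keeps the
    denominator positive when \<open>B = 0\<close>.\<close>
  define \<delta> where "\<delta> = min r (e / (sqrt B + 1))"
  have s1: "sqrt B + 1 > 0" using B(1) real_sqrt_ge_zero by (simp add: add_nonneg_pos)
  have \<delta>: "\<delta> > 0" "\<delta> \<le> r" "\<delta> \<le> e / (sqrt B + 1)" using e r s1 by (auto simp: \<delta>_def)
  define U where "U = fst c \<inter> snd c -` ball u \<delta>"
  have "open U" unfolding U_def
    using continuous_open_preimage[OF chart_invD(4)[OF ch] chart_invD(6)[OF ch] open_ball] .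
  moreover have "p \<in> U" using c \<delta>(1) by (simp add: U_def u_def)
  moreover have "\<exists>c. piecewise_smooth_curve A c \<and> c 0 = p \<and> c 1 = q \<and>
     curve_length A g c < e \<and> (q = p \<longrightarrow> curve_length A g c = 0)" if q: "q \<in> U" for q
  proof -
    define v where "v = snd c q - u"
    have nv: "norm v < \<delta>" using q by (simp add: U_def v_def dist_norm norm_minus_commute)
    have cb: "u + t *\<^sub>R v \<in> cball u r" if "t \<in> {0..1}" for t
    proof -
      have "norm (t *\<^sub>R v) \<le> norm v" using that by (simp add: mult_left_le_one_le)
      then show ?thesis using nv \<delta>(2) by (simp add: dist_norm)
    qed
    then have uv: "u + t *\<^sub>R v \<in> snd c ` fst c" if "t \<in> {0..1}" for t using r(2) that by blast
    let ?c = "chart_segment c u v"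
    have len: "curve_length A g ?c \<le> sqrt B * norm v"
    proof (rule curve_length_chart_segment_le[OF A g c(1) uv])
      fix t :: real assume t: "t \<in> {0..1}"
      have "g c (?c t) v v \<le> ?s (u + t *\<^sub>R v) * (norm v)\<^sup>2"
        unfolding chart_segment_def
        by (intro bilinear_le_sum_Basis riemannian_metricD(1)[OF g c(1)] chart_invD(3)[OF ch] uv t)
      also have "\<dots> \<le> B * (norm v)\<^sup>2" using B(2)[OF cb[OF t]] by (intro mult_right_mono) auto
      finally have "sqrt (g c (?c t) v v) \<le> sqrt (B * (norm v)\<^sup>2)" by simp
      then show "sqrt (g c (?c t) v v) \<le> sqrt B * norm v" by (simp add: real_sqrt_mult)
    qed
    have "sqrt B * norm v \<le> sqrt B * \<delta>" using nv B(1) by (intro mult_left_mono) auto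
    also have "\<dots> < (sqrt B + 1) * \<delta>" using \<delta>(1) by simp
    also have "\<dots> \<le> e" using \<delta>(3) s1 by (simp add: field_simps)
    finally have "curve_length A g ?c < e" using len by linarith
    moreover have "piecewise_smooth_curve A ?c" by (rule piecewise_smooth_chart_segment[OF A c(1) uv])
    moreover have "?c 0 = p" "?c 1 = q"
      using c q chart_invD(1)[OF ch] by (auto simp: chart_segment_def u_def v_def U_def)
    moreover have "curve_length A g ?c = 0" if "q = p"
      using len that curve_length_nonneg[OF A g, of ?c] by (simp add: v_def u_def)
    ultimately show ?thesis by blast
  qed
  ultimately show ?thesis by blast
qed

text \<open>Being joined by a curve is an equivalence relation with open classes. The result makes
  the set under \<open>Inf\<close> in \<open>riemannian_dist\<close> nonempty.\<close>

lemma piecewise_smooth_curve_exists: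
  fixes A :: "('m::topological_space, 'e::euclidean_space) chart set"
  assumes A: "smooth_atlas A" and g: "riemannian_metric A g" and "connected (UNIV :: 'm set)"
  shows "\<exists>c. piecewise_smooth_curve A c \<and> c 0 = x \<and> c 1 = y"
proof (rule connected_equivalence_relation[OF assms(3),
      where R = "\<lambda>x y. \<exists>c. piecewise_smooth_curve A c \<and> c 0 = x \<and> c 1 = y"])
  fix x y assume "\<exists>c. piecewise_smooth_curve A c \<and> c 0 = x \<and> c 1 = y"
  then obtain c where c: "piecewise_smooth_curve A c" "c 0 = x" "c 1 = y" by blast
  show "\<exists>c. piecewise_smooth_curve A c \<and> c 0 = y \<and> c 1 = x"
    by (rule exI[of _ "\<lambda>t. c (1 - t)"]) (use c piecewise_smooth_curve_reverse in auto)
next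
  fix x y z assume "\<exists>c. piecewise_smooth_curve A c \<and> c 0 = x \<and> c 1 = y"
    "\<exists>c. piecewise_smooth_curve A c \<and> c 0 = y \<and> c 1 = z"
  then obtain c c' where c: "piecewise_smooth_curve A c" "c 0 = x" "c 1 = y"
    "piecewise_smooth_curve A c'" "c' 0 = y" "c' 1 = z" by blast
  show "\<exists>c. piecewise_smooth_curve A c \<and> c 0 = x \<and> c 1 = z"
    by (rule exI[of _ "c +++ c'"])
      (use c piecewise_smooth_curve_join[OF c(1,4)] in \<open>auto simp: joinpaths_def\<close>)
next
  fix a :: 'm
  show "\<exists>T. openin (top_of_set UNIV) T \<and> a \<in> T \<and>
      (\<forall>x\<in>T. \<exists>c. piecewise_smooth_curve A c \<and> c 0 = a \<and> c 1 = x)"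
    using short_curves_nearby[OF A g zero_less_one, of a] unfolding subtopology_UNIV openin_open_eq[OF open_UNIV]
    by (metis open_openin)
qed auto

lemma riemannian_dist_properties:
  fixes A :: "('m::topological_space, 'e::euclidean_space) chart set"
  assumes A: "smooth_atlas A" and g: "riemannian_metric A g" and conn: "connected (UNIV :: 'm set)"
  shows riemannian_dist_nonneg: "0 \<le> riemannian_dist A g x y"
    and riemannian_dist_commute: "riemannian_dist A g x y = riemannian_dist A g y x"
    and riemannian_dist_refl: "riemannian_dist A g x x = 0"
    and riemannian_dist_nearby: "e > 0 \<Longrightarrow> \<exists>U. open U \<and> x \<in> U \<and> (\<forall>y\<in>U. riemannian_dist A g x y < e)"
proof -
  define E where "E x y = {curve_length A g c | c. piecewise_smooth_curve A c \<and> c 0 = x \<and> c 1 = y}" for x y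
  have dE: "riemannian_dist A g x y = Inf (E x y)" for x y by (simp add: riemannian_dist_def E_def)
  have ne: "E x y \<noteq> {}" for x y
    using piecewise_smooth_curve_exists[OF A g conn, of x y] unfolding E_def by blast
  have pos: "0 \<le> l" if "l \<in> E x y" for l x y
    using that curve_length_nonneg[OF A g] unfolding E_def by blast
  then have bdd: "bdd_below (E x y)" for x y by (meson bdd_belowI)
  show ge: "0 \<le> riemannian_dist A g x y" for x y
    unfolding dE by (rule cInf_greatest[OF ne pos])
  have "E x y \<subseteq> E y x" for x y
  proof
    fix l assume "l \<in> E x y"
    then obtain c where c: "l = curve_length A g c" "piecewise_smooth_curve A c" "c 0 = x" "c 1 = y"
      unfolding E_def by blast
    have "l = curve_length A g (\<lambda>t. c (1 - t))" by (simp add: c curve_length_reverse[OF A g])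
    moreover have "piecewise_smooth_curve A (\<lambda>t. c (1 - t))"
      by (rule piecewise_smooth_curve_reverse[OF c(2)])
    ultimately show "l \<in> E y x" unfolding E_def using c by fastforce
  qed
  then show "riemannian_dist A g x y = riemannian_dist A g y x" unfolding dE by (metis subset_antisym)
  have le: "riemannian_dist A g x y \<le> l" if "l \<in> E x y" for x y l
    unfolding dE by (rule cInf_lower[OF that bdd])
  have "0 \<in> E x x" using short_curves_nearby[OF A g zero_less_one, of x] unfolding E_def by force
  then show "riemannian_dist A g x x = 0" using le ge by (metis order_antisym)
  show "\<exists>U. open U \<and> x \<in> U \<and> (\<forall>y\<in>U. riemannian_dist A g x y < e)" if e: "e > 0"
  proof -
    obtain U where U: "open U" "x \<in> U"
      "\<And>q. q \<in> U \<Longrightarrow> \<exists>c. piecewise_smooth_curve A c \<and> c 0 = x \<and> c 1 = q \<and> curve_length A g c < e"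
      using short_curves_nearby[OF A g e, of x] by blast
    have "riemannian_dist A g x y < e" if "y \<in> U" for y
    proof -
      obtain c where "piecewise_smooth_curve A c" "c 0 = x" "c 1 = y" "curve_length A g c < e"
        using U(3)[OF \<open>y \<in> U\<close>] by blast
      then show ?thesis using le[of "curve_length A g c" x y] unfolding E_def by fastforce
    qed
    then show ?thesis using U by blast
  qed
qed

section \<open>Spiralling leaves in the tube\<close>

lemma turbulization_profileD:
  assumes "turbulization_profile lam"
  shows "continuous_on {0..1} lam"
    and "\<And>r. 0 \<le> r \<Longrightarrow> r < 2/3 \<Longrightarrow> sin (lam r) < 0"
    and "\<And>r. 2/3 < r \<Longrightarrow> r \<le> 1 \<Longrightarrow> 0 < sin (lam r)"
    and "\<exists>L>0. \<exists>\<delta>>0. \<forall>r. 0 \<le> r \<longrightarrow> r \<le> 1 \<longrightarrow> \<bar>r - 2/3\<bar> < \<delta> \<longrightarrow> \<bar>lam r\<bar> \<le> L * \<bar>r - 2/3\<bar>"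
proof -
  note prof = assms[unfolded turbulization_profile_def]
  have range: "- pi / 2 \<le> lam r" "lam r \<le> pi / 2" if "0 \<le> r" "r \<le> 1" for r
    using prof that by (auto simp: image_subset_iff)
  have mono: "lam r < lam s" if "0 \<le> r" "r < s" "s \<le> 3/4" for r s
    using prof that by (intro strict_mono_onD[of "{0..3/4}" lam r s]) auto
  have l23: "lam (2/3) = 0" using prof by blast
  obtain D where D: "iterated_derivs {0..1} lam D" using prof by blast
  have der: "(lam has_vector_derivative D 1 r) (at r within {0..1})" if "r \<in> {0..1}" for r
  proof (rule has_vector_derivative_transform[OF that])
    show "(D 0 has_vector_derivative D 1 r) (at r within {0..1})"
      using D that unfolding iterated_derivs_def One_nat_def by blast
    show "\<And>x. x \<in> {0..1} \<Longrightarrow> lam x = D 0 x"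
      using D unfolding iterated_derivs_def by simp
  qed
  show "continuous_on {0..1} lam"
    using der has_vector_derivative_continuous continuous_on_eq_continuous_within by blast
  show "sin (lam r) < 0" if "0 \<le> r" "r < 2/3" for r
  proof -
    have "lam r < 0" using mono[of r "2/3"] that l23 by simp
    moreover have "- lam r \<le> pi / 2" using range(1)[of r] that by simp
    ultimately have "0 < sin (- lam r)" using pi_gt_zero by (intro sin_gt_zero) linarith+
    then show ?thesis by simp
  qed
  show "0 < sin (lam r)" if "2/3 < r" "r \<le> 1" for r
  proof -
    have "0 < lam r"
    proof (cases "r \<le> 3/4")
      case True
      then show ?thesis using mono[of "2/3" r] that l23 by simp
    next
      case False
      then have "lam r = pi / 2" using prof that by auto
      then show ?thesis using pi_gt_zero by linarith
    qed
    moreover have "lam r \<le> pi / 2" using range(2)[of r] that by simp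
    ultimately show ?thesis using pi_gt_zero by (intro sin_gt_zero) linarith+
  qed
  \<comment> \<open>The summand 1 absorbs the error term of the derivative at \<open>2/3\<close>,
    taken with tolerance 1.\<close>
  define L where "L = \<bar>D 1 (2/3)\<bar> + 1"
  have "L > 0" by (simp add: L_def add_nonneg_pos)
  have "(lam has_derivative (\<lambda>x. x *\<^sub>R D 1 (2/3))) (at (2/3) within {0..1})"
    using der[of "2/3"] by (simp add: has_vector_derivative_def)
  then obtain \<delta> where \<delta>: "\<delta> > 0"
    "\<And>r. r \<in> {0..1} \<Longrightarrow> norm (r - 2/3) < \<delta> \<Longrightarrow>
       norm (lam r - lam (2/3) - (r - 2/3) *\<^sub>R D 1 (2/3)) \<le> 1 * norm (r - 2/3)"
    unfolding has_derivative_within_alt using zero_less_one by blast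
  have "\<bar>lam r\<bar> \<le> L * \<bar>r - 2/3\<bar>" if "0 \<le> r" "r \<le> 1" "\<bar>r - 2/3\<bar> < \<delta>" for r
  proof -
    have "\<bar>lam r - (r - 2/3) * D 1 (2/3)\<bar> \<le> \<bar>r - 2/3\<bar>" using \<delta>(2)[of r] that l23 by simp
    moreover have "\<bar>(r - 2/3) * D 1 (2/3)\<bar> = \<bar>D 1 (2/3)\<bar> * \<bar>r - 2/3\<bar>" by (simp add: abs_mult)
    moreover have "\<bar>lam r\<bar> \<le> \<bar>lam r - (r - 2/3) * D 1 (2/3)\<bar> + \<bar>(r - 2/3) * D 1 (2/3)\<bar>"
      using abs_triangle_ineq[of "lam r - (r - 2/3) * D 1 (2/3)" "(r - 2/3) * D 1 (2/3)"] by simp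
    ultimately show ?thesis unfolding L_def distrib_right mult_1 by linarith
  qed
  then show "\<exists>L>0. \<exists>\<delta>>0. \<forall>r. 0 \<le> r \<longrightarrow> r \<le> 1 \<longrightarrow> \<bar>r - 2/3\<bar> < \<delta> \<longrightarrow> \<bar>lam r\<bar> \<le> L * \<bar>r - 2/3\<bar>"
    using \<open>L > 0\<close> \<delta>(1) by blast
qed

text \<open>The slope \<open>dt/dr\<close> of the leaves in the half planes of constant angle.\<close>

definition turbulization_slope :: "(real \<Rightarrow> real) \<Rightarrow> real \<Rightarrow> real" where
  "turbulization_slope lam r = - cos (lam r) / sin (lam r)"

text \<open>The slope is not integrable at \<open>r = 2/3\<close>, since the zero of \<open>lam\<close> there is at least of first order.\<close>

lemma turbulization_slope_blowup:
  assumes prof: "turbulization_profile lam"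
  shows "\<exists>C>0. \<exists>\<delta>>0. \<delta> \<le> 1/3 \<and>
    (\<forall>r. 2/3 - \<delta> < r \<longrightarrow> r < 2/3 \<longrightarrow> C / (2/3 - r) \<le> turbulization_slope lam r) \<and>
    (\<forall>r. 2/3 < r \<longrightarrow> r < 2/3 + \<delta> \<longrightarrow> C / (r - 2/3) \<le> - turbulization_slope lam r)"
proof -
  obtain L \<delta> where L: "L > 0" and \<delta>: "\<delta> > 0"
    and lam: "\<And>r. 0 \<le> r \<Longrightarrow> r \<le> 1 \<Longrightarrow> \<bar>r - 2/3\<bar> < \<delta> \<Longrightarrow> \<bar>lam r\<bar> \<le> L * \<bar>r - 2/3\<bar>"
    using turbulization_profileD(4)[OF prof] by blast
  \<comment> \<open>The three bounds keep \<open>r\<close> in the unit interval, make the linear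
    estimate of \<open>lam\<close> available and force \<open>|lam r| \<le> 1\<close>. As
    \<open>1 < pi / 3\<close>, the cosine is then at least 1/2, which explains the constant
    \<open>1 / (2 * L)\<close>.\<close>
  define e where "e = min (1/3) (min \<delta> (1 / L))"
  have e: "e > 0" "e \<le> 1/3" "e \<le> \<delta>" "e \<le> 1 / L" using L \<delta> by (auto simp: e_def)
  have main: "(1 / (2 * L)) / \<bar>r - 2/3\<bar> \<le> cos (lam r) / \<bar>sin (lam r)\<bar>"
    if r: "\<bar>r - 2/3\<bar> < e" "r \<noteq> 2/3" for r
  proof -
    have r01: "0 \<le> r" "r \<le> 1" using r e by linarith+
    have l: "\<bar>lam r\<bar> \<le> L * \<bar>r - 2/3\<bar>" using lam[OF r01] r e by linarith
    also have "\<dots> \<le> L * (1 / L)" using r e L by (intro mult_left_mono) linarith+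
    finally have l1: "\<bar>lam r\<bar> \<le> 1" using L by simp
    have "\<bar>lam r\<bar> \<le> pi / 3" using l1 pi_gt3 by linarith
    then have "cos (pi / 3) \<le> cos \<bar>lam r\<bar>" using pi_gt3 by (intro cos_monotone_0_pi_le) auto
    then have c: "1/2 \<le> cos (lam r)" by (simp add: cos_60)
    have s: "\<bar>sin (lam r)\<bar> \<le> L * \<bar>r - 2/3\<bar>" using l abs_sin_x_le_abs_x[of "lam r"] by linarith
    have s0: "0 < \<bar>sin (lam r)\<bar>"
      using turbulization_profileD(2,3)[OF prof, of r] r r01 by (cases "r < 2/3") auto
    have "(1 / (2 * L)) / \<bar>r - 2/3\<bar> = (1/2) / (L * \<bar>r - 2/3\<bar>)" by simp
    also have "\<dots> \<le> cos (lam r) / \<bar>sin (lam r)\<bar>" using c s s0 by (intro frac_le) auto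
    finally show ?thesis .
  qed
  have 1: "(1 / (2 * L)) / (2/3 - r) \<le> turbulization_slope lam r" if "2/3 - e < r" "r < 2/3" for r
  proof -
    have "sin (lam r) < 0" by (rule turbulization_profileD(2)[OF prof]) (use that e in auto)
    then show ?thesis using main[of r] that by (simp add: turbulization_slope_def)
  qed
  have 2: "(1 / (2 * L)) / (r - 2/3) \<le> - turbulization_slope lam r" if "2/3 < r" "r < 2/3 + e" for r
  proof -
    have "0 < sin (lam r)" by (rule turbulization_profileD(3)[OF prof]) (use that e in auto)
    then show ?thesis using main[of r] that by (simp add: turbulization_slope_def)
  qed
  show ?thesis
    by (rule exI[of _ "1 / (2 * L)"], rule conjI, use L in simp, rule exI[of _ e]) (use e 1 2 in blast)
qed

text \<open>Comparison with \<open>- C * ln (b - s)\<close>, whose derivative is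
  \<open>C / (b - s)\<close>: \<open>T\<close> minus this function is nondecreasing, and the
  function tends to infinity at \<open>b\<close>.\<close>

lemma log_growth_unbounded:
  fixes T T' :: "real \<Rightarrow> real"
  assumes C: "C > 0" and a: "a < b"
    and der: "\<And>s. a < s \<Longrightarrow> s < b \<Longrightarrow> (T has_real_derivative T' s) (at s)"
    and ge: "\<And>s. a < s \<Longrightarrow> s < b \<Longrightarrow> C / (b - s) \<le> T' s"
  shows "\<exists>s. a < s \<and> s < b \<and> M < T s"
proof -
  define s1 where "s1 = (a + b) / 2"
  have s1: "a < s1" "s1 < b" using a by (auto simp: s1_def)
  define K where "K = T s1 + C * ln (b - s1)"
  \<comment> \<open>So close to \<open>b\<close> that \<open>C * ln (b - s)\<close> is at most
    \<open>- (|M - K| + 1)\<close>, which lifts \<open>T s\<close> above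
    \<open>K + |M - K|\<close>.\<close>
  define s where "s = max s1 (b - exp (- (\<bar>M - K\<bar> + 1) / C))"
  have s: "s1 \<le> s" "s < b" using s1 by (auto simp: s_def)
  have "T s1 + C * ln (b - s1) \<le> T s + C * ln (b - s)"
  proof (rule DERIV_nonneg_imp_nondecreasing[OF s(1)])
    fix x assume x: "s1 \<le> x" "x \<le> s"
    have "((\<lambda>s. T s + C * ln (b - s)) has_real_derivative T' x - C / (b - x)) (at x)"
      using x s s1 by (auto intro!: derivative_eq_intros der)
    moreover have "T' x - C / (b - x) \<ge> 0" using ge[of x] x s s1 by simp
    ultimately show "\<exists>y. ((\<lambda>s. T s + C * ln (b - s)) has_real_derivative y) (at x) \<and> 0 \<le> y" by blast
  qed
  then have "K - C * ln (b - s) \<le> T s" by (simp add: K_def)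
  moreover have "C * ln (b - s) \<le> - (\<bar>M - K\<bar> + 1)"
  proof -
    have "b - s \<le> exp (- (\<bar>M - K\<bar> + 1) / C)" by (auto simp: s_def)
    then have "ln (b - s) \<le> - (\<bar>M - K\<bar> + 1) / C" using s ln_le_cancel_iff[of "b - s"] by (metis diff_gt_0_iff_gt exp_gt_zero ln_exp)
    then show ?thesis using C by (simp add: field_simps)
  qed
  ultimately have "M < T s" by linarith
  then show ?thesis using s s1 by (meson less_le_trans)
qed

text \<open>\<open>T\<close> is continuous and unbounded above, so it takes every value beyond some
  point, in particular some \<open>t + N\<close> with \<open>N\<close> an integer. Since
  \<open>a\<close> may be taken arbitrarily close to \<open>b\<close>, every height modulo 1 recurs
  as \<open>s\<close> tends to \<open>b\<close>.\<close>

lemma log_growth_hits_residue_class: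
  fixes T T' :: "real \<Rightarrow> real"
  assumes C: "C > 0" and a: "a < b"
    and der: "\<And>s. a < s \<Longrightarrow> s < b \<Longrightarrow> (T has_real_derivative T' s) (at s)"
    and ge: "\<And>s. a < s \<Longrightarrow> s < b \<Longrightarrow> C / (b - s) \<le> T' s"
  shows "\<exists>s. a < s \<and> s < b \<and> T s - t \<in> \<int>"
proof -
  define s1 where "s1 = (a + b) / 2"
  have s1: "a < s1" "s1 < b" using a by (auto simp: s1_def)
  define N where "N = \<lceil>T s1 - t\<rceil>"
  have N: "T s1 \<le> t + of_int N" unfolding N_def by linarith
  obtain s2 where s2: "s1 < s2" "s2 < b" "t + of_int N < T s2"
    using log_growth_unbounded[OF C s1(2), of T T' "t + of_int N"] der ge s1 by force
  have "\<exists>x\<ge>s1. x \<le> s2 \<and> T x = t + of_int N"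
  proof (rule IVT')
    show "continuous_on {s1..s2} T"
    proof (intro continuous_at_imp_continuous_on ballI)
      fix x assume "x \<in> {s1..s2}"
      then show "isCont T x" using s1 s2 by (intro DERIV_isCont[OF der]) auto
    qed
  qed (use N s2 in auto)
  then obtain s where "s1 \<le> s" "s \<le> s2" "T s = t + of_int N" by blast
  then show ?thesis using s1 s2 by (intro exI[of _ s]) auto
qed

section \<open>Curves in the coordinates of the tube\<close>

lemma foliated_tubular_nbhdD:
  assumes "foliated_tubular_nbhd A F \<gamma> \<Theta>"
  shows "\<And>q. q \<in> cball 0 1 \<times> UNIV \<Longrightarrow> isCont \<Theta> q"
    and "\<And>q c. q \<in> cball 0 1 \<times> UNIV \<Longrightarrow> c \<in> A \<Longrightarrow> \<Theta> q \<in> fst c \<Longrightarrow> (snd c \<circ> \<Theta>) differentiable (at q)"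
    and "\<And>x t t'. x \<in> cball 0 1 \<Longrightarrow> t - t' \<in> \<int> \<Longrightarrow> \<Theta> (x, t) = \<Theta> (x, t')"
    and "leaves_of_restriction F (tube \<Theta>) = {\<Theta> ` (cball 0 1 \<times> {t}) | t. True}"
    and "\<gamma> ` {0..1} = \<Theta> ` ({0} \<times> UNIV)"
proof -
  obtain R where R: "R > 1" and cont: "continuous_on (ball 0 R \<times> UNIV) \<Theta>"
    and smooth: "\<forall>c\<in>A. smooth_on {q \<in> ball 0 R \<times> UNIV. \<Theta> q \<in> fst c} (snd c \<circ> \<Theta>) \<and>
           (\<forall>q\<in>ball 0 R \<times> UNIV. \<Theta> q \<in> fst c \<longrightarrow>
              bij (frechet_derivative (snd c \<circ> \<Theta>) (at q)))"
    and per: "\<forall>x\<in>ball 0 R. \<forall>x'\<in>ball 0 R. \<forall>t t'. \<Theta> (x, t) = \<Theta> (x', t') \<longleftrightarrow> x = x' \<and> t - t' \<in> \<int>"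
    using assms[unfolded foliated_tubular_nbhd_def, THEN conjunct1] by (elim exE conjE) (rule that)
  have sub: "cball 0 1 \<times> UNIV \<subseteq> ball 0 R \<times> UNIV" using R by auto
  have "open (ball 0 R \<times> UNIV)" by (simp add: open_Times)
  then show "isCont \<Theta> q" if "q \<in> cball 0 1 \<times> UNIV" for q
    using cont sub that continuous_on_eq_continuous_at by blast
  show "(snd c \<circ> \<Theta>) differentiable (at q)"
    if "q \<in> cball 0 1 \<times> UNIV" "c \<in> A" "\<Theta> q \<in> fst c" for q c
  proof -
    have "Ck_on (Suc 0) {q \<in> ball 0 R \<times> UNIV. \<Theta> q \<in> fst c} (snd c \<circ> \<Theta>)"
      using smooth that(2) unfolding smooth_on_def by blast
    then show ?thesis using that sub by auto
  qed
  show "\<Theta> (x, t) = \<Theta> (x, t')" if "x \<in> cball 0 1" "t - t' \<in> \<int>" for x t t'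
    using bspec[OF bspec[OF per, of x], of x] that R by simp
  show "leaves_of_restriction F (tube \<Theta>) = {\<Theta> ` (cball 0 1 \<times> {t}) | t. True}"
    "\<gamma> ` {0..1} = \<Theta> ` ({0} \<times> UNIV)"
    using assms[unfolded foliated_tubular_nbhd_def, THEN conjunct2] by simp_all
qed

text \<open>By periodicity in \<open>t\<close> the tube is the image of a compact solid cylinder,
  and the manifold is Hausdorff.\<close>

lemma closed_tube:
  fixes \<Theta> :: "(real^'n::finite) \<times> real \<Rightarrow> 'm::t2_space"
  assumes "foliated_tubular_nbhd A F \<gamma> \<Theta>"
  shows "closed (tube \<Theta>)"
proof -
  note nbhd = foliated_tubular_nbhdD[OF assms]
  have "tube \<Theta> = \<Theta> ` (cball 0 1 \<times> {0..1})"
  proof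
    show "tube \<Theta> \<subseteq> \<Theta> ` (cball 0 1 \<times> {0..1})"
    proof
      fix p assume "p \<in> tube \<Theta>"
      then obtain x t where p: "p = \<Theta> (x, t)" "x \<in> cball 0 1" unfolding tube_def by blast
      have "t - frac t \<in> \<int>" by (simp add: frac_def)
      then have "p = \<Theta> (x, frac t)" using nbhd(3) p by blast
      moreover have "frac t \<in> {0..1}" using frac_ge_0[of t] frac_lt_1[of t] by auto
      ultimately show "p \<in> \<Theta> ` (cball 0 1 \<times> {0..1})" using p(2) by blast
    qed
  qed (auto simp: tube_def)
  moreover have "compact (\<Theta> ` (cball 0 1 \<times> {0..1}))"
    by (intro compact_continuous_image compact_Times compact_cball compact_Icc
        continuous_at_imp_continuous_on ballI nbhd(1)) auto
  ultimately show ?thesis by (simp add: compact_imp_closed)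
qed

lemma leaf_through_tube_curve:
  fixes A F F' :: "('m::t2_space, (real^'n::finite) \<times> real) chart set"
  assumes A: "smooth_atlas A" and nbhd: "foliated_tubular_nbhd A F \<gamma> \<Theta>"
    and F': "foliated_atlas A F'" and "a \<le> b" and cont: "continuous_on {a..b} h"
    and dom: "\<And>s. a \<le> s \<Longrightarrow> s \<le> b \<Longrightarrow> h s \<in> cball 0 1 \<times> UNIV"
    and der: "\<And>s. a < s \<Longrightarrow> s < b \<Longrightarrow> (h has_vector_derivative h' s) (at s)"
    and tangent: "\<And>s. a < s \<Longrightarrow> s < b \<Longrightarrow> h' s \<in> leaf_tangent F' \<Theta> (h s)"
  shows "leaf_through F' (\<Theta> (h a)) = leaf_through F' (\<Theta> (h b))"
proof (rule leaf_through_tangent_curve[OF F' \<open>a \<le> b\<close>])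
  note N = foliated_tubular_nbhdD[OF nbhd]
  show "continuous_on {a..b} (\<lambda>s. \<Theta> (h s))"
  proof (rule continuous_on_compose2[OF _ cont, where t = "cball 0 1 \<times> UNIV"])
    show "continuous_on (cball 0 1 \<times> UNIV) \<Theta>"
      by (intro continuous_at_imp_continuous_on ballI N(1))
    show "h ` {a..b} \<subseteq> cball 0 1 \<times> UNIV"
      by (intro image_subsetI dom) simp_all
  qed
  fix s \<psi> assume s: "a < s" "s < b" and \<psi>: "\<psi> \<in> F'" "\<Theta> (h s) \<in> fst \<psi>"
  have q: "h s \<in> cball 0 1 \<times> UNIV" using dom s by simp
  obtain c where c: "c \<in> A" "\<Theta> (h s) \<in> fst c" using smooth_atlasD(2)[OF A] by blast
  note diff = N(2)[OF q c]
  \<comment> \<open>Smoothness of \<open>\<Theta>\<close> is given in charts of \<open>A\<close> and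
    reaches \<open>\<psi>\<close> because \<open>A\<close> and \<open>F'\<close> together form a
    smooth atlas.\<close>
  then have "(snd \<psi> \<circ> \<Theta>) differentiable (at (h s))"
    using has_derivative_change_chart[OF foliated_atlasD(1)[OF F'] _ _ c(2) \<psi>(2) N(1)[OF q]] c \<psi>
    unfolding differentiable_def by blast
  then have D: "(snd \<psi> \<circ> \<Theta> has_derivative frechet_derivative (snd \<psi> \<circ> \<Theta>) (at (h s))) (at (h s))"
    using frechet_derivative_works by blast
  let ?D = "frechet_derivative (snd \<psi> \<circ> \<Theta>) (at (h s))"
  have "snd (?D (h' s)) = 0"
    using leaf_tangent_iff[OF F' _ c(2) N(1)[OF q] diff \<psi>] tangent[OF s] c by blast
  then have z: "snd (?D (x *\<^sub>R h' s)) = 0" for x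
    using linear_scale[OF has_derivative_linear[OF D]] by simp
  have "((\<lambda>s. (snd \<psi> \<circ> \<Theta>) (h s)) has_derivative (\<lambda>x. ?D (x *\<^sub>R h' s))) (at s)"
    by (rule has_derivative_compose[OF der[OF s, unfolded has_vector_derivative_def] D])
  from has_derivative_snd[OF this]
  show "((\<lambda>s. snd (snd \<psi> (\<Theta> (h s)))) has_real_derivative 0) (at s)"
    by (simp add: z has_field_derivative_def lambda_zero)
qed

text \<open>In the half plane of angle \<open>z\<close> the equation \<open>\<omega> = 0\<close>
  becomes \<open>dt/dr = turbulization_slope lam r\<close>, so graphs of primitives of the slope are
  leaf curves. Tangency is checked only for \<open>s > a\<close>, so the curve may start on the
  core, where the angle is undefined.\<close>

lemma leaf_through_turbulization_curve:
  fixes A F F' :: "('m::t2_space, (real^'n::finite) \<times> real) chart set"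
  assumes A: "smooth_atlas A" and nbhd: "foliated_tubular_nbhd A F \<gamma> \<Theta>"
    and turb: "turbulization A F \<Theta> lam F'" and z: "norm z = 1"
    and ab: "0 \<le> a" "a \<le> b" "b \<le> 1" and T: "continuous_on {a..b} T"
    and T': "\<And>s. a < s \<Longrightarrow> s < b \<Longrightarrow> (T has_real_derivative turbulization_slope lam s) (at s)"
    and sin: "\<And>s. a < s \<Longrightarrow> s < b \<Longrightarrow> sin (lam s) \<noteq> 0"
  shows "leaf_through F' (\<Theta> (a *\<^sub>R z, t + T a)) = leaf_through F' (\<Theta> (b *\<^sub>R z, t + T b))"
proof -
  have F': "foliated_atlas A F'"
    and ker: "\<And>q. q \<in> cball 0 1 \<times> UNIV \<Longrightarrow> leaf_tangent F' \<Theta> q = turbulization_kernel lam q"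
    using turb unfolding turbulization_def by blast+
  show ?thesis
  proof (rule leaf_through_tube_curve[OF A nbhd F' ab(2), where h = "\<lambda>s. (s *\<^sub>R z, t + T s)"
        and h' = "\<lambda>s. (z, turbulization_slope lam s)"])
    show "continuous_on {a..b} (\<lambda>s. (s *\<^sub>R z, t + T s))" using T by (intro continuous_intros)
    show dom: "(s *\<^sub>R z, t + T s) \<in> cball 0 1 \<times> UNIV" if "a \<le> s" "s \<le> b" for s
      using that ab z by simp
    fix s assume s: "a < s" "s < b"
    have "((\<lambda>s. t + T s) has_vector_derivative turbulization_slope lam s) (at s)"
      using T'[OF s] by (auto intro!: derivative_eq_intros simp: has_real_derivative_iff_has_vector_derivative[symmetric])
    moreover have "((\<lambda>s. s *\<^sub>R z) has_vector_derivative z) (at s)"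
      by (auto intro!: derivative_eq_intros)
    ultimately show "((\<lambda>s. (s *\<^sub>R z, t + T s)) has_vector_derivative (z, turbulization_slope lam s)) (at s)"
      by (rule has_vector_derivative_Pair[rotated])
    have "s > 0" using s ab by simp
    moreover have "z \<bullet> z = 1" using z by (simp add: norm_eq_1)
    \<comment> \<open>Here \<open>dr z = 1\<close>, and the slope solves
      \<open>cos + sin * slope = 0\<close>.\<close>
    ultimately have "(z, turbulization_slope lam s) \<in> turbulization_kernel lam (s *\<^sub>R z, t + T s)"
      using sin[OF s] z by (simp add: turbulization_kernel_def turbulization_slope_def)
    then show "(z, turbulization_slope lam s) \<in> leaf_tangent F' \<Theta> (s *\<^sub>R z, t + T s)"
      using ker[OF dom] s by simp
  qed
qed

text \<open>At a hit, \<open>\<tau>\<close> agrees with \<open>t\<close> modulo 1, so the point is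
  also \<open>\<Theta> (s *\<^sub>R z, t)\<close>, which tends to the limit point as
  \<open>s\<close> tends to \<open>2/3\<close>. The neighbourhoods in \<open>near\<close> turn this
  into \<open>f\<close>-convergence.\<close>

lemma spiral_limit_zero:
  fixes \<Theta> :: "(real^'n::finite) \<times> real \<Rightarrow> 'm::t2_space"
  assumes nbhd: "foliated_tubular_nbhd A F \<gamma> \<Theta>" and f: "pseudometric_on UNIV f"
    and near: "\<And>x e. e > 0 \<Longrightarrow> \<exists>U. open U \<and> x \<in> U \<and> (\<forall>y\<in>U. f x y < e)"
    and z: "norm z = 1"
    and hits: "\<And>\<delta>. \<delta> > 0 \<Longrightarrow> \<exists>s \<tau>. \<bar>s - 2/3\<bar> < \<delta> \<and> 0 \<le> s \<and> s \<le> 1 \<and> \<tau> - t \<in> \<int> \<and> f p (\<Theta> (s *\<^sub>R z, \<tau>)) = 0"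
  shows "f p (\<Theta> ((2/3) *\<^sub>R z, t)) = 0"
proof -
  note N = foliated_tubular_nbhdD[OF nbhd]
  let ?q = "\<Theta> ((2/3) *\<^sub>R z, t)"
  have "f p ?q \<le> e" if "e > 0" for e
  proof -
    obtain U where U: "open U" "?q \<in> U" "\<And>y. y \<in> U \<Longrightarrow> f ?q y < e" using near[OF \<open>e > 0\<close>, of ?q] by blast
    have "isCont (\<lambda>s. (s *\<^sub>R z, t)) (2/3)" by (intro continuous_intros)
    moreover have "isCont \<Theta> ((2/3) *\<^sub>R z, t)" by (rule N(1)) (simp add: z)
    ultimately have "isCont (\<lambda>s. \<Theta> (s *\<^sub>R z, t)) (2/3)" by (rule isCont_o2[where f = "\<lambda>s. (s *\<^sub>R z, t)"])
    then have "((\<lambda>s. \<Theta> (s *\<^sub>R z, t)) \<longlongrightarrow> ?q) (at (2/3))" by (simp add: isCont_def)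
    then have "\<forall>\<^sub>F s in at (2/3). \<Theta> (s *\<^sub>R z, t) \<in> U" using U(1,2) by (rule topological_tendstoD)
    then obtain \<delta> where \<delta>: "\<delta> > 0" "\<And>s. s \<noteq> 2/3 \<Longrightarrow> dist s (2/3) < \<delta> \<Longrightarrow> \<Theta> (s *\<^sub>R z, t) \<in> U"
      unfolding eventually_at by auto
    obtain s \<tau> where s: "\<bar>s - 2/3\<bar> < \<delta>" "0 \<le> s" "s \<le> 1" "\<tau> - t \<in> \<int>" "f p (\<Theta> (s *\<^sub>R z, \<tau>)) = 0"
      using hits[OF \<delta>(1)] by blast
    have "\<Theta> (s *\<^sub>R z, \<tau>) = \<Theta> (s *\<^sub>R z, t)" by (rule N(3)) (use s z in auto)
    then have "f p (\<Theta> (s *\<^sub>R z, t)) = 0" using s(5) by simp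
    moreover have "\<Theta> (s *\<^sub>R z, t) \<in> U"
    proof (cases "s = 2/3")
      case True
      show ?thesis unfolding True by (rule U(2))
    next
      case False
      then show ?thesis using \<delta>(2)[of s] s(1) by (simp add: dist_real_def)
    qed
    then have "f ?q (\<Theta> (s *\<^sub>R z, t)) < e" by (rule U(3))
    ultimately show ?thesis
      using pseudometric_onD(4)[OF f UNIV_I UNIV_I UNIV_I, of p ?q "\<Theta> (s *\<^sub>R z, t)"]
        pseudometric_onD(3)[OF f UNIV_I UNIV_I, of ?q "\<Theta> (s *\<^sub>R z, t)"] by linarith
  qed
  then have "f p ?q \<le> 0" using field_le_epsilon[of "f p ?q" 0] by simp
  then show ?thesis using pseudometric_onD(2)[OF f UNIV_I UNIV_I, of p ?q] by linarith
qed

lemma zero_on_tube_turbulization: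
  fixes A F F' :: "('m::t2_space, (real^'n::finite) \<times> real) chart set"
  assumes A: "smooth_atlas A" and nbhd: "foliated_tubular_nbhd A F \<gamma> \<Theta>"
    and turb: "turbulization A F \<Theta> lam F'" and prof: "turbulization_profile lam"
    and f: "pseudometric_on UNIV f"
    and near: "\<And>x e. e > 0 \<Longrightarrow> \<exists>U. open U \<and> x \<in> U \<and> (\<forall>y\<in>U. f x y < e)"
    and zero: "\<And>p q. leaf_through F' p = leaf_through F' q \<Longrightarrow> f p q = 0"
    and pq: "p \<in> tube \<Theta>" "q \<in> tube \<Theta>"
  shows "f p q = 0"
proof -
  let ?k = "turbulization_slope lam"
  note lam = turbulization_profileD(1-3)[OF prof]
  note tr = pseudometric_on_zero_trans[OF f UNIV_I UNIV_I UNIV_I]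
  have sy: "f x y = f y x" for x y using pseudometric_onD(3)[OF f] by blast
  obtain C \<delta>0 where C: "C > 0" "\<delta>0 > 0" "\<delta>0 \<le> 1/3"
    and left: "\<And>r. 2/3 - \<delta>0 < r \<Longrightarrow> r < 2/3 \<Longrightarrow> C / (2/3 - r) \<le> ?k r"
    and right: "\<And>r. 2/3 < r \<Longrightarrow> r < 2/3 + \<delta>0 \<Longrightarrow> C / (r - 2/3) \<le> - ?k r"
    using turbulization_slope_blowup[OF prof] by blast
  have contk: "continuous_on I ?k" if "I \<subseteq> {0..1} - {2/3}" for I
  proof -
    have "sin (lam s) \<noteq> 0" if "s \<in> I" for s
    proof -
      have "0 \<le> s" "s \<le> 1" "s \<noteq> 2/3" using that \<open>I \<subseteq> _\<close> by auto
      then show ?thesis using lam(2,3)[of s] by (cases "s < 2/3") auto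
    qed
    moreover have "continuous_on I lam" by (rule continuous_on_subset[OF lam(1)]) (use that in auto)
    ultimately show ?thesis unfolding turbulization_slope_def by (intro continuous_intros) auto
  qed

  \<comment> \<open>The height gained along a leaf from the core out to radius \<open>s\<close>; the
    slope is continuous on \<open>[0, 2/3)\<close>, so the primitive can be based at the
    core.\<close>
  define T where "T s = integral {0..s} ?k" for s
  have Tder: "(T has_real_derivative ?k s) (at s within {0..b})" if "0 \<le> s" "s \<le> b" "b < 2/3" for s b
    unfolding T_def by (rule integral_has_real_derivative) (use that in \<open>auto intro!: contk\<close>)
  have Tcont: "continuous_on {0..b} T" if "b < 2/3" for b
    using Tder[OF _ _ that] by (intro DERIV_continuous_on) auto
  have Tat: "(T has_real_derivative ?k s) (at s)" if "0 < s" "s < 2/3" for s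
  proof -
    have "(T has_real_derivative ?k s) (at s within {0..(s + 2/3) / 2})" by (rule Tder) (use that in auto)
    moreover have "at s within {0..(s + 2/3) / 2} = at s" using that by (intro at_within_Icc_at) auto
    ultimately show ?thesis by simp
  qed
  have core: "f (\<Theta> (0, t)) (\<Theta> (s *\<^sub>R z, t + T s)) = 0" if "norm z = 1" "0 \<le> s" "s < 2/3" for z s t
  proof (rule zero)
    have "leaf_through F' (\<Theta> (0 *\<^sub>R z, t + T 0)) = leaf_through F' (\<Theta> (s *\<^sub>R z, t + T s))"
    proof (rule leaf_through_turbulization_curve[OF A nbhd turb that(1) _ that(2) _ Tcont])
      fix r assume "0 < r" "r < s"
      then show "(T has_real_derivative ?k r) (at r)" "sin (lam r) \<noteq> 0"
        using Tat[of r] lam(2)[of r] that by auto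
    qed (use that in auto)
    then show "leaf_through F' (\<Theta> (0, t)) = leaf_through F' (\<Theta> (s *\<^sub>R z, t + T s))"
      by (simp add: T_def)
  qed
  \<comment> \<open>All half planes share the core, so one core point is linked to radius
    \<open>2/3\<close> at every angle \<open>z\<close> and every height \<open>t'\<close>.\<close>
  have inner: "f (\<Theta> (0, t)) (\<Theta> ((2/3) *\<^sub>R z, t')) = 0" if z: "norm z = 1" for z t t'
  proof (rule spiral_limit_zero[OF nbhd f near z])
    fix \<delta> :: real assume \<delta>: "\<delta> > 0"
    define a where "a = 2/3 - min \<delta> \<delta>0"
    have a: "0 < a" "a < 2/3" "2/3 - \<delta> \<le> a" "2/3 - \<delta>0 \<le> a" using \<delta> C by (auto simp: a_def)
    have "\<exists>s. a < s \<and> s < 2/3 \<and> T s - (t' - t) \<in> \<int>"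
      by (rule log_growth_hits_residue_class[OF C(1) a(2), where T' = ?k])
        (use a Tat left in auto)
    then obtain s where s: "a < s" "s < 2/3" "T s - (t' - t) \<in> \<int>" by blast
    have "(t + T s) - t' \<in> \<int>" using s(3) by (simp add: algebra_simps)
    moreover have "f (\<Theta> (0, t)) (\<Theta> (s *\<^sub>R z, t + T s)) = 0" using core[OF z, of s t] s a by simp
    ultimately show "\<exists>s \<tau>. \<bar>s - 2/3\<bar> < \<delta> \<and> 0 \<le> s \<and> s \<le> 1 \<and> \<tau> - t' \<in> \<int> \<and>
        f (\<Theta> (0, t)) (\<Theta> (s *\<^sub>R z, \<tau>)) = 0"
      using s a by (intro exI[of _ s] exI[of _ "t + T s"]) auto
  qed

  \<comment> \<open>On the outer side the primitive is based at \<open>r = 1\<close>, because the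
    slope is not integrable up to \<open>2/3\<close>.\<close>
  define V where "V s = - integral {s..1} ?k" for s
  have Vder: "(V has_real_derivative ?k s) (at s within {b..1})" if "b \<le> s" "s \<le> 1" "2/3 < b" for s b
  proof -
    have "((\<lambda>u. integral {u..1} ?k) has_real_derivative - ?k s) (at s within {b..1})"
      by (rule integral_has_real_derivative') (use that in \<open>auto intro!: contk\<close>)
    from DERIV_minus[OF this] show ?thesis by (simp add: V_def[abs_def])
  qed
  have Vcont: "continuous_on {b..1} V" if "2/3 < b" for b
    using Vder[OF _ _ that] by (intro DERIV_continuous_on) auto
  have Vat: "(V has_real_derivative ?k s) (at s)" if "2/3 < s" "s < 1" for s
  proof -
    have "(V has_real_derivative ?k s) (at s within {(s + 2/3) / 2..1})" by (rule Vder) (use that in auto)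
    moreover have "at s within {(s + 2/3) / 2..1} = at s" using that by (intro at_within_Icc_at) auto
    ultimately show ?thesis by simp
  qed
  have outer: "f (\<Theta> (r *\<^sub>R z, t)) (\<Theta> ((2/3) *\<^sub>R z, t')) = 0"
    if z: "norm z = 1" and r: "2/3 < r" "r \<le> 1" for z t t' r
  proof (rule spiral_limit_zero[OF nbhd f near z])
    fix \<delta> :: real assume \<delta>: "\<delta> > 0"
    \<comment> \<open>The reflection \<open>s \<mapsto> 4/3 - s\<close> fixes \<open>2/3\<close> and
      moves outer radii to its left, where the growth lemma applies with \<open>b = 2/3\<close>. The
      term \<open>r - 2/3\<close> ensures that the radius reflected back is below
      \<open>r\<close>.\<close>
    define a where "a = 2/3 - min (r - 2/3) (min \<delta> \<delta>0)"
    have a: "1/3 \<le> a" "a < 2/3" "2/3 - \<delta> \<le> a" "2/3 - \<delta>0 \<le> a" "2/3 - (r - 2/3) \<le> a"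
      using \<delta> C r unfolding a_def by linarith+
    have "\<exists>s. a < s \<and> s < 2/3 \<and> V (4/3 - s) - (t' - (t - V r)) \<in> \<int>"
    proof (rule log_growth_hits_residue_class[OF C(1) a(2), where T' = "\<lambda>s. - ?k (4/3 - s)"])
      fix s assume s: "a < s" "s < 2/3"
      have "(V has_real_derivative ?k (4/3 - s)) (at (4/3 - s))" by (rule Vat) (use s a in auto)
      moreover have "((\<lambda>s. 4/3 - s) has_real_derivative - 1) (at s)"
        by (auto intro!: derivative_eq_intros)
      ultimately show "((\<lambda>s. V (4/3 - s)) has_real_derivative - ?k (4/3 - s)) (at s)"
        using DERIV_chain2[of V "?k (4/3 - s)" "\<lambda>s. 4/3 - s" s "-1" UNIV] by simp
      show "C / (2/3 - s) \<le> - ?k (4/3 - s)" using right[of "4/3 - s"] s a by simp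
    qed
    then obtain s' where s': "a < s'" "s' < 2/3" "V (4/3 - s') - (t' - (t - V r)) \<in> \<int>" by blast
    define s where "s = 4/3 - s'"
    have s: "2/3 < s" "s < r" "s - 2/3 < \<delta>" "(t - V r + V s) - t' \<in> \<int>"
      using s' a by (auto simp: s_def algebra_simps)
    \<comment> \<open>The offset \<open>t - V r\<close> makes the leaf curve pass through the given
      point at radius \<open>r\<close> and height \<open>t\<close>.\<close>
    have "leaf_through F' (\<Theta> (s *\<^sub>R z, (t - V r) + V s)) = leaf_through F' (\<Theta> (r *\<^sub>R z, (t - V r) + V r))"
    proof (rule leaf_through_turbulization_curve[OF A nbhd turb z])
      show "continuous_on {s..r} V" by (rule continuous_on_subset[OF Vcont[OF s(1)]]) (use r in auto)
      fix u assume "s < u" "u < r"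
      then show "(V has_real_derivative ?k u) (at u)" "sin (lam u) \<noteq> 0"
        using Vat[of u] lam(3)[of u] s r by auto
    qed (use s r in auto)
    then have "f (\<Theta> (r *\<^sub>R z, t)) (\<Theta> (s *\<^sub>R z, t - V r + V s)) = 0" by (intro zero) simp
    then show "\<exists>s \<tau>. \<bar>s - 2/3\<bar> < \<delta> \<and> 0 \<le> s \<and> s \<le> 1 \<and> \<tau> - t' \<in> \<int> \<and>
        f (\<Theta> (r *\<^sub>R z, t)) (\<Theta> (s *\<^sub>R z, \<tau>)) = 0"
      using s r by (intro exI[of _ s] exI[of _ "t - V r + V s"]) auto
  qed

  obtain e :: "real^'n" where e: "norm e = 1"
    using vector_choose_size[of 1] by auto
  \<comment> \<open>Two core points are compared through a common limit point at radius
    \<open>2/3\<close>.\<close>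
  have axis: "f (\<Theta> (0, 0)) (\<Theta> (0, t)) = 0" for t
    using tr[OF inner[OF e, of 0 0]] inner[OF e, of t 0] sy by metis
  \<comment> \<open>One core point serves as hub. Points inside radius \<open>2/3\<close> reach it
    along their leaf and the core, points outside through a limit point at radius
    \<open>2/3\<close>.\<close>
  have hub: "f (\<Theta> (0, 0)) (\<Theta> (x, t)) = 0" if x: "norm x \<le> 1" for x t
  proof (cases "x = 0")
    case True
    then show ?thesis using axis by simp
  next
    case False
    define z where "z = x /\<^sub>R norm x"
    have z: "norm z = 1" "x = norm x *\<^sub>R z" using False by (auto simp: z_def)
    consider "norm x < 2/3" | "norm x = 2/3" | "2/3 < norm x" by linarith
    then show ?thesis
    proof cases
      case 1
      have "f (\<Theta> (0, t - T (norm x))) (\<Theta> (x, t)) = 0"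
        using core[OF z(1) _ 1, of "t - T (norm x)"] unfolding z(2)[symmetric] by simp
      then show ?thesis using tr[OF axis] by blast
    next
      case 2
      show ?thesis using inner[OF z(1), of 0 t] unfolding 2[symmetric] z(2)[symmetric] .
    next
      case 3
      have "f (\<Theta> (x, t)) (\<Theta> ((2/3) *\<^sub>R z, 0)) = 0" 
        using outer[OF z(1) 3 x, of t 0] unfolding z(2)[symmetric] .
      then show ?thesis using tr[OF inner[OF z(1)]] sy by metis
    qed
  qed
  then have "f (\<Theta> (0, 0)) p = 0" if "p \<in> tube \<Theta>" for p
    using that unfolding tube_def by auto
  then show ?thesis using tr pq sy by metis
qed

section \<open>Comparing the leaf spaces\<close>

lemma set_dist_properties:
  fixes d :: "'m \<Rightarrow> 'm \<Rightarrow> real"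
  assumes nonneg: "\<And>x y. 0 \<le> d x y" and sym: "\<And>x y. d x y = d y x" and refl: "\<And>x. d x x = 0"
  shows set_dist_nonneg: "L \<noteq> {} \<Longrightarrow> L' \<noteq> {} \<Longrightarrow> 0 \<le> set_dist d L L'"
    and set_dist_commute: "set_dist d L L' = set_dist d L' L"
    and set_dist_le: "x \<in> L \<Longrightarrow> y \<in> L' \<Longrightarrow> set_dist d L L' \<le> d x y"
    and set_dist_refl: "L \<noteq> {} \<Longrightarrow> set_dist d L L = 0"
proof -
  show nn: "0 \<le> set_dist d L L'" if "L \<noteq> {}" "L' \<noteq> {}" for L L'
    unfolding set_dist_def by (rule cInf_greatest) (use that nonneg in blast)+
  have "{d x y | x y. x \<in> L \<and> y \<in> L'} = {d x y | x y. x \<in> L' \<and> y \<in> L}" using sym by blast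
  then show "set_dist d L L' = set_dist d L' L" by (simp add: set_dist_def)
  show le: "set_dist d L L' \<le> d x y" if "x \<in> L" "y \<in> L'" for x y L L'
    unfolding set_dist_def
  proof (rule cInf_lower)
    show "bdd_below {d x y | x y. x \<in> L \<and> y \<in> L'}" using nonneg by (intro bdd_belowI[of _ 0]) blast
  qed (use that in blast)
  show "set_dist d L L = 0" if L: "L \<noteq> {}"
  proof -
    obtain x where "x \<in> L" using L by blast
    then show ?thesis using le[of x L x L] nn[OF L L] refl[of x] by simp
  qed
qed

section \<open>The leaf space of a single foliation\<close>

context
  fixes d :: "'m::topological_space \<Rightarrow> 'm \<Rightarrow> real" and A F :: "('m, (real^'n::finite) \<times> real) chart set"
  assumes nonneg: "\<And>x y. 0 \<le> d x y" and sym: "\<And>x y. d x y = d y x" and refl: "\<And>x. d x x = 0"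
    and F: "foliated_atlas A F"
begin

lemma leaves_nonempty: "L \<in> leaves F \<Longrightarrow> L \<noteq> {}"
  using leaf_through_self[OF F] unfolding leaves_eq[OF F] by blast

lemma leaf_through_in_leaves: "leaf_through F x \<in> leaves F"
  unfolding leaves_eq[OF F] by blast

lemma leaf_chain_dist_leaves_eq: "leaf_chain_dist d (leaves F) = glued_dist (leaves F) (set_dist d) Id"
  by (rule leaf_chain_dist_eq_glued_dist) (simp add: leaves_nonempty set_dist_refl[OF nonneg sym refl])

lemma glue_set_dist_nonneg: "L \<in> leaves F \<Longrightarrow> L' \<in> leaves F \<Longrightarrow> 0 \<le> set_dist d L L'"
  by (simp add: leaves_nonempty set_dist_nonneg[OF nonneg sym refl])

lemma pseudometric_on_leaf_chain_dist: "pseudometric_on (leaves F) (leaf_chain_dist d (leaves F))"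
proof -
  \<comment> \<open>Chains never leave \<open>leaves F\<close>, so cutting the gluing relation down
    to the carrier changes no chain.\<close>
  have glue: "glued_dist (leaves F) (set_dist d) Id = glued_dist (leaves F) (set_dist d) (Id_on (leaves F))"
  proof (intro ext)
    fix L L'
    have "glue_chain (leaves F) (set_dist d) Id L L' s \<longleftrightarrow>
        glue_chain (leaves F) (set_dist d) (Id_on (leaves F)) L L' s" for s
    proof
      show "glue_chain (leaves F) (set_dist d) (Id_on (leaves F)) L L' s"
        if "glue_chain (leaves F) (set_dist d) Id L L' s"
        using that by (induction rule: glue_chain.induct) (auto intro: glue_chain.intros)
      show "glue_chain (leaves F) (set_dist d) Id L L' s"
        if "glue_chain (leaves F) (set_dist d) (Id_on (leaves F)) L L' s"
        using that by (induction rule: glue_chain.induct) (auto intro: glue_chain.intros)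
    qed
    then show "glued_dist (leaves F) (set_dist d) Id L L' =
        glued_dist (leaves F) (set_dist d) (Id_on (leaves F)) L L'"
      by (simp add: glued_dist_eq_Inf)
  qed
  show ?thesis
    unfolding leaf_chain_dist_leaves_eq glue
  proof (rule pseudometric_on_glued_dist)
    show "refl_on (leaves F) (Id_on (leaves F))" by (auto simp: refl_on_def)
    show "sym (Id_on (leaves F))" by (rule sym_Id_on)
    fix L L' assume "L \<in> leaves F"
    then show "set_dist d L L = 0" by (simp add: leaves_nonempty set_dist_refl[OF nonneg sym refl])
    assume "L' \<in> leaves F"
    with \<open>L \<in> leaves F\<close> show "0 \<le> set_dist d L L'" by (rule glue_set_dist_nonneg)
    show "set_dist d L L' = set_dist d L' L" by (rule set_dist_commute[OF nonneg sym refl])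
  qed
qed

lemma leaf_chain_dist_le: "leaf_chain_dist d (leaves F) (leaf_through F x) (leaf_through F y) \<le> d x y"
proof -
  have "glue_chain (leaves F) (set_dist d) Id (leaf_through F x) (leaf_through F y)
      (set_dist d (leaf_through F x) (leaf_through F y))"
    by (rule glue_chain.single) (rule leaf_through_in_leaves)+
  then have "leaf_chain_dist d (leaves F) (leaf_through F x) (leaf_through F y)
     \<le> set_dist d (leaf_through F x) (leaf_through F y)"
    unfolding leaf_chain_dist_leaves_eq
    by (intro glued_dist_le[where d = "set_dist d", OF glue_set_dist_nonneg])
  also have "\<dots> \<le> d x y"
    by (rule set_dist_le[OF nonneg sym refl]) (rule leaf_through_self[OF F])+
  finally show ?thesis .
qed

text \<open>As \<open>f\<close> vanishes along leaves, \<open>f x y = f u v\<close> for all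
  \<open>u\<close> and \<open>v\<close> on the leaves of \<open>x\<close> and \<open>y\<close>.
  Hence \<open>f\<close> is below \<open>set_dist\<close>, and maximality of the glued distance does
  the rest.\<close>

lemma le_leaf_chain_dist:
  assumes f: "pseudometric_on UNIV f" and le: "\<And>x y. f x y \<le> d x y"
    and zero: "\<And>x y. leaf_through F x = leaf_through F y \<Longrightarrow> f x y = 0"
  shows "f x y \<le> leaf_chain_dist d (leaves F) (leaf_through F x) (leaf_through F y)"
  unfolding leaf_chain_dist_leaves_eq
proof (rule le_glued_dist[OF f])
  show "leaves F = range (leaf_through F)" by (rule leaves_eq[OF F])
  show "f x y = 0" if "(leaf_through F x, leaf_through F y) \<in> Id" for x y using zero that by simp
  show "f x y \<le> set_dist d (leaf_through F x) (leaf_through F y)" for x y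
    unfolding set_dist_def
  proof (rule cInf_greatest)
    show "{d u v |u v. u \<in> leaf_through F x \<and> v \<in> leaf_through F y} \<noteq> {}"
      using leaf_through_self[OF F] by blast
    fix s assume "s \<in> {d u v |u v. u \<in> leaf_through F x \<and> v \<in> leaf_through F y}"
    then obtain u v where uv: "s = d u v" "u \<in> leaf_through F x" "v \<in> leaf_through F y" by blast
    then have "f x u = 0" "f y v = 0" using zero leaf_through_eq_iff[OF F] by blast+
    then have "f x y = f u y" "f u y = f u v"
      using pseudometric_on_cong_left[OF f UNIV_I UNIV_I UNIV_I] pseudometric_onD(3)[OF f UNIV_I UNIV_I]
      by metis+
    then show "f x y \<le> s" using le[of u v] uv by simp
  qed
qed auto

lemma hls_points_eq: "hls_points d F = range (hls_proj d F)"
  unfolding hls_points_def zero_dist_classes_eq leaves_eq[OF F] hls_proj_def by blast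

lemma hls_dist_proj: "hls_dist d F (hls_proj d F x) (hls_proj d F y) =
    leaf_chain_dist d (leaves F) (leaf_through F x) (leaf_through F y)"
  unfolding hls_dist_def hls_proj_def
  by (rule class_dist_zero_dist_class[OF pseudometric_on_leaf_chain_dist leaf_through_in_leaves leaf_through_in_leaves])

lemma pseudometric_on_hls_dist: "pseudometric_on (hls_points d F) (hls_dist d F)"
  unfolding hls_points_def hls_dist_def
  by (rule pseudometric_on_class_dist[OF pseudometric_on_leaf_chain_dist])

end

lemma pseudometric_on_glued_dist_collapse:
  assumes "pseudometric_on Y d" "P \<subseteq> Y"
  shows "pseudometric_on Y (glued_dist Y d (collapse_rel Y P))"
proof (rule pseudometric_on_glued_dist)
  show "refl_on Y (collapse_rel Y P)" "sym (collapse_rel Y P)"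
    by (auto simp: refl_on_def collapse_rel_def sym_def)
qed (use assms pseudometric_onD[OF assms(1)] in blast)+

text \<open>Each disc of constant \<open>t\<close> is a leaf of the restriction to the tube, hence
  connected in the leaf topology, and it meets the core.\<close>

lemma leaf_through_tube:
  assumes F: "foliated_atlas A F" and nbhd: "foliated_tubular_nbhd A F \<gamma> \<Theta>" and x: "x \<in> cball 0 1"
  shows "leaf_through F (\<Theta> (x, t)) = leaf_through F (\<Theta> (0, t))"
proof (rule leaf_through_eqI)
  have "\<Theta> ` (cball 0 1 \<times> {t}) \<in> leaves_of_restriction F (tube \<Theta>)"
    unfolding foliated_tubular_nbhdD(4)[OF nbhd] by blast
  then have "connectedin (subtopology (leaf_topology F) (tube \<Theta>)) (\<Theta> ` (cball 0 1 \<times> {t}))"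
    unfolding leaves_of_restriction_def by (rule connectedin_connected_components_of)
  then show "connectedin (leaf_topology F) (\<Theta> ` (cball 0 1 \<times> {t}))"
    by (simp add: connectedin_subtopology)
qed (use x in auto)

theorem theorem4p3:
  fixes A F F\<^sub>\<gamma> :: "('m::t2_space, (real^'n::finite) \<times> real) chart set"
    and g :: "('m, (real^'n) \<times> real) chart \<Rightarrow> 'm \<Rightarrow> (real^'n) \<times> real \<Rightarrow> (real^'n) \<times> real \<Rightarrow> real"
    and \<gamma> :: "real \<Rightarrow> 'm"
    and \<Theta> :: "(real^'n) \<times> real \<Rightarrow> 'm"
    and lam :: "real \<Rightarrow> real"
  defines "d \<equiv> riemannian_dist A g"
  defines "R \<equiv> collapse_rel (hls_points d F) (hls_proj d F ` \<gamma> ` {0..1})"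
  assumes "compact (UNIV :: 'm set)" and "connected (UNIV :: 'm set)"
    and "smooth_atlas A" and "riemannian_metric A g"
    and "foliated_atlas A F"
    and "leafwise_orientable A F" and "transversely_orientable A F"
    and "simple_closed_transversal A F \<gamma>"
    and "foliated_tubular_nbhd A F \<gamma> \<Theta>"
    and "turbulization_profile lam"
    and "turbulization A F \<Theta> lam F\<^sub>\<gamma>"
  shows "isometric (hls_points d F\<^sub>\<gamma>) (hls_dist d F\<^sub>\<gamma>)
           (quotient_points (hls_points d F) (hls_dist d F) R)
           (quotient_dist (hls_points d F) (hls_dist d F) R)"
proof -
  note A = \<open>smooth_atlas A\<close> and F = \<open>foliated_atlas A F\<close>
    and nbhd = \<open>foliated_tubular_nbhd A F \<gamma> \<Theta>\<close> and turb = \<open>turbulization A F \<Theta> lam F\<^sub>\<gamma>\<close>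
  have F': "foliated_atlas A F\<^sub>\<gamma>" using turb by (simp add: turbulization_def)
  have tangent: "leaf_tangent F\<^sub>\<gamma> (chart_inv c) (snd c p) = leaf_tangent F (chart_inv c) (snd c p)"
    if "c \<in> A" "p \<in> fst c - tube \<Theta>" for c p
    using turb that unfolding turbulization_def by blast
  note riem = A \<open>riemannian_metric A g\<close> \<open>connected (UNIV :: 'm set)\<close>
  have d: "\<And>x y. 0 \<le> d x y" "\<And>x y. d x y = d y x" "\<And>x. d x x = 0"
    unfolding d_def by (rule riemannian_dist_nonneg[OF riem], rule riemannian_dist_commute[OF riem],
      rule riemannian_dist_refl[OF riem])
  let ?\<rho> = "leaf_chain_dist d (leaves F)" and ?\<rho>' = "leaf_chain_dist d (leaves F\<^sub>\<gamma>)"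
  let ?Y = "hls_points d F"
  let ?\<delta> = "glued_dist ?Y (hls_dist d F) R"
  \<comment> \<open>Both distances are pulled back to points of the manifold, where they can be
    compared although the two quotients have elements of different types.\<close>
  define \<sigma> where "\<sigma> x y = ?\<rho>' (leaf_through F\<^sub>\<gamma> x) (leaf_through F\<^sub>\<gamma> y)" for x y
  define \<tau> where "\<tau> x y = ?\<delta> (hls_proj d F x) (hls_proj d F y)" for x y
  note psm' = pseudometric_on_leaf_chain_dist[where d = d, OF d F']
  have psm: "pseudometric_on ?Y ?\<delta>"
    unfolding R_def by (rule pseudometric_on_glued_dist_collapse[OF pseudometric_on_hls_dist[where d = d, OF d F]])
      (auto simp: hls_points_eq[where d = d, OF d F])
  have proj_Y: "hls_proj d F x \<in> ?Y" for x by (simp add: hls_points_eq[where d = d, OF d F])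

  have \<sigma>: "pseudometric_on UNIV \<sigma>"
    unfolding \<sigma>_def by (rule pseudometric_on_pullback[OF psm']) (auto simp: leaves_eq[OF F'])
  have \<sigma>_le: "\<sigma> x y \<le> d x y" for x y unfolding \<sigma>_def by (rule leaf_chain_dist_le[where d = d, OF d F'])
  have \<sigma>_leaf: "\<sigma> x y = 0" if "leaf_through F\<^sub>\<gamma> x = leaf_through F\<^sub>\<gamma> y" for x y
    unfolding \<sigma>_def that
    using pseudometric_onD(1)[OF psm' leaf_through_in_leaves[where d = d, OF d F'] leaf_through_in_leaves[where d = d, OF d F']] .
  have \<sigma>_tube: "\<sigma> p q = 0" if "p \<in> tube \<Theta>" "q \<in> tube \<Theta>" for p q
  proof (rule zero_on_tube_turbulization[OF A nbhd turb \<open>turbulization_profile lam\<close> \<sigma> _ \<sigma>_leaf that])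
    fix x and e :: real assume "e > 0"
    then obtain U where "open U" "x \<in> U" "\<And>y. y \<in> U \<Longrightarrow> d x y < e"
      using riemannian_dist_nearby[OF riem \<open>e > 0\<close>, where x = x] unfolding d_def by blast
    then show "\<exists>U. open U \<and> x \<in> U \<and> (\<forall>y\<in>U. \<sigma> x y < e)"
      using \<sigma>_le by (intro exI[of _ U]) (auto intro: le_less_trans)
  qed
  have \<sigma>_leaf_F: "\<sigma> x y = 0" if "leaf_through F x = leaf_through F y" for x y
    by (rule zero_on_leaves_change_foliation[OF A F F' \<sigma> closed_tube[OF nbhd] \<sigma>_leaf \<sigma>_tube _ that])
      (simp_all add: tangent)

  have \<tau>: "pseudometric_on UNIV \<tau>"
    unfolding \<tau>_def by (rule pseudometric_on_pullback[OF psm]) (use proj_Y in auto)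
  have \<tau>_leaf: "\<tau> x y = 0" if "leaf_through F x = leaf_through F y" for x y
  proof -
    have "hls_proj d F x = hls_proj d F y" using that by (simp add: hls_proj_def)
    then show ?thesis unfolding \<tau>_def using pseudometric_onD(1)[OF psm proj_Y proj_Y] by simp
  qed
  have \<tau>_le_hls: "\<tau> x y \<le> hls_dist d F (hls_proj d F x) (hls_proj d F y)" for x y
    unfolding \<tau>_def
    by (rule glued_dist_le[where d = "hls_dist d F"])
      (auto intro: pseudometric_onD(2)[OF pseudometric_on_hls_dist[where d = d, OF d F]] glue_chain.single proj_Y)
  have \<tau>_le: "\<tau> x y \<le> d x y" for x y
    using \<tau>_le_hls[of x y] leaf_chain_dist_le[where d = d and x = x and y = y, OF d F] unfolding hls_dist_proj[where d = d, OF d F] by linarith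
  have tube_R: "hls_proj d F p \<in> hls_proj d F ` \<gamma> ` {0..1}" if p: "p \<in> tube \<Theta>" for p
  proof -
    obtain x t where xt: "p = \<Theta> (x, t)" "x \<in> cball 0 1" using p unfolding tube_def by blast
    have "hls_proj d F p = hls_proj d F (\<Theta> (0, t))"
      using leaf_through_tube[OF F nbhd xt(2)] by (simp add: xt(1) hls_proj_def)
    then show ?thesis unfolding foliated_tubular_nbhdD(5)[OF nbhd] by blast
  qed
  have \<tau>_R: "\<tau> x y = 0" if "(hls_proj d F x, hls_proj d F y) \<in> R" for x y
  proof -
    let ?x = "hls_proj d F x" and ?y = "hls_proj d F y"
    have "glue_chain ?Y (hls_dist d F) R ?y ?y (hls_dist d F ?y ?y)"
      by (rule glue_chain.single) (rule proj_Y)+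
    moreover have "(?y, ?x) \<in> R" using that by (auto simp: R_def collapse_rel_def)
    \<comment> \<open>Two degenerate pairs of length zero with one jump along \<open>R\<close>
      between them.\<close>
    ultimately have "glue_chain ?Y (hls_dist d F) R ?x ?y (hls_dist d F ?x ?x + hls_dist d F ?y ?y)"
      using proj_Y by (intro glue_chain.step[where p' = ?y and q = ?x])
    moreover have "hls_dist d F z z = 0" if "z \<in> ?Y" for z
      by (rule pseudometric_onD(1)[OF pseudometric_on_hls_dist[where d = d, OF d F] that that])
    ultimately have "glue_chain ?Y (hls_dist d F) R ?x ?y 0" using proj_Y by simp
    then have "\<tau> x y \<le> 0"
      unfolding \<tau>_def by (intro glued_dist_le[where d = "hls_dist d F"])
        (auto intro: pseudometric_onD(2)[OF pseudometric_on_hls_dist[where d = d, OF d F]])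
    then show ?thesis using pseudometric_onD(2)[OF \<tau> UNIV_I UNIV_I, of x y] by simp
  qed
  have \<tau>_tube: "\<tau> p q = 0" if "p \<in> tube \<Theta>" "q \<in> tube \<Theta>" for p q
    by (rule \<tau>_R) (use tube_R that proj_Y in \<open>auto simp: R_def collapse_rel_def\<close>)
  have \<tau>_leaf_F': "\<tau> x y = 0" if "leaf_through F\<^sub>\<gamma> x = leaf_through F\<^sub>\<gamma> y" for x y
    by (rule zero_on_leaves_change_foliation[OF A F' F \<tau> closed_tube[OF nbhd] \<tau>_leaf \<tau>_tube _ that])
      (simp_all add: tangent)

  have "\<tau> x y \<le> \<sigma> x y" for x y
    unfolding \<sigma>_def by (rule le_leaf_chain_dist[where d = d, OF d F' \<tau> \<tau>_le \<tau>_leaf_F'])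
  moreover have "\<sigma> x y \<le> \<tau> x y" for x y
    unfolding \<tau>_def
  proof (rule le_glued_dist[OF \<sigma> hls_points_eq[where d = d, OF d F]])
    show "\<sigma> x y \<le> hls_dist d F (hls_proj d F x) (hls_proj d F y)" for x y
      unfolding hls_dist_proj[where d = d, OF d F] by (rule le_leaf_chain_dist[where d = d, OF d F \<sigma> \<sigma>_le \<sigma>_leaf_F])
    fix x y assume xy: "(hls_proj d F x, hls_proj d F y) \<in> R"
    \<comment> \<open>Equal projections mean leaves at \<open>\<rho>\<close>-distance zero, which
      may be distinct; so the maximality of \<open>\<rho>\<close> is used rather than
      \<open>\<sigma>_leaf_F\<close>.\<close>
    have \<sigma>_proj: "\<sigma> u v = 0" if "hls_proj d F u = hls_proj d F v" for u v
    proof -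
      have "\<sigma> u v \<le> hls_dist d F (hls_proj d F u) (hls_proj d F v)"
        unfolding hls_dist_proj[where d = d, OF d F] by (rule le_leaf_chain_dist[where d = d, OF d F \<sigma> \<sigma>_le \<sigma>_leaf_F])
      also have "\<dots> = 0"
        unfolding that by (rule pseudometric_onD(1)[OF pseudometric_on_hls_dist[where d = d, OF d F] proj_Y proj_Y])
      finally show ?thesis using pseudometric_onD(2)[OF \<sigma> UNIV_I UNIV_I, of u v] by simp
    qed
    show "\<sigma> x y = 0"
    proof (cases "hls_proj d F x = hls_proj d F y")
      case True
      then show ?thesis by (rule \<sigma>_proj)
    next
      case False
      \<comment> \<open>Distinct classes related by \<open>R\<close> both come from \<gamma>. By
        \<open>\<sigma>_proj\<close> the points \<open>x\<close> and \<open>y\<close> may be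
        replaced by points of \<gamma>, which lie in the tube.\<close>
      then obtain s t where st: "hls_proj d F x = hls_proj d F (\<gamma> s)" "s \<in> {0..1}"
        "hls_proj d F y = hls_proj d F (\<gamma> t)" "t \<in> {0..1}"
        using xy unfolding R_def collapse_rel_def by blast
      have "\<gamma> ` {0..1} \<subseteq> tube \<Theta>" unfolding foliated_tubular_nbhdD(5)[OF nbhd] tube_def by auto
      then have "\<sigma> (\<gamma> s) (\<gamma> t) = 0" using st by (intro \<sigma>_tube) auto
      moreover have "\<sigma> x (\<gamma> s) = 0" "\<sigma> (\<gamma> t) y = 0" using st by (auto intro: \<sigma>_proj)
      ultimately show ?thesis using pseudometric_on_zero_trans[OF \<sigma> UNIV_I UNIV_I UNIV_I] by blast
    qed
  qed auto
  ultimately have eq: "\<sigma> x y = \<tau> x y" for x y by (simp add: order_antisym)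
  have "isometric (zero_dist_classes (leaves F\<^sub>\<gamma>) ?\<rho>') (class_dist ?\<rho>')
      (zero_dist_classes ?Y ?\<delta>) (class_dist ?\<delta>)"
    by (rule isometric_zero_dist_classes[OF psm' psm leaves_eq[OF F', symmetric] hls_points_eq[where d = d, OF d F, symmetric]])
      (use eq in \<open>simp add: \<sigma>_def \<tau>_def\<close>)
  then show ?thesis
    by (simp add: hls_points_def[of d F\<^sub>\<gamma>] hls_dist_def[of d F\<^sub>\<gamma>] quotient_points_def quotient_dist_def)
qed

end
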